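(* Let $\phi\ge0$ be a non-trivial communication kernel which is either smooth, i.e. $\phi\in C^1([0,\infty))$, or singular, i.e. $\phi\in C^1((0,\infty))$ with $\int_0^1\phi(r)\,dr=\infty$. Consider the discrete Cucker--Smale system on the circle $\mathbb{T}$. Then the following alignment holds for any solution. (i) $\mathcal{V}_2(t)\le \dfrac{C N}{t}$ as $t\to\infty$, where $C$ depends on the initial condition only. (ii) For sub-quadratic singularities, i.e. if $\sup_{r<r_0}r^2\phi(r)<\infty$ for some $r_0>0$, one has $$\mathcal{V}_2(t)\le C\,\frac{\ln t}{t},\qquad t\to\infty,$$ where $C$ depends only on the initial condition. (iii) If the kernel satisfies the more singular assumption that, for some $r_0,\lambda,\Lambda>0$ and some $\beta>2$, $$\mathbf{1}_{r<r_0}\frac{\lambda}{r^\beta}\le\phi(r)\le\frac{\Lambda}{r^\beta},$$ then $\mathcal{V}_2(t)\to0$ as $t\to\infty$, with a rate independent of $N$. In case (ii), and in case (iii) in the range $2<\beta<3$, the result holds for any strong solution $(\rho,v)$ of the Euler alignment system on $\mathbb{T}$ as well, with $\mathcal{V}_2$ the hydrodynamic variation: under the hypothesis of (ii), $\mathcal{V}_2(t)\le C\frac{\ln t}{t}$ as $t\to\infty$, with $C$ depending only on the initial condition; under the hypothesis of (iii) with $2<\beta<3$, $\mathcal{V}_2(t)\to0$ as $t\to\infty$.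
   Context: $\mathbb{T}=\mathbb{R}/2\pi\mathbb{Z}$ is the one-dimensional torus, and $|x-y|$ denotes the distance on $\mathbb{T}$. The kernel $\phi$ is fixed; non-trivial means that it is not identically zero on the range of distances in $\mathbb{T}$. Discrete Cucker--Smale system on $\mathbb{T}$: for $N$ agents with $(x_i,v_i)\in\mathbb{T}\times\mathbb{R}$, $i=1,\dots,N$, $$\dot x_i=v_i,\qquad \dot v_i=\frac1N\sum_{j=1}^N\phi(|x_i-x_j|)(v_j-v_i),$$ where the $j=i$ term is zero. For singular kernels the initial datum is taken non-collisional ($x_i(0)\neq x_j(0)$ for $i\ne j$); the solution then stays non-collisional and is unique and global. Discrete variation: $\mathcal{V}_2(t)=\frac1{N^2}\sum_{i,j=1}^N|v_i(t)-v_j(t)|^2$. Euler alignment system on $\mathbb{T}$, for density $\rho(x,t)\ge0$ and velocity $v(x,t)\in\mathbb{R}$: $$\partial_t\rho+\partial_x(v\rho)=0,\qquad \partial_t v+v\,\partial_x v=\int_{\mathbb{T}}\phi(|x-y|)\,(v(y,t)-v(x,t))\,\rho(y,t)\,dy ,$$ the integral being understood in the principal value sense where needed for singular $\phi$. A strong solution is a given solution on $t\ge0$ that is regular enough for both equations to hold in the classical sense (its existence is not part of the statement); vacuum ($\rho=0$ on some set) is allowed. Hydrodynamic variation: $\mathcal{V}_2(t)=\int_{\mathbb{T}\times\mathbb{T}}|v(x,t)-v(y,t)|^2\rho(x,t)\rho(y,t)\,dx\,dy$. *)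

theory Defs
  imports "HOL-Analysis.Analysis"
begin

text \<open>Points of the circle of length \<open>2\<pi>\<close> are represented by real numbers: trajectories are
  differentiable lifts to the line, and fields on the circle are \<open>2\<pi>\<close>-periodic functions on the
  line.\<close>

definition torus_dist :: "real \<Rightarrow> real \<Rightarrow> real" where
  "torus_dist x y = (INF k::int. \<bar>x - y + 2 * pi * of_int k\<bar>)"


section \<open>Communication kernels\<close>

text \<open>A kernel is a function of \<open>r > 0\<close>, or of \<open>r \<ge> 0\<close> in the smooth case; for a singular kernel
  the value \<open>\<phi> 0\<close> is arbitrary and carries no meaning.\<close>

definition C1_on :: "real set \<Rightarrow> (real \<Rightarrow> real) \<Rightarrow> bool" where
  "C1_on S f \<longleftrightarrow> (\<exists>f'. (\<forall>r\<in>S. (f has_real_derivative f' r) (at r within S)) \<and> continuous_on S f')"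

definition smooth_kernel :: "(real \<Rightarrow> real) \<Rightarrow> bool" where
  "smooth_kernel \<phi> \<longleftrightarrow> C1_on {0..} \<phi>"

definition singular_kernel :: "(real \<Rightarrow> real) \<Rightarrow> bool" where
  "singular_kernel \<phi> \<longleftrightarrow>
     C1_on {0<..} \<phi> \<and> (\<integral>\<^sup>+ r\<in>{0<..1}. ennreal (\<phi> r) \<partial>lborel) = \<infinity>"

text \<open>The distances between distinct points of the circle fill the interval from \<open>0\<close> (excluded)
  to \<open>\<pi>\<close>. Including \<open>0\<close> would change nothing for a smooth kernel, by continuity.\<close>

definition nontrivial_kernel :: "(real \<Rightarrow> real) \<Rightarrow> bool" where
  "nontrivial_kernel \<phi> \<longleftrightarrow> (\<exists>r\<in>{0<..pi}. \<phi> r \<noteq> 0)"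

definition subquadratic :: "(real \<Rightarrow> real) \<Rightarrow> bool" where
  "subquadratic \<phi> \<longleftrightarrow> (\<exists>r0>0. bdd_above ((\<lambda>r. r\<^sup>2 * \<phi> r) ` {0<..<r0}))"

definition power_singular :: "(real \<Rightarrow> real) \<Rightarrow> real \<Rightarrow> bool" where
  "power_singular \<phi> \<beta> \<longleftrightarrow>
     (\<exists>r0>0. \<exists>l>0. \<exists>L>0. \<forall>r>0.
        (if r < r0 then l / r powr \<beta> else 0) \<le> \<phi> r \<and> \<phi> r \<le> L / r powr \<beta>)"


section \<open>Discrete system\<close>

definition noncollisional :: "nat \<Rightarrow> (nat \<Rightarrow> real) \<Rightarrow> bool" where
  "noncollisional N x \<longleftrightarrow> (\<forall>i\<in>{1..N}. \<forall>j\<in>{1..N}. i \<noteq> j \<longrightarrow> torus_dist (x i) (x j) \<noteq> 0)"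

text \<open>The summand \<open>j = i\<close> vanishes whatever the value of \<open>\<phi> 0\<close>. Non-collision is imposed on the
  initial datum only, and only for singular kernels.\<close>

definition cs_solution ::
    "(real \<Rightarrow> real) \<Rightarrow> nat \<Rightarrow> (nat \<Rightarrow> real \<Rightarrow> real) \<Rightarrow> (nat \<Rightarrow> real \<Rightarrow> real) \<Rightarrow> bool" where
  "cs_solution \<phi> N x v \<longleftrightarrow>
     (singular_kernel \<phi> \<longrightarrow> noncollisional N (\<lambda>i. x i 0)) \<and>
     (\<forall>i\<in>{1..N}. \<forall>t\<ge>0.
        (x i has_real_derivative v i t) (at t within {0..}) \<and>
        (v i has_real_derivative
           (1 / real N) * (\<Sum>j=1..N. \<phi> (torus_dist (x i t) (x j t)) * (v j t - v i t)))
          (at t within {0..}))"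

definition variation :: "nat \<Rightarrow> (nat \<Rightarrow> real) \<Rightarrow> real" where
  "variation N v = (1 / (real N)\<^sup>2) * (\<Sum>i=1..N. \<Sum>j=1..N. \<bar>v i - v j\<bar>\<^sup>2)"

text \<open>Used to express that a constant depends on the initial datum but not on \<open>N\<close>: it may depend
  on an upper bound for the initial velocity differences.\<close>

definition velocity_spread_le :: "nat \<Rightarrow> (nat \<Rightarrow> real) \<Rightarrow> real \<Rightarrow> bool" where
  "velocity_spread_le N v A \<longleftrightarrow> (\<forall>i\<in>{1..N}. \<forall>j\<in>{1..N}. \<bar>v i - v j\<bar> \<le> A)"


section \<open>Euler alignment system\<close>

definition dx :: "(real \<Rightarrow> real \<Rightarrow> real) \<Rightarrow> real \<Rightarrow> real \<Rightarrow> real" where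
  "dx f x t = deriv (\<lambda>y. f y t) x"

definition dt :: "(real \<Rightarrow> real \<Rightarrow> real) \<Rightarrow> real \<Rightarrow> real \<Rightarrow> real" where
  "dt f x t = vector_derivative (f x) (at t within {0..})"

definition C1_field :: "(real \<Rightarrow> real \<Rightarrow> real) \<Rightarrow> bool" where
  "C1_field f \<longleftrightarrow>
     (\<forall>x. \<forall>t\<ge>0. f (x + 2 * pi) t = f x t \<and>
        (\<lambda>y. f y t) differentiable (at x) \<and> f x differentiable (at t within {0..})) \<and>
     continuous_on (UNIV \<times> {0..}) (\<lambda>(x, t). dx f x t) \<and>
     continuous_on (UNIV \<times> {0..}) (\<lambda>(x, t). dt f x t)"

definition truncated_alignment ::
    "(real \<Rightarrow> real) \<Rightarrow> (real \<Rightarrow> real) \<Rightarrow> (real \<Rightarrow> real) \<Rightarrow> real \<Rightarrow> real \<Rightarrow> real" where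
  "truncated_alignment \<phi> \<rho> v \<epsilon> x =
     (LINT y:{y \<in> {0..2 * pi}. \<epsilon> < torus_dist x y}|lborel.
        \<phi> (torus_dist x y) * (v y - v x) * \<rho> y)"

text \<open>The alignment integral is the limit of its truncations as \<open>\<epsilon>\<close> decreases to \<open>0\<close>, uniformly
  in \<open>x\<close> at each time. The uniformity is part of the regularity of a strong solution: for \<open>C1\<close>
  fields it is automatic when \<open>r \<phi>(r)\<close> is integrable at \<open>0\<close> (in particular for smooth kernels,
  where the limit is the ordinary integral), and for \<open>\<phi>(r) \<le> L / r powr \<beta>\<close> with \<open>\<beta> < 3\<close> as soon as
  \<open>v\<close> is twice continuously differentiable in \<open>x\<close>.\<close>

definition euler_alignment_solution ::
    "(real \<Rightarrow> real) \<Rightarrow> (real \<Rightarrow> real \<Rightarrow> real) \<Rightarrow> (real \<Rightarrow> real \<Rightarrow> real) \<Rightarrow> bool" where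
  "euler_alignment_solution \<phi> \<rho> v \<longleftrightarrow>
     C1_field \<rho> \<and> C1_field v \<and>
     (\<forall>x. \<forall>t\<ge>0. \<rho> x t \<ge> 0) \<and>
     (\<forall>x. \<forall>t\<ge>0. dt \<rho> x t + dx (\<lambda>y s. v y s * \<rho> y s) x t = 0) \<and>
     (\<forall>t\<ge>0. uniform_limit UNIV
        (\<lambda>\<epsilon> x. truncated_alignment \<phi> (\<lambda>y. \<rho> y t) (\<lambda>y. v y t) \<epsilon> x)
        (\<lambda>x. dt v x t + v x t * dx v x t) (at_right 0))"

definition hydro_variation :: "(real \<Rightarrow> real) \<Rightarrow> (real \<Rightarrow> real) \<Rightarrow> real" where
  "hydro_variation \<rho> v =
     (LINT p:{0..2 * pi} \<times> {0..2 * pi}|lborel.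
        \<bar>v (fst p) - v (snd p)\<bar>\<^sup>2 * \<rho> (fst p) * \<rho> (snd p))"

end

theory Submission
  imports Defs
begin

text \<open>
  Everything rests on Lyapunov functionals; write \<open>x\<^sub>i\<^sub>j\<close> and \<open>v\<^sub>i\<^sub>j\<close> for differences and \<open>\<V>\<close> for the
  variation. For total mass \<open>1\<close> its derivative is \<open>- 2 J\<close>, the dissipation \<open>J\<close> being the mean of \<open>\<phi> v\<^sub>i\<^sub>j\<^sup>2\<close>.

  \<^bold>\<open>Agents with a singular kernel.\<close> No two agents ever collide: with an antiderivative \<open>F\<close> of the
  kernel on \<open>(0, 2\<pi>)\<close>, the sum of \<open>v\<^sub>i\<close> and the mean over \<open>j\<close> of \<open>F(x\<^sub>i\<^sub>j)\<close> is conserved, while \<open>F\<close> tends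
  to \<open>-\<infinity>\<close> at \<open>0\<close>, so a collision would force an infinite velocity (\<open>no_collision\<close>). Consequently
  agents keep their cyclic order, every lifted difference stays in \<open>(0, 2\<pi>)\<close> for all times, and by the
  conservation law the system is the gradient flow of a convex energy \<open>\<Phi>\<close>. The functional
  \<open>t\<^sup>2 \<V>/2 + t (\<Phi>(t) - \<Phi>(T)) + Q/2\<close>, with \<open>Q\<close> the mean square distance to the configuration at
  time \<open>T\<close>, is nonincreasing, which yields \<open>\<V>(T) \<le> 4\<pi>\<^sup>2 / T\<^sup>2\<close> for every \<open>N\<close>
  (\<open>variation_decay_singular\<close>). All discrete claims for singular kernels follow, and the hypothesis
  of the strongly singular case excludes smooth kernels.

  \<^bold>\<open>The corrector.\<close> In the remaining cases the dissipation degenerates where \<open>\<phi>\<close> vanishes. There is an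
  odd periodic \<open>\<psi>\<close> with derivative at most \<open>-1 + K \<phi>\<close> (\<open>corrector_exists\<close>), and \<open>G\<close>, the mean of
  \<open>\<psi>(x\<^sub>i\<^sub>j) v\<^sub>i\<^sub>j\<close>, satisfies \<open>G' \<le> - \<V> + K J + R\<close>. This expresses that, on the circle, two agents
  with constant different velocities would pass through every distance, in particular through those
  where \<open>\<phi>\<close> is positive. The remainder \<open>R\<close> comes from the acceleration; after symmetrisation, and since
  \<open>\<psi>\<close> is Lipschitz, it is bounded by a multiple of the mean of \<open>r \<phi>(r) \<bar>v\<^sub>i\<^sub>j\<bar>\<close>, \<open>r\<close> being the distance.

  If \<open>r\<^sup>2 \<phi>(r)\<close> is bounded, Young's inequality gives \<open>R \<le> t J + D/t\<close>, and
  \<open>t \<V> + G + c \<V> - D ln t\<close> is nonincreasing (\<open>logarithmic_decay\<close>). For a smooth kernel and \<open>N\<close>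
  agents, \<open>R\<close> is instead absorbed by \<open>N\<close> times the dissipation of the mean of \<open>\<bar>v\<^sub>i\<^sub>j\<bar>\<close>, regularised to
  \<open>\<surd>(v\<^sub>i\<^sub>j\<^sup>2 + \<epsilon>\<^sup>2)\<close> (\<open>smooth_N_decay\<close>).

  \<^bold>\<open>The hydrodynamic system.\<close> The same computations hold with sums replaced by integrals against
  \<open>\<rho> dx\<close> (\<open>pair_transport\<close>); the alignment force is the uniform limit of its truncations, each of which
  can be symmetrised (\<open>circle_alignment\<close>). For \<open>2 < \<beta> < 3\<close> the bound of \<open>R\<close> involves the energy with
  density \<open>r powr (2 - \<beta>)\<close>. It is finite initially, and since its rate of change is controlled by
  itself and by \<open>J\<close>, it grows at most linearly (\<open>riesz_energy_growth\<close>). Then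
  \<open>G' \<le> - \<V> + B (1 + t) J + \<eta>\<close> for every \<open>\<eta> > 0\<close>, and as \<open>J\<close> is integrable in time this forces
  \<open>\<V>\<close> to vanish at infinity (\<open>vanishing_of_variation\<close>).
\<close>

section \<open>Decay from differential inequalities\<close>

lemma nonincreasing_on_halfline:
  fixes f :: "real \<Rightarrow> real"
  assumes der: "\<And>t. a \<le> t \<Longrightarrow> t \<le> b \<Longrightarrow> (f has_real_derivative f' t) (at t within {0..})"
    and nonpos: "\<And>t. a < t \<Longrightarrow> t < b \<Longrightarrow> f' t \<le> 0"
    and ab: "0 \<le> a" "a \<le> b"
  shows "f b \<le> f a"
proof (rule DERIV_nonpos_imp_decreasing_open[OF ab(2)])
  fix t assume t: "a < t" "t < b"
  then have "at t within {0..} = at t"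
    using ab by (intro at_within_interior) (simp add: interior_Ici[of "t/2"] )
  then show "\<exists>y. DERIV f t :> y \<and> y \<le> 0"
    using der[of t] nonpos[of t] t by auto
next
  have "continuous (at t within {a..b}) f" if "t \<in> {a..b}" for t
  proof (rule continuous_within_subset)
    show "continuous (at t within {0..}) f"
      using der[of t] that by (auto intro: DERIV_continuous)
    show "{a..b} \<subseteq> {0..}" using ab by auto
  qed
  then show "continuous_on {a..b} f"
    by (simp add: continuous_on_eq_continuous_within)
qed

text \<open>In the next three lemmas \<open>V\<close> is the variation, \<open>J\<close> the dissipation, \<open>M\<close> the total mass and \<open>G\<close> the
  corrector functional.\<close>

lemma logarithmic_decay:
  fixes V G J :: "real \<Rightarrow> real"
  assumes V': "\<And>t. t \<ge> 0 \<Longrightarrow> (V has_real_derivative - (2 * M * J t)) (at t within {0..})"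
    and G': "\<And>t. t \<ge> 0 \<Longrightarrow> (G has_real_derivative G' t) (at t within {0..})"
    and G'_le: "\<And>t. t > 0 \<Longrightarrow> G' t \<le> - V t + K * J t + M * t * J t + D / t"
    and J: "\<And>t. t \<ge> 0 \<Longrightarrow> J t \<ge> 0"
    and V: "\<And>t. t \<ge> 0 \<Longrightarrow> V t \<ge> 0" "\<And>t. t \<ge> 0 \<Longrightarrow> V t \<le> V0"
    and G: "\<And>t. t \<ge> 0 \<Longrightarrow> \<bar>G t\<bar> \<le> g"
    and pos: "M > 0" "K \<ge> 0" and t: "t \<ge> exp 1"
  shows "V t \<le> (V0 + K / (2 * M) * V0 + 2 * g + D) * (ln t / t)"
proof -
  define F where "F s = s * V s + G s + K / (2 * M) * V s - D * ln s" for s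
  have t1: "t \<ge> 1" using t one_le_exp_iff[of 1] by linarith
  have ln1: "ln t \<ge> 1"
    using t t1 ln_ge_iff[of t 1] by simp
  \<comment> \<open>the term \<open>M * s * J s\<close> is absorbed by half of the decay of \<open>s * V s\<close>, and \<open>K * J s\<close> by the third summand of \<open>F\<close>\<close>
  have "F t \<le> F 1"
  proof (rule nonincreasing_on_halfline[where f = F and f' = "\<lambda>s. V s - s * (2 * M * J s) + G' s - K / (2 * M) * (2 * M * J s) - D / s"])
    fix s assume s: "1 \<le> s" "s \<le> t"
    show "(F has_real_derivative
        (V s - s * (2 * M * J s) + G' s - K / (2 * M) * (2 * M * J s) - D / s)) (at s within {0..})"
      unfolding F_def using s
      by (auto intro!: derivative_eq_intros V' G')
  next
    fix s assume s: "1 < s" "s < t"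
    have "0 \<le> M * s * J s" using pos J[of s] s by simp
    then show "V s - s * (2 * M * J s) + G' s - K / (2 * M) * (2 * M * J s) - D / s \<le> 0"
      using G'_le[of s] s pos by (simp add: algebra_simps)
  qed (use t1 in auto)
  then have "t * V t + K / (2 * M) * V t \<le> V 1 + K / (2 * M) * V 1 + G 1 - G t + D * ln t"
    by (simp add: F_def algebra_simps)
  also have "\<dots> \<le> V0 + K / (2 * M) * V0 + 2 * g + D * ln t"
  proof -
    have "K / (2 * M) * V 1 \<le> K / (2 * M) * V0"
      using pos V[of 1] by (intro mult_left_mono) auto
    then show ?thesis
      using V[of 1] G[of 1] G[of t] t1 by auto
  qed
  also have "\<dots> \<le> (V0 + K / (2 * M) * V0 + 2 * g) * ln t + D * ln t"
  proof -
    have "0 \<le> V0" "0 \<le> g" using V[of 0] G[of 0] by auto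
    then have "0 \<le> V0 + K / (2 * M) * V0 + 2 * g" using pos by simp
    from mult_left_mono[OF ln1 this] show ?thesis by simp
  qed
  finally have "t * V t + K / (2 * M) * V t \<le> (V0 + K / (2 * M) * V0 + 2 * g + D) * ln t"
    by (simp add: algebra_simps)
  moreover have "0 \<le> K / (2 * M) * V t" using pos V[of t] t1 by simp
  ultimately have "t * V t \<le> (V0 + K / (2 * M) * V0 + 2 * g + D) * ln t" by linarith
  then show ?thesis using t1 by (simp add: field_simps)
qed

text \<open>On \<open>{s..T}\<close> the factor \<open>1 + t\<close> is at most \<open>1 + T\<close>, and there the integral of \<open>J\<close> is at most
  \<open>(V s - l) / (2 * M)\<close> with \<open>l\<close> the limit of \<open>V\<close>. If \<open>s\<close> is chosen with \<open>V s\<close> close to \<open>l\<close>, the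
  integrated inequality, divided by \<open>T\<close>, gives \<open>l \<le> 2 * \<eta>\<close>.\<close>

lemma vanishing_of_variation:
  fixes V G J :: "real \<Rightarrow> real"
  assumes V': "\<And>t. t \<ge> 0 \<Longrightarrow> (V has_real_derivative - (2 * M * J t)) (at t within {0..})"
    and G': "\<And>t. t \<ge> 0 \<Longrightarrow> (G has_real_derivative G' t) (at t within {0..})"
    and G'_le: "\<And>\<eta>. \<eta> > 0 \<Longrightarrow> \<exists>B\<ge>0. \<forall>t\<ge>0. G' t \<le> - V t + B * (1 + t) * J t + \<eta>"
    and J: "\<And>t. t \<ge> 0 \<Longrightarrow> J t \<ge> 0"
    and V: "\<And>t. t \<ge> 0 \<Longrightarrow> V t \<ge> 0"
    and G: "\<And>t. t \<ge> 0 \<Longrightarrow> \<bar>G t\<bar> \<le> g"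
    and M: "M > 0"
  shows "(V \<longlongrightarrow> 0) at_top"
proof -
  have mono: "V t \<le> V s" if "0 \<le> s" "s \<le> t" for s t
    by (rule nonincreasing_on_halfline[OF V']) (use that M J in auto)
  define l where "l = Inf (V ` {0..})"
  have bdd: "bdd_below (V ` {0..})" using V by (intro bdd_belowI[of _ 0]) auto
  have l_le: "l \<le> V t" if "t \<ge> 0" for t
    unfolding l_def using bdd that by (intro cInf_lower) auto
  have near: "\<exists>s\<ge>0. V s < l + e" if "e > 0" for e
  proof -
    have "Inf (V ` {0..}) < l + e" using that by (simp add: l_def)
    then show ?thesis by (subst (asm) cInf_less_iff) (use bdd in auto)
  qed
  have l_small: "l \<le> 2 * \<eta>" if \<eta>: "\<eta> > 0" for \<eta>
  proof (rule ccontr)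
    assume "\<not> l \<le> 2 * \<eta>"
    then have l: "l > 2 * \<eta>" by simp
    obtain B where B: "B \<ge> 0" "\<And>t. t \<ge> 0 \<Longrightarrow> G' t \<le> - V t + B * (1 + t) * J t + \<eta>"
      using G'_le[OF \<eta>] by auto
    define b where "b = B / (2 * M)"
    have b: "b \<ge> 0" using B M by (simp add: b_def)
    obtain s where s: "s \<ge> 0" "V s < l + \<eta> / (2 * (b + 1))"
      using near[of "\<eta> / (2 * (b + 1))"] \<eta> b by auto
    have ineq: "(T - s) * (l - \<eta>) \<le> 2 * g + b * (1 + T) * (\<eta> / (2 * (b + 1)))" if T: "T \<ge> s" for T
    proof -
      define F where "F u = G u + b * (1 + T) * V u + u * (l - \<eta>)" for u
      have "F T \<le> F s"
      proof (rule nonincreasing_on_halfline[where f = F and f' = "\<lambda>u. G' u - b * (1 + T) * (2 * M * J u) + (l - \<eta>)"])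
        fix u assume u: "s \<le> u" "u \<le> T"
        show "(F has_real_derivative (G' u - b * (1 + T) * (2 * M * J u) + (l - \<eta>))) (at u within {0..})"
          unfolding F_def using u s by (auto intro!: derivative_eq_intros V' G')
      next
        fix u assume u: "s < u" "u < T"
        have "B * (1 + u) * J u \<le> B * (1 + T) * J u"
          using u s B J[of u] by (intro mult_right_mono mult_left_mono) auto
        moreover have "b * (1 + T) * (2 * M * J u) = B * (1 + T) * J u"
          using M by (simp add: b_def)
        ultimately show "G' u - b * (1 + T) * (2 * M * J u) + (l - \<eta>) \<le> 0"
          using B(2)[of u] l_le[of u] u s by linarith
      qed (use s T in auto)
      then have "(T - s) * (l - \<eta>) \<le> G s - G T + b * (1 + T) * (V s - V T)"
        by (simp add: F_def algebra_simps)
      also have "b * (1 + T) * (V s - V T) \<le> b * (1 + T) * (\<eta> / (2 * (b + 1)))"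
        using s T l_le[of T] b by (intro mult_left_mono) auto
      also have "G s - G T \<le> 2 * g" using G[of s] G[of T] s T by auto
      finally show ?thesis by simp
    qed
    have small: "b * (\<eta> / (2 * (b + 1))) \<le> \<eta> / 2"
      using b \<eta> by (simp add: field_simps)
    define T where "T = s + (2 * g + \<eta> * (1 + s) + 1) / (\<eta> / 2)"
    have g: "g \<ge> 0" using G[of 0] by auto
    have T: "T \<ge> s" unfolding T_def using g \<eta> s by simp
    have "(T - s) * \<eta> \<le> (T - s) * (l - \<eta>)" using T l by (intro mult_left_mono) auto
    also note ineq[OF T]
    also have "b * (1 + T) * (\<eta> / (2 * (b + 1))) = (1 + T) * (b * (\<eta> / (2 * (b + 1))))" by simp
    also have "\<dots> \<le> (1 + T) * (\<eta> / 2)" using small T s by (intro mult_left_mono) auto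
    also have "(1 + T) * (\<eta> / 2) = (1 + s) * (\<eta> / 2) + (T - s) * (\<eta> / 2)" by (simp add: field_simps)
    finally have "(T - s) * (\<eta> / 2) \<le> 2 * g + (1 + s) * (\<eta> / 2)" by (simp add: field_simps)
    moreover have "(T - s) * (\<eta> / 2) = 2 * g + \<eta> * (1 + s) + 1" using \<eta> by (simp add: T_def)
    moreover have "(1 + s) * (\<eta> / 2) \<le> \<eta> * (1 + s)" using s \<eta> by (simp add: field_simps)
    ultimately show False by linarith
  qed
  have l0: "l \<le> 0"
  proof (rule field_le_epsilon)
    fix e :: real assume "e > 0" then show "l \<le> 0 + e" using l_small[of "e/2"] by simp
  qed
  show ?thesis
  proof (rule tendstoI)
    fix e :: real assume e: "e > 0"
    then obtain s where s: "s \<ge> 0" "V s < e" using near[of e] l0 by (auto intro: less_le_trans)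
    show "\<forall>\<^sub>F t in at_top. dist (V t) 0 < e"
      using eventually_ge_at_top[of s]
    proof eventually_elim
      case (elim t)
      then show ?case using mono[of s t] V[of t] s by auto
    qed
  qed
qed

text \<open>With \<open>\<tau> = 2 * (1 + t)\<close> the sum of \<open>E\<close> and a multiple of \<open>(1 + t) * V\<close> grows at a rate of at most half of
  its quotient by \<open>1 + t\<close>, up to a constant. The constant in the conclusion depends on \<open>E\<close> through
  \<open>E0\<close> only, which allows a limit in regularised energies.\<close>

lemma linear_growth:
  fixes V E J :: "real \<Rightarrow> real"
  assumes V': "\<And>t. t \<ge> 0 \<Longrightarrow> (V has_real_derivative - (2 * M * J t)) (at t within {0..})"
    and E': "\<And>t. t \<ge> 0 \<Longrightarrow> (E has_real_derivative E' t) (at t within {0..})"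
    and E'_le: "\<And>t \<tau>. t \<ge> 0 \<Longrightarrow> \<tau> > 0 \<Longrightarrow> E' t \<le> c + E t / \<tau> + \<tau> * k * J t"
    and V: "\<And>t. t \<ge> 0 \<Longrightarrow> V t \<ge> 0" "\<And>t. t \<ge> 0 \<Longrightarrow> V t \<le> V0"
    and E: "E 0 \<le> E0" "0 \<le> E0" and pos: "M > 0" "c \<ge> 0" "k \<ge> 0" and t: "t \<ge> 0"
  shows "E t \<le> (E0 + 3 * (k / M) * V0 + 2 * c) * (1 + t)"
proof -
  define a where "a = k / M"
  have a: "a \<ge> 0" "a * M = k" using pos by (auto simp: a_def)
  have V0: "V0 \<ge> 0" using V[of 0] by auto
  define c' where "c' = c + a * V0"
  have c': "c' \<ge> 0" using pos a V0 by (simp add: c'_def)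
  define g where "g s = E s + a * (1 + s) * V s" for s
  define f where "f s = g s / sqrt (1 + s) - 2 * c' * sqrt (1 + s)" for s
  define g' where "g' s = E' s + a * V s - a * (1 + s) * (2 * M * J s)" for s
  have "f t \<le> f 0"
  proof (rule nonincreasing_on_halfline[where f = f and f' = "\<lambda>s. (g' s * sqrt (1 + s) - g s * (inverse (sqrt (1 + s)) / 2)) / (sqrt (1 + s) * sqrt (1 + s))
        - 2 * c' * (inverse (sqrt (1 + s)) / 2)"])
    fix s :: real assume s: "0 \<le> s" "s \<le> t"
    have g': "(g has_real_derivative g' s) (at s within {0..})"
      unfolding g_def g'_def using s
      by (auto intro!: derivative_eq_intros V' E' simp: algebra_simps)
    show "(f has_real_derivative ((g' s * sqrt (1 + s) - g s * (inverse (sqrt (1 + s)) / 2)) / (sqrt (1 + s) * sqrt (1 + s))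
        - 2 * c' * (inverse (sqrt (1 + s)) / 2))) (at s within {0..})"
      unfolding f_def using s
      by (auto intro!: derivative_eq_intros g' simp del: real_sqrt_mult_self)
  next
    fix s :: real assume s: "0 < s" "s < t"
    define r where "r = sqrt (1 + s)"
    have r: "r > 0" "r * r = 1 + s" using s by (auto simp: r_def)
    have "E' s \<le> c + E s / (2 * (1 + s)) + 2 * (1 + s) * k * J s" using E'_le[of s "2 * (1 + s)"] s by simp
    moreover have "a * (1 + s) * (2 * M * J s) = 2 * (1 + s) * k * J s" by (simp add: a(2)[symmetric])
    moreover have "a * V s \<le> a * V0" using a V[of s] s by (intro mult_left_mono) auto
    ultimately have "g' s \<le> c' + E s / (2 * (1 + s))" unfolding g'_def c'_def by linarith
    also have "E s / (2 * (1 + s)) \<le> g s / (2 * (1 + s))"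
      using s a V[of s] by (intro divide_right_mono) (auto simp: g_def)
    finally have g': "g' s \<le> c' + g s / (2 * (r * r))" by (simp add: r)
    have "(g' s * r - g s * (inverse r / 2)) / (r * r) = (g' s - g s / (2 * (r * r))) / r"
      using r(1) by (simp add: field_simps)
    also have "\<dots> \<le> c' / r" using g' r by (intro divide_right_mono) auto
    also have "c' / r = 2 * c' * (inverse r / 2)" using r by (simp add: field_simps)
    finally show "(g' s * sqrt (1 + s) - g s * (inverse (sqrt (1 + s)) / 2)) / (sqrt (1 + s) * sqrt (1 + s))
        - 2 * c' * (inverse (sqrt (1 + s)) / 2) \<le> 0" unfolding r_def by simp
  qed (use t in auto)
  define r where "r = sqrt (1 + t)"
  have r: "r > 0" "r * r = 1 + t" "r \<ge> 1" using t by (auto simp: r_def)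
  have "g t / r \<le> g 0 + 2 * c' * r - 2 * c'" using \<open>f t \<le> f 0\<close> by (simp add: f_def r_def)
  also have "\<dots> \<le> g 0 + 2 * c' * r" using c' by simp
  finally have "g t \<le> (g 0 + 2 * c' * r) * r" using r by (simp add: field_simps)
  also have "\<dots> = g 0 * r + 2 * c' * (1 + t)" by (simp add: r(2)[symmetric] algebra_simps)
  also have "g 0 \<le> E0 + a * V0"
    using E a V[of 0] by (auto simp: g_def intro!: add_mono mult_left_mono)
  then have "g 0 * r \<le> (E0 + a * V0) * r" using r by (intro mult_right_mono) auto
  also have "\<dots> \<le> (E0 + a * V0) * (r * r)"
    using mult_right_mono[of 1 r r] r E a V0 by (intro mult_left_mono) auto
  finally have "g t \<le> (E0 + a * V0 + 2 * c') * (1 + t)" using r by (simp add: algebra_simps)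
  moreover have "E t \<le> g t" using a V[of t] t by (simp add: g_def)
  ultimately have "E t \<le> (E0 + a * V0 + 2 * c') * (1 + t)" by linarith
  also have "E0 + a * V0 + 2 * c' = E0 + 3 * (k / M) * V0 + 2 * c" by (simp add: c'_def a_def algebra_simps)
  finally show ?thesis .
qed

section \<open>The distance on the circle\<close>

lemma arccos_cos_le_abs: "arccos (cos u) \<le> \<bar>u\<bar>"
proof (cases "\<bar>u\<bar> \<le> pi")
  case True
  then show ?thesis by (metis abs_ge_zero arccos_cos cos_abs_real order_refl)
next
  case False
  then show ?thesis using arccos_ubound[of "cos u"] by simp
qed

lemma ex_near_multiple_2pi: "\<exists>k::int. \<bar>z + 2 * pi * of_int k\<bar> \<le> pi"
proof -
  define k where "k = - round (z / (2 * pi))"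
  have "\<bar>of_int (round (z / (2 * pi))) - z / (2 * pi)\<bar> \<le> 1 / 2" by (rule of_int_round_abs_le)
  then have "2 * pi * \<bar>of_int (round (z / (2 * pi))) - z / (2 * pi)\<bar> \<le> 2 * pi * (1 / 2)"
    by (intro mult_left_mono) auto
  moreover have "2 * pi * \<bar>of_int (round (z / (2 * pi))) - z / (2 * pi)\<bar>
      = \<bar>2 * pi * (of_int (round (z / (2 * pi))) - z / (2 * pi))\<bar>" by (simp add: abs_mult)
  moreover have "2 * pi * (of_int (round (z / (2 * pi))) - z / (2 * pi)) = - (z + 2 * pi * of_int k)"
    by (simp add: k_def field_simps)
  ultimately have "\<bar>z + 2 * pi * of_int k\<bar> \<le> 2 * pi * (1 / 2)" by (metis abs_minus_cancel)
  then show ?thesis by (intro exI[of _ k]) simp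
qed

lemma cos_add_2pi_int: "cos (z + 2 * pi * of_int k) = cos (z::real)"
  using cos_int_2pin[of k] sin_int_2pin[of k] by (simp add: cos_add mult_ac)

text \<open>This closed form makes continuity and periodicity of the distance evident.\<close>

lemma torus_dist_eq: "torus_dist x y = arccos (cos (x - y))"
proof -
  obtain k :: int where k: "\<bar>x - y + 2 * pi * of_int k\<bar> \<le> pi" using ex_near_multiple_2pi by blast
  show ?thesis unfolding torus_dist_def
  proof (rule antisym)
    have "(INF k::int. \<bar>x - y + 2 * pi * of_int k\<bar>) \<le> \<bar>x - y + 2 * pi * of_int k\<bar>"
      by (rule cINF_lower) (auto intro: bdd_belowI[of _ 0])
    also have "\<dots> = arccos (cos (x - y + 2 * pi * of_int k))"
      using k by (metis abs_ge_zero arccos_cos cos_abs_real)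
    finally show "(INF k::int. \<bar>x - y + 2 * pi * of_int k\<bar>) \<le> arccos (cos (x - y))"
      by (simp add: cos_add_2pi_int)
    show "arccos (cos (x - y)) \<le> (INF k::int. \<bar>x - y + 2 * pi * of_int k\<bar>)"
    proof (rule cINF_greatest)
      fix j :: int
      show "arccos (cos (x - y)) \<le> \<bar>x - y + 2 * pi * of_int j\<bar>"
        using arccos_cos_le_abs[of "x - y + 2 * pi * of_int j"] by (simp add: cos_add_2pi_int)
    qed simp
  qed
qed

lemma torus_dist_commute: "torus_dist x y = torus_dist y x"
  by (simp add: torus_dist_eq cos_diff mult.commute)

lemma torus_dist_bounds: "0 \<le> torus_dist x y" "torus_dist x y \<le> pi"
  by (auto simp: torus_dist_eq arccos_lbound arccos_ubound)

lemma cos_torus_dist: "cos (torus_dist x y) = cos (x - y)"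
  by (simp add: torus_dist_eq cos_arccos_abs)

lemma torus_dist_eq_0_iff: "torus_dist x y = 0 \<longleftrightarrow> cos (x - y) = 1"
  by (metis arccos_1 cos_torus_dist cos_zero torus_dist_eq)

lemma torus_dist_witness: "\<exists>k::int. torus_dist x y = \<bar>x - y + 2 * pi * of_int k\<bar>"
proof -
  obtain k :: int where k: "\<bar>x - y + 2 * pi * of_int k\<bar> \<le> pi" using ex_near_multiple_2pi by blast
  then have "\<bar>x - y + 2 * pi * of_int k\<bar> = arccos (cos (x - y + 2 * pi * of_int k))"
    by (metis abs_ge_zero arccos_cos cos_abs_real)
  then show ?thesis by (metis cos_add_2pi_int torus_dist_eq)
qed

lemma periodic_int:
  fixes f :: "real \<Rightarrow> 'a"
  assumes "\<And>x. f (x + 2 * pi) = f x"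
  shows "f (x + 2 * pi * of_int k) = f x"
proof -
  have nat: "f (y + 2 * pi * of_nat n) = f y" for y n
  proof (induction n)
    case (Suc n)
    then show ?case using assms[of "y + 2 * pi * of_nat n"] by (simp add: algebra_simps)
  qed simp
  show ?thesis
  proof (cases k)
    case (nonneg n) then show ?thesis using nat[of x n] by simp
  next
    case (neg n)
    have "x + 2 * pi * of_int k + 2 * pi * of_nat (Suc n) = x" unfolding neg by (simp add: algebra_simps)
    then show ?thesis using nat[of "x + 2 * pi * of_int k" "Suc n"] by metis
  qed
qed

text \<open>A periodic function is Lipschitz with respect to the distance on the circle.\<close>

lemma lipschitz_torus_dist:
  fixes f :: "real \<Rightarrow> real"
  assumes per: "\<And>x. f (x + 2 * pi) = f x"
    and der: "\<And>x. (f has_real_derivative f' x) (at x)"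
    and bd: "\<And>x. \<bar>f' x\<bar> \<le> L"
  shows "\<bar>f (x - z) - f (y - z)\<bar> \<le> L * torus_dist x y"
proof -
  obtain k :: int where k: "torus_dist x y = \<bar>x - y + 2 * pi * of_int k\<bar>" using torus_dist_witness by blast
  have "norm (f (x - z + 2 * pi * of_int k) - f (y - z)) \<le> L * norm (x - z + 2 * pi * of_int k - (y - z))"
    by (rule field_differentiable_bound[where S=UNIV and f'=f']) (use der bd in auto)
  moreover have "f (x - z + 2 * pi * of_int k) = f (x - z)" by (rule periodic_int[of f, OF per])
  moreover have "x - z + 2 * pi * of_int k - (y - z) = x - y + 2 * pi * of_int k" by simp
  ultimately show ?thesis by (simp add: k)
qed

lemma continuous_on_torus_dist [continuous_intros]:
  fixes f g :: "'a::t2_space \<Rightarrow> real"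
  assumes "continuous_on S f" "continuous_on S g"
  shows "continuous_on S (\<lambda>s. torus_dist (f s) (g s))"
  unfolding torus_dist_eq using assms
  by (intro continuous_on_compose2[OF continuous_on_arccos'] continuous_intros) auto

lemma C1_on_imp_continuous_on:
  assumes "C1_on S f" shows "continuous_on S f"
proof -
  from assms obtain f' where "\<forall>r\<in>S. (f has_real_derivative f' r) (at r within S)"
    unfolding C1_on_def by auto
  then show ?thesis by (auto simp: continuous_on_eq_continuous_within intro: DERIV_continuous)
qed

lemma kernel_continuous:
  assumes "smooth_kernel \<phi> \<or> singular_kernel \<phi>"
  shows "continuous_on {0<..} \<phi>"
proof -
  show ?thesis
    using assms C1_on_imp_continuous_on[of _ \<phi>] unfolding smooth_kernel_def singular_kernel_def
    by (auto intro: continuous_on_subset[of "{0..}"])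
qed

lemma smooth_kernel_continuous: "smooth_kernel \<phi> \<Longrightarrow> continuous_on {0..} \<phi>"
  unfolding smooth_kernel_def by (rule C1_on_imp_continuous_on)

section \<open>Double sums\<close>

lemma sum_antisym:
  fixes \<beta> :: "nat \<Rightarrow> nat \<Rightarrow> real"
  assumes "\<And>i j. i \<in> I \<Longrightarrow> j \<in> I \<Longrightarrow> \<beta> j i = - \<beta> i j"
  shows "(\<Sum>i\<in>I. \<Sum>j\<in>I. \<beta> i j * (c i - c j)) = 2 * (\<Sum>i\<in>I. c i * (\<Sum>j\<in>I. \<beta> i j))"
proof -
  have "(\<Sum>i\<in>I. \<Sum>j\<in>I. \<beta> i j * c j) = (\<Sum>j\<in>I. \<Sum>i\<in>I. \<beta> i j * c j)" by (rule sum.swap)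
  also have "\<dots> = (\<Sum>j\<in>I. \<Sum>i\<in>I. - (\<beta> j i * c j))"
  proof (intro sum.cong refl)
    fix j i assume "j \<in> I" "i \<in> I"
    then show "\<beta> i j * c j = - (\<beta> j i * c j)" using assms[of i j] by simp
  qed
  finally have "(\<Sum>i\<in>I. \<Sum>j\<in>I. \<beta> i j * c j) = - (\<Sum>i\<in>I. \<Sum>j\<in>I. \<beta> i j * c i)"
    by (simp only: sum_negf)
  moreover have "(\<Sum>i\<in>I. \<Sum>j\<in>I. \<beta> i j * c i) = (\<Sum>i\<in>I. c i * (\<Sum>j\<in>I. \<beta> i j))"
    by (simp only: sum_distrib_left mult.commute)
  ultimately show ?thesis
    by (simp only: right_diff_distrib sum_subtractf)
qed

lemma sum_diff_mult_diff:
  fixes u c :: "nat \<Rightarrow> real"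
  shows "(\<Sum>i\<in>I. \<Sum>j\<in>I. (u i - u j) * (c i - c j))
    = 2 * (real (card I) * (\<Sum>i\<in>I. c i * u i) - (\<Sum>i\<in>I. c i) * (\<Sum>i\<in>I. u i))"
proof -
  have "(\<Sum>i\<in>I. \<Sum>j\<in>I. (u i - u j) * (c i - c j)) = 2 * (\<Sum>i\<in>I. c i * (\<Sum>j\<in>I. u i - u j))"
    by (rule sum_antisym) simp
  also have "\<dots> = 2 * (\<Sum>i\<in>I. real (card I) * (c i * u i) - c i * (\<Sum>j\<in>I. u j))"
    by (simp add: sum_subtractf algebra_simps)
  also have "\<dots> = 2 * (real (card I) * (\<Sum>i\<in>I. c i * u i) - (\<Sum>i\<in>I. c i) * (\<Sum>i\<in>I. u i))"
    by (simp add: sum_subtractf sum_distrib_left[symmetric] sum_distrib_right[symmetric])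
  finally show ?thesis .
qed

text \<open>The acceleration is tested against an antisymmetric weight \<open>\<beta>\<close> and then symmetrised in the two agents
  that interact.\<close>

lemma sum_alignment_symmetrized:
  fixes \<beta> k :: "nat \<Rightarrow> nat \<Rightarrow> real"
  assumes "\<And>i j. i \<in> I \<Longrightarrow> j \<in> I \<Longrightarrow> \<beta> j i = - \<beta> i j"
    and "\<And>i j. i \<in> I \<Longrightarrow> j \<in> I \<Longrightarrow> k j i = k i j"
    and a: "\<And>i. i \<in> I \<Longrightarrow> a i = c * (\<Sum>j\<in>I. k i j * (v j - v i))"
  shows "(\<Sum>i\<in>I. \<Sum>j\<in>I. \<beta> i j * (a i - a j))
    = c * (\<Sum>i\<in>I. \<Sum>j\<in>I. k i j * (v j - v i) * ((\<Sum>l\<in>I. \<beta> i l) - (\<Sum>l\<in>I. \<beta> j l)))"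
proof -
  define B where "B i = (\<Sum>l\<in>I. \<beta> i l)" for i
  have "(\<Sum>i\<in>I. \<Sum>j\<in>I. \<beta> i j * (a i - a j)) = 2 * (\<Sum>i\<in>I. a i * B i)"
    unfolding B_def by (rule sum_antisym) (rule assms(1))
  also have "\<dots> = c * (2 * (\<Sum>i\<in>I. B i * (\<Sum>j\<in>I. k i j * (v j - v i))))"
    unfolding sum_distrib_left[of c] sum_distrib_left[of 2] by (intro sum.cong refl) (simp add: a)
  also have "2 * (\<Sum>i\<in>I. B i * (\<Sum>j\<in>I. k i j * (v j - v i)))
      = (\<Sum>i\<in>I. \<Sum>j\<in>I. k i j * (v j - v i) * (B i - B j))"
  proof (rule sum_antisym[symmetric])
    fix i j assume "i \<in> I" "j \<in> I"
    then show "k j i * (v i - v j) = - (k i j * (v j - v i))" using assms(2)[of i j] by (simp add: algebra_simps)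
  qed
  finally show ?thesis unfolding B_def .
qed

section \<open>Functionals of pairs of agents\<close>

text \<open>The right-hand side of the velocity equation of agent \<open>i\<close>.\<close>

definition acceleration :: "(real \<Rightarrow> real) \<Rightarrow> nat \<Rightarrow> (nat \<Rightarrow> real \<Rightarrow> real) \<Rightarrow> (nat \<Rightarrow> real \<Rightarrow> real) \<Rightarrow> nat \<Rightarrow> real \<Rightarrow> real" where
  "acceleration \<phi> N x v i t = (1 / real N) * (\<Sum>j=1..N. \<phi> (torus_dist (x i t) (x j t)) * (v j t - v i t))"

text \<open>Half of the rate at which the variation decreases.\<close>

definition dissipation :: "(real \<Rightarrow> real) \<Rightarrow> nat \<Rightarrow> (nat \<Rightarrow> real) \<Rightarrow> (nat \<Rightarrow> real) \<Rightarrow> real" where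
  "dissipation \<phi> N x v = 1 / (real N)\<^sup>2 * (\<Sum>i=1..N. \<Sum>j=1..N. \<phi> (torus_dist (x i) (x j)) * (v i - v j)\<^sup>2)"

lemma cs_derivs:
  assumes "cs_solution \<phi> N x v" "i \<in> {1..N}" "t \<ge> 0"
  shows "(x i has_real_derivative v i t) (at t within {0..})"
    "(v i has_real_derivative acceleration \<phi> N x v i t) (at t within {0..})"
  using assms unfolding cs_solution_def acceleration_def by auto

lemma cs_continuous:
  assumes "cs_solution \<phi> N x v" "i \<in> {1..N}"
  shows "continuous_on {0..} (x i)" "continuous_on {0..} (v i)"
  using cs_derivs[OF assms] by (auto simp: continuous_on_eq_continuous_within intro: DERIV_continuous)

text \<open>The source of all rates of change in the discrete system. The assumption \<open>odd\<close> makes the weight of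
  the acceleration antisymmetric; it holds if \<open>\<alpha>\<close> and \<open>b\<close> are both even or both odd.\<close>

lemma pair_functional_derivative:
  assumes sol: "cs_solution \<phi> N x v" and t: "t \<ge> 0"
    and \<alpha>: "\<And>z. (\<alpha> has_real_derivative \<alpha>' z) (at z)"
    and b: "\<And>w. (b has_real_derivative b' w) (at w)"
    and odd: "\<And>z w. \<alpha> (-z) * b' (-w) = - (\<alpha> z * b' w)"
  shows "((\<lambda>t. \<Sum>i=1..N. \<Sum>j=1..N. \<alpha> (x i t - x j t) * b (v i t - v j t)) has_real_derivative
     (\<Sum>i=1..N. \<Sum>j=1..N. \<alpha>' (x i t - x j t) * (v i t - v j t) * b (v i t - v j t))
     + 1 / real N * (\<Sum>i=1..N. \<Sum>j=1..N. \<phi> (torus_dist (x i t) (x j t)) * (v j t - v i t) *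
        ((\<Sum>l=1..N. \<alpha> (x i t - x l t) * b' (v i t - v l t)) - (\<Sum>l=1..N. \<alpha> (x j t - x l t) * b' (v j t - v l t)))))
     (at t within {0..})"
proof -
  have "((\<lambda>t. \<Sum>i=1..N. \<Sum>j=1..N. \<alpha> (x i t - x j t) * b (v i t - v j t)) has_real_derivative
     (\<Sum>i=1..N. \<Sum>j=1..N. \<alpha>' (x i t - x j t) * (v i t - v j t) * b (v i t - v j t)
       + \<alpha> (x i t - x j t) * b' (v i t - v j t) * (acceleration \<phi> N x v i t - acceleration \<phi> N x v j t))) (at t within {0..})"
  proof (intro DERIV_sum)
    fix i j assume "i \<in> {1..N}" "j \<in> {1..N}"
    note d = cs_derivs[OF sol this(1) t] cs_derivs[OF sol this(2) t]
    show "((\<lambda>t. \<alpha> (x i t - x j t) * b (v i t - v j t)) has_real_derivative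
       (\<alpha>' (x i t - x j t) * (v i t - v j t) * b (v i t - v j t)
       + \<alpha> (x i t - x j t) * b' (v i t - v j t) * (acceleration \<phi> N x v i t - acceleration \<phi> N x v j t))) (at t within {0..})"
      by (auto intro!: derivative_eq_intros DERIV_chain2[OF \<alpha>] DERIV_chain2[OF b] d simp: algebra_simps)
  qed
  also have "(\<Sum>i=1..N. \<Sum>j=1..N. \<alpha>' (x i t - x j t) * (v i t - v j t) * b (v i t - v j t)
       + \<alpha> (x i t - x j t) * b' (v i t - v j t) * (acceleration \<phi> N x v i t - acceleration \<phi> N x v j t))
     = (\<Sum>i=1..N. \<Sum>j=1..N. \<alpha>' (x i t - x j t) * (v i t - v j t) * b (v i t - v j t))
       + (\<Sum>i=1..N. \<Sum>j=1..N. \<alpha> (x i t - x j t) * b' (v i t - v j t) * (acceleration \<phi> N x v i t - acceleration \<phi> N x v j t))"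
    by (simp add: sum.distrib)
  also have "(\<Sum>i=1..N. \<Sum>j=1..N. \<alpha> (x i t - x j t) * b' (v i t - v j t) * (acceleration \<phi> N x v i t - acceleration \<phi> N x v j t))
    = 1 / real N * (\<Sum>i=1..N. \<Sum>j=1..N. \<phi> (torus_dist (x i t) (x j t)) * (v j t - v i t) *
        ((\<Sum>l=1..N. \<alpha> (x i t - x l t) * b' (v i t - v l t)) - (\<Sum>l=1..N. \<alpha> (x j t - x l t) * b' (v j t - v l t))))"
  proof (rule sum_alignment_symmetrized)
    fix i j show "\<alpha> (x j t - x i t) * b' (v j t - v i t) = - (\<alpha> (x i t - x j t) * b' (v i t - v j t))"
      using odd[of "x i t - x j t" "v i t - v j t"] by simp
  qed (auto simp: torus_dist_commute acceleration_def)
  finally show ?thesis .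
qed

lemma variation_derivative:
  assumes sol: "cs_solution \<phi> N x v" and t: "t \<ge> 0" and N: "N \<ge> 1"
  shows "((\<lambda>t. variation N (\<lambda>i. v i t)) has_real_derivative
     - (2 * 1 * dissipation \<phi> N (\<lambda>i. x i t) (\<lambda>i. v i t))) (at t within {0..})"
proof -
  have "((\<lambda>t. \<Sum>i=1..N. \<Sum>j=1..N. 1 * (v i t - v j t)\<^sup>2) has_real_derivative
     (\<Sum>i=1..N. \<Sum>j=1..N. 0 * (v i t - v j t) * (v i t - v j t)\<^sup>2)
     + 1 / real N * (\<Sum>i=1..N. \<Sum>j=1..N. \<phi> (torus_dist (x i t) (x j t)) * (v j t - v i t) *
        ((\<Sum>l=1..N. 1 * (2 * (v i t - v l t))) - (\<Sum>l=1..N. 1 * (2 * (v j t - v l t))))))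
     (at t within {0..})"
    by (rule pair_functional_derivative[OF sol t, where \<alpha> = "\<lambda>_. 1" and b = "\<lambda>w. w\<^sup>2" and b' = "\<lambda>w. 2 * w"])
      (auto intro!: derivative_eq_intros)
  also have "(\<Sum>i=1..N. \<Sum>j=1..N. 0 * (v i t - v j t) * (v i t - v j t)\<^sup>2)
     + 1 / real N * (\<Sum>i=1..N. \<Sum>j=1..N. \<phi> (torus_dist (x i t) (x j t)) * (v j t - v i t) *
        ((\<Sum>l=1..N. 1 * (2 * (v i t - v l t))) - (\<Sum>l=1..N. 1 * (2 * (v j t - v l t)))))
     = 1 / real N * (\<Sum>i=1..N. \<Sum>j=1..N. (2 * real N) * (- (\<phi> (torus_dist (x i t) (x j t)) * (v i t - v j t)\<^sup>2)))"
    by (simp add: sum_subtractf sum_distrib_left[symmetric] power2_eq_square algebra_simps)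
  also have "\<dots> = - 2 * (\<Sum>i=1..N. \<Sum>j=1..N. \<phi> (torus_dist (x i t) (x j t)) * (v i t - v j t)\<^sup>2)"
    using N by (simp add: sum_distrib_left[symmetric] sum_negf)
  finally have "((\<lambda>t. 1 / (real N)\<^sup>2 * (\<Sum>i=1..N. \<Sum>j=1..N. 1 * (v i t - v j t)\<^sup>2)) has_real_derivative
     1 / (real N)\<^sup>2 * (- 2 * (\<Sum>i=1..N. \<Sum>j=1..N. \<phi> (torus_dist (x i t) (x j t)) * (v i t - v j t)\<^sup>2)))
     (at t within {0..})"
    by (rule DERIV_cmult)
  then show ?thesis by (simp add: variation_def dissipation_def)
qed

lemma variation_nonneg: "variation N u \<ge> 0"
  unfolding variation_def by (intro mult_nonneg_nonneg sum_nonneg) auto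

text \<open>Equal indices are exempt because their summand vanishes; in the singular case \<open>\<phi> 0\<close> may be negative.\<close>

lemma dissipation_nonneg:
  assumes "\<And>i j. i \<in> {1..N} \<Longrightarrow> j \<in> {1..N} \<Longrightarrow> i \<noteq> j \<Longrightarrow> \<phi> (torus_dist (x i) (x j)) \<ge> 0"
  shows "dissipation \<phi> N x v \<ge> 0"
proof -
  have "0 \<le> \<phi> (torus_dist (x i) (x j)) * (v i - v j)\<^sup>2" if "i \<in> {1..N}" "j \<in> {1..N}" for i j
    using assms that by (cases "i = j") auto
  then show ?thesis unfolding dissipation_def by (intro mult_nonneg_nonneg[OF _ sum_nonneg] sum_nonneg) auto
qed

lemma variation_nonincreasing:
  assumes sol: "cs_solution \<phi> N x v" and N: "N \<ge> 1"
    and nonneg: "\<And>i j t. i \<in> {1..N} \<Longrightarrow> j \<in> {1..N} \<Longrightarrow> i \<noteq> j \<Longrightarrow> t \<ge> 0 \<Longrightarrow> \<phi> (torus_dist (x i t) (x j t)) \<ge> 0"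
    and st: "0 \<le> s" "s \<le> t"
  shows "variation N (\<lambda>i. v i t) \<le> variation N (\<lambda>i. v i s)"
proof (rule nonincreasing_on_halfline[where f = "\<lambda>t. variation N (\<lambda>i. v i t)"
      and f' = "\<lambda>t. - (2 * 1 * dissipation \<phi> N (\<lambda>i. x i t) (\<lambda>i. v i t))"])
  fix u assume "s \<le> u" "u \<le> t"
  then show "((\<lambda>t. variation N (\<lambda>i. v i t)) has_real_derivative
      - (2 * 1 * dissipation \<phi> N (\<lambda>i. x i u) (\<lambda>i. v i u))) (at u within {0..})"
    using st by (intro variation_derivative[OF sol _ N]) auto
next
  fix u assume "s < u" "u < t"
  then show "- (2 * 1 * dissipation \<phi> N (\<lambda>i. x i u) (\<lambda>i. v i u)) \<le> 0"
    using st nonneg by (auto intro!: dissipation_nonneg)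
qed (use st in auto)

lemma variation_initial_le:
  assumes A: "velocity_spread_le N u A" and N: "N \<ge> 1"
  shows "variation N u \<le> A\<^sup>2"
proof -
  have "(\<Sum>i=1..N. \<Sum>j=1..N. \<bar>u i - u j\<bar>\<^sup>2) \<le> (\<Sum>i=1..N. \<Sum>j=1..N. A\<^sup>2)"
    using A unfolding velocity_spread_le_def
    by (intro sum_mono power_mono) auto
  also have "\<dots> = (real N)\<^sup>2 * A\<^sup>2" by (simp add: power2_eq_square)
  finally show ?thesis
    using N by (simp add: variation_def field_simps)
qed

section \<open>Antiderivative of the kernel\<close>

text \<open>For \<open>z\<close> in \<open>(0, 2\<pi>)\<close> the argument \<open>arccos (cos z)\<close> is the distance of \<open>0\<close> and \<open>z\<close> on the circle.\<close>

lemma kernel_antiderivative: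
  assumes cont: "continuous_on {0<..} \<phi>"
  obtains F where "\<And>z. 0 < z \<Longrightarrow> z < 2 * pi \<Longrightarrow> (F has_real_derivative \<phi> (arccos (cos z))) (at z)"
proof -
  have "isCont (\<lambda>z. \<phi> (arccos (cos z))) z" if z: "ereal 0 < ereal z" "ereal z < ereal (2 * pi)" for z
  proof -
    have "cos z \<noteq> 1"
    proof
      assume "cos z = 1"
      then obtain n :: int where n: "z = of_int n * 2 * pi" by (auto simp: cos_one_2pi_int)
      with z have "0 < real_of_int n" "real_of_int n < 1" by (auto simp: zero_less_mult_iff)
      then have "0 < n" "n < 1" by simp_all
      then show False by linarith
    qed
    then have "arccos (cos z) \<noteq> 0" by (metis cos_arccos_abs abs_cos_le_one cos_zero)
    then have pos: "arccos (cos z) > 0" using arccos_lbound[of "cos z"] by simp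
    have "isCont (\<lambda>z. arccos (cos z)) z"
    proof -
      have "continuous_on UNIV (\<lambda>z::real. arccos (cos z))"
        by (intro continuous_on_compose2[OF continuous_on_arccos'] continuous_intros) auto
      then show ?thesis by (simp add: continuous_on_eq_continuous_at)
    qed
    moreover have "isCont \<phi> (arccos (cos z))"
      using cont pos by (simp add: continuous_on_eq_continuous_at)
    ultimately show ?thesis by (rule isCont_o2)
  qed
  from einterval_antiderivative[of "ereal 0" "ereal (2 * pi)", OF _ this] obtain F
    where "\<And>z. 0 < z \<Longrightarrow> z < 2 * pi \<Longrightarrow> (F has_vector_derivative \<phi> (arccos (cos z))) (at z)"
    by auto
  then show ?thesis by (intro that) (simp add: has_real_derivative_iff_has_vector_derivative)
qed

lemma deriv_nonneg_mono_2pi: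
  fixes F :: "real \<Rightarrow> real"
  assumes der: "\<And>z. 0 < z \<Longrightarrow> z < 2 * pi \<Longrightarrow> (F has_real_derivative f z) (at z)"
    and nonneg: "\<And>z. 0 < z \<Longrightarrow> z < 2 * pi \<Longrightarrow> f z \<ge> 0"
    and yz: "0 < y" "y \<le> z" "z < 2 * pi"
  shows "F y \<le> F z"
  by (rule DERIV_nonneg_imp_nondecreasing[OF yz(2)])
    (meson assms le_less_trans less_le_trans)

text \<open>A non-integrable singularity makes the antiderivative tend to \<open>-\<infinity>\<close> at \<open>0\<close>.\<close>

lemma antiderivative_at_0:
  assumes sing: "singular_kernel \<phi>" and nonneg: "\<And>r. r > 0 \<Longrightarrow> \<phi> r \<ge> 0"
    and F: "\<And>z. 0 < z \<Longrightarrow> z < 2 * pi \<Longrightarrow> (F has_real_derivative \<phi> (arccos (cos z))) (at z)"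
  shows "\<exists>\<delta>>0. \<forall>z. 0 < z \<and> z < \<delta> \<longrightarrow> F z < B"
proof (rule ccontr)
  assume "\<not> (\<exists>\<delta>>0. \<forall>z. 0 < z \<and> z < \<delta> \<longrightarrow> F z < B)"
  then have big: "\<exists>z. 0 < z \<and> z < \<delta> \<and> F z \<ge> B" if "\<delta> > 0" for \<delta>
    using that by (meson not_le)
  have cont: "continuous_on {0<..} \<phi>" using sing kernel_continuous by auto
  have id: "arccos (cos z) = z" if "0 < z" "z \<le> 1" for z :: real
    using that pi_gt3 by (intro arccos_cos) auto
  have F1: "(F has_real_derivative \<phi> z) (at z)" if "0 < z" "z \<le> 1" for z
    using F[of z] id[OF that] that pi_gt3 by simp
  have FB: "F z \<ge> B" if z: "0 < z" "z \<le> 1" for z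
  proof -
    obtain y where y: "0 < y" "y < z" "F y \<ge> B" using big[OF z(1)] by auto
    have "F y \<le> F z"
    proof (rule DERIV_nonneg_imp_nondecreasing[of y z F])
      fix u assume "y \<le> u" "u \<le> z"
      then have "0 < u" "u \<le> 1" using y z by auto
      then show "\<exists>w. DERIV F u :> w \<and> w \<ge> 0" using F1 nonneg by blast
    qed (use y in auto)
    with y show ?thesis by simp
  qed
  define f where "f x = indicator {0<..} x *\<^sub>R \<phi> x" for x :: real
  have meas [measurable]: "f \<in> borel_measurable borel"
    unfolding f_def using cont by (intro borel_measurable_continuous_on_indicator) auto
  have bound: "(\<integral>\<^sup>+x. ennreal (f x) * indicator {1 / real (Suc n)..1} x \<partial>lborel) \<le> ennreal (F 1 - B)" for n
  proof -
    have "(\<integral>\<^sup>+x. ennreal (f x) * indicator {1 / real (Suc n)..1} x \<partial>lborel) = F 1 - F (1 / real (Suc n))"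
    proof (rule nn_integral_FTC_Icc[OF meas])
      fix x :: real assume "x \<in> {1 / real (Suc n)..1}"
      then have x: "1 / real (Suc n) \<le> x" "x \<le> 1" by auto
      moreover have "0 < 1 / real (Suc n)" by simp
      ultimately have "x > 0" using x by linarith
      then show "(F has_real_derivative f x) (at x)" "0 \<le> f x"
        using F1[of x] x nonneg by (auto simp: f_def)
    qed auto
    also have "\<dots> \<le> ennreal (F 1 - B)" using FB[of "1 / real (Suc n)"] by (intro ennreal_leI) auto
    finally show ?thesis .
  qed
  have "(\<integral>\<^sup>+ r\<in>{0<..1}. ennreal (\<phi> r) \<partial>lborel)
      = (\<integral>\<^sup>+ x. (SUP n. ennreal (f x) * indicator {1 / real (Suc n)..1} x) \<partial>lborel)"
  proof (rule nn_integral_cong)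
    fix x :: real
    show "ennreal (\<phi> x) * indicator {0<..1} x = (SUP n. ennreal (f x) * indicator {1 / real (Suc n)..1} x)"
    proof (cases "0 < x \<and> x \<le> 1")
      case True
      then obtain n where n: "1 / real (Suc n) < x" using nat_approx_posE by blast
      have "(SUP n. ennreal (f x) * indicator {1 / real (Suc n)..1} x) = ennreal (f x)"
      proof (rule antisym)
        show "(SUP n. ennreal (f x) * indicator {1 / real (Suc n)..1} x) \<le> ennreal (f x)"
          by (intro SUP_least) (auto simp: indicator_def)
        show "ennreal (f x) \<le> (SUP n. ennreal (f x) * indicator {1 / real (Suc n)..1} x)"
          by (rule SUP_upper2[of n]) (use n True in auto)
      qed
      with True show ?thesis by (simp add: f_def)
    next
      case False
      moreover have "\<not> 1 / real (Suc n) \<le> x" if "x \<le> 0" for n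
      proof -
        have "0 < 1 / real (Suc n)" by simp
        with that show ?thesis by linarith
      qed
      ultimately show ?thesis by (auto simp: indicator_def not_le f_def)
    qed
  qed
  also have "\<dots> = (SUP n. \<integral>\<^sup>+ x. ennreal (f x) * indicator {1 / real (Suc n)..1} x \<partial>lborel)"
  proof (rule nn_integral_monotone_convergence_SUP)
    show "incseq (\<lambda>n x. ennreal (f x) * indicator {1 / real (Suc n)..1} x)"
    proof (intro incseq_SucI le_funI mult_left_mono)
      fix n x
      have "1 / real (Suc (Suc n)) \<le> 1 / real (Suc n)" by (simp add: field_simps)
      then show "(indicator {1 / real (Suc n)..1} x :: ennreal) \<le> indicator {1 / real (Suc (Suc n))..1} x"
        by (intro indicator_leI) auto
    qed auto
  qed auto
  also have "\<dots> \<le> ennreal (F 1 - B)" by (intro SUP_least bound)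
  finally have "top \<le> ennreal (F 1 - B)" using sing by (simp add: singular_kernel_def)
  then show False by (simp add: top_unique)
qed

section \<open>Singular kernels: agents never collide\<close>

text \<open>The lift of the difference \<open>x i - x j\<close> that starts in \<open>[0, 2\<pi>)\<close>.\<close>

definition gap :: "(nat \<Rightarrow> real \<Rightarrow> real) \<Rightarrow> nat \<Rightarrow> nat \<Rightarrow> real \<Rightarrow> real" where
  "gap x i j t = x i t - x j t - 2 * pi * of_int \<lfloor>(x i 0 - x j 0) / (2 * pi)\<rfloor>"

lemma cos_gap: "cos (gap x i j t) = cos (x i t - x j t)"
  using cos_add_2pi_int[of "x i t - x j t" "- \<lfloor>(x i 0 - x j 0) / (2 * pi)\<rfloor>"]
  by (simp add: gap_def)

lemma gap_initial: "0 \<le> gap x i j 0" "gap x i j 0 < 2 * pi"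
proof -
  have "of_int \<lfloor>(x i 0 - x j 0) / (2 * pi)\<rfloor> \<le> (x i 0 - x j 0) / (2 * pi)"
    "(x i 0 - x j 0) / (2 * pi) < of_int \<lfloor>(x i 0 - x j 0) / (2 * pi)\<rfloor> + 1"
    by linarith+
  then have "of_int \<lfloor>(x i 0 - x j 0) / (2 * pi)\<rfloor> * (2 * pi) \<le> x i 0 - x j 0"
    "x i 0 - x j 0 < (of_int \<lfloor>(x i 0 - x j 0) / (2 * pi)\<rfloor> + 1) * (2 * pi)"
    by (simp_all only: pos_le_divide_eq[of "2 * pi"] pos_divide_less_eq[of "2 * pi"] pi_gt_zero mult_pos_pos zero_less_numeral)
  then show "0 \<le> gap x i j 0" "gap x i j 0 < 2 * pi"
    by (simp_all add: gap_def algebra_simps)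
qed

lemma multiple_2pi_open_interval:
  assumes "- 2 * pi < 2 * pi * of_int n" "2 * pi * of_int n < 2 * pi"
  shows "n = 0"
proof -
  have "2 * pi * (- 1) < 2 * pi * real_of_int n" using assms(1) by simp
  then have "- 1 < real_of_int n" by (subst (asm) mult_less_cancel_left_pos) auto
  moreover have "real_of_int n < 1" using assms(2) by simp
  ultimately show ?thesis by linarith
qed

lemma arccos_cos_pos:
  assumes "0 < z" "z < 2 * pi"
  shows "0 < arccos (cos z)"
proof -
  have "cos z \<noteq> 1"
  proof
    assume "cos z = 1"
    then obtain n :: int where n: "z = 2 * pi * of_int n" by (auto simp: cos_one_2pi_int)
    have "n = 0"
    proof (rule multiple_2pi_open_interval)
      show "- 2 * pi < 2 * pi * of_int n" using assms(1) pi_gt_zero unfolding n by linarith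
    qed (use assms n in auto)
    with n assms show False by simp
  qed
  then have "arccos (cos z) \<noteq> 0" by (metis cos_arccos_abs abs_cos_le_one cos_zero)
  then show ?thesis using arccos_lbound[of "cos z"] by simp
qed

lemma gap_swap:
  assumes "0 < gap x i j t" "gap x i j t < 2 * pi" "0 < gap x j i t" "gap x j i t < 2 * pi"
  shows "gap x j i t = 2 * pi - gap x i j t"
proof -
  define n where "n = - \<lfloor>(x i 0 - x j 0) / (2 * pi)\<rfloor> - \<lfloor>(x j 0 - x i 0) / (2 * pi)\<rfloor> - 1"
  have eq: "gap x i j t + gap x j i t - 2 * pi = 2 * pi * of_int n"
    by (simp add: gap_def n_def algebra_simps)
  have "n = 0"
    by (rule multiple_2pi_open_interval) (use assms eq[symmetric] in auto)
  then show ?thesis using eq by simp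
qed

lemma gap_derivative:
  assumes "cs_solution \<phi> N x v" "i \<in> {1..N}" "j \<in> {1..N}" "t \<ge> 0"
  shows "(gap x i j has_real_derivative (v i t - v j t)) (at t within {0..})"
  unfolding gap_def
  by (auto intro!: derivative_eq_intros cs_derivs(1)[OF assms(1,2,4)] cs_derivs(1)[OF assms(1,3,4)])

lemma gap_continuous:
  assumes "cs_solution \<phi> N x v" "i \<in> {1..N}" "j \<in> {1..N}"
  shows "continuous_on {0..} (gap x i j)"
  using gap_derivative[OF assms] by (auto simp: continuous_on_eq_continuous_within intro: DERIV_continuous)

text \<open>Up to and including a first collision time \<open>T\<close>, a lifted difference cannot leave \<open>[0, 2\<pi>]\<close>.\<close>

lemma stays_in_interval:
  fixes z :: "real \<Rightarrow> real"
  assumes cont: "continuous_on {0..} z" and z0: "0 \<le> z 0" "z 0 < 2 * pi"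
    and nc: "\<And>s. 0 \<le> s \<Longrightarrow> s < T \<Longrightarrow> cos (z s) \<noteq> 1" and T: "T > 0"
  shows "0 \<le> z T" "z T \<le> 2 * pi"
proof -
  have cont': "continuous_on {0..T} z" by (rule continuous_on_subset[OF cont]) auto
  show "0 \<le> z T"
  proof (rule ccontr)
    assume "\<not> 0 \<le> z T"
    then obtain s where "0 \<le> s" "s \<le> T" "z s = 0"
      using IVT2'[of z T 0 0] z0 T cont' by auto
    then show False using nc[of s] \<open>\<not> 0 \<le> z T\<close> by (cases "s = T") auto
  qed
  show "z T \<le> 2 * pi"
  proof (rule ccontr)
    assume "\<not> z T \<le> 2 * pi"
    then obtain s where "0 \<le> s" "s \<le> T" "z s = 2 * pi"
      using IVT'[of z 0 "2 * pi" T] z0 T cont' by auto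
    then show False using nc[of s] \<open>\<not> z T \<le> 2 * pi\<close> by (cases "s = T") auto
  qed
qed

lemma gap_interval:
  assumes sol: "cs_solution \<phi> N x v" and ij: "i \<in> {1..N}" "j \<in> {1..N}"
    and nc: "\<And>s. 0 \<le> s \<Longrightarrow> s \<le> T \<Longrightarrow> cos (x i s - x j s) \<noteq> 1" and T: "T \<ge> 0"
  shows "0 < gap x i j T" "gap x i j T < 2 * pi"
proof -
  have le: "0 \<le> gap x i j T \<and> gap x i j T \<le> 2 * pi"
  proof (cases "T = 0")
    case True then show ?thesis using gap_initial[of x i j] by auto
  next
    case False
    show ?thesis
      using stays_in_interval[OF gap_continuous[OF sol ij] gap_initial, of T] nc False T
      by (auto simp: cos_gap)
  qed
  moreover have "cos (gap x i j T) \<noteq> 1" using nc[of T] T by (simp add: cos_gap)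
  ultimately show "0 < gap x i j T" "gap x i j T < 2 * pi"
    by (metis cos_zero order_le_imp_less_or_eq, metis cos_two_pi order_le_imp_less_or_eq \<open>0 \<le> gap x i j T \<and> gap x i j T \<le> 2 * pi\<close>)
qed

text \<open>The derivative of \<open>F (gap x i j)\<close> is the interaction of \<open>i\<close> and \<open>j\<close> with the opposite sign.\<close>

lemma conserved_quantity:
  assumes sol: "cs_solution \<phi> N x v" and i: "i \<in> {1..N}" and T: "T \<ge> 0"
    and F: "\<And>z. 0 < z \<Longrightarrow> z < 2 * pi \<Longrightarrow> (F has_real_derivative \<phi> (arccos (cos z))) (at z)"
    and gaps: "\<And>j s. j \<in> {1..N} - {i} \<Longrightarrow> 0 \<le> s \<Longrightarrow> s \<le> T \<Longrightarrow> 0 < gap x i j s \<and> gap x i j s < 2 * pi"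
  shows "v i T + 1 / real N * (\<Sum>j\<in>{1..N} - {i}. F (gap x i j T))
    = v i 0 + 1 / real N * (\<Sum>j\<in>{1..N} - {i}. F (gap x i j 0))"
proof -
  define w where "w s = v i s + 1 / real N * (\<Sum>j\<in>{1..N} - {i}. F (gap x i j s))" for s
  have der: "(w has_real_derivative 0) (at s within {0..})" if s: "0 \<le> s" "s \<le> T" for s
  proof -
    have "((\<lambda>s. F (gap x i j s)) has_real_derivative
        \<phi> (torus_dist (x i s) (x j s)) * (v i s - v j s)) (at s within {0..})"
      if j: "j \<in> {1..N} - {i}" for j
    proof -
      have "0 < gap x i j s" "gap x i j s < 2 * pi" using gaps[OF j s] by auto
      from DERIV_chain2[OF F[OF this] gap_derivative[OF sol i _ s(1), of j]] j
      show ?thesis by (simp add: cos_gap torus_dist_eq)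
    qed
    then have "(w has_real_derivative acceleration \<phi> N x v i s
        + 1 / real N * (\<Sum>j\<in>{1..N} - {i}. \<phi> (torus_dist (x i s) (x j s)) * (v i s - v j s))) (at s within {0..})"
      unfolding w_def
      by (intro DERIV_add DERIV_cmult DERIV_sum cs_derivs[OF sol i s(1)]) auto
    moreover have "(\<Sum>j=1..N. \<phi> (torus_dist (x i s) (x j s)) * (v j s - v i s))
      = (\<Sum>j\<in>{1..N} - {i}. \<phi> (torus_dist (x i s) (x j s)) * (v j s - v i s))"
      by (subst sum.remove[OF _ i]) auto
    then have "acceleration \<phi> N x v i s
        + 1 / real N * (\<Sum>j\<in>{1..N} - {i}. \<phi> (torus_dist (x i s) (x j s)) * (v i s - v j s)) = 0"
      unfolding acceleration_def distrib_left[symmetric]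
      by (simp add: sum.distrib[symmetric] distrib_left[symmetric])
    ultimately show ?thesis by simp
  qed
  have "w T \<le> w 0"
    by (rule nonincreasing_on_halfline[where f = w and f' = "\<lambda>_. 0"]) (use der T in auto)
  moreover have "- w T \<le> - w 0"
  proof (rule nonincreasing_on_halfline[where f = "\<lambda>t. - w t" and f' = "\<lambda>_. 0"])
    fix s assume "0 \<le> s" "s \<le> T"
    then show "((\<lambda>t. - w t) has_real_derivative 0) (at s within {0..})"
      using DERIV_minus[OF der[of s]] by simp
  qed (use T in auto)
  ultimately show ?thesis unfolding w_def by linarith
qed

text \<open>At a first collision time \<open>T\<close> take the cluster \<open>K\<close> of the agents that meet \<open>p\<close>, and among them the
  foremost agent \<open>a\<close>. Its lifted differences to the other members of \<open>K\<close> tend to \<open>0\<close>, and to no agent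
  do they tend to \<open>2\<pi>\<close>. Then the sum of \<open>F\<close> over the lifted differences of \<open>a\<close> tends to \<open>-\<infinity>\<close>, and the
  conservation law forces \<open>v a\<close> to tend to \<open>+\<infinity>\<close>, although \<open>v a\<close> is continuous at \<open>T\<close>.\<close>

lemma no_collision:
  assumes sol: "cs_solution \<phi> N x v" and sing: "singular_kernel \<phi>"
    and nonneg: "\<And>r. r > 0 \<Longrightarrow> \<phi> r \<ge> 0"
    and ij: "i \<in> {1..N}" "j \<in> {1..N}" "i \<noteq> j" and t: "t \<ge> 0"
  shows "cos (x i t - x j t) \<noteq> 1"
proof
  assume coll: "cos (x i t - x j t) = 1"
  obtain F where F: "\<And>z. 0 < z \<Longrightarrow> z < 2 * pi \<Longrightarrow> (F has_real_derivative \<phi> (arccos (cos z))) (at z)"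
    using kernel_antiderivative kernel_continuous sing by blast
  have F_mono: "F y \<le> F z" if "0 < y" "y \<le> z" "z < 2 * pi" for y z
  proof (rule deriv_nonneg_mono_2pi[OF F _ that])
    fix z :: real assume "0 < z" "z < 2 * pi"
    then show "0 \<le> \<phi> (arccos (cos z))" by (intro nonneg arccos_cos_pos)
  qed
  define I where "I = {1..N}"
  define S where "S = (\<Union>p\<in>I. \<Union>q\<in>I-{p}. {s\<in>{0..}. cos (x p s - x q s) = 1})"
  define T where "T = Inf S"
  have S_ge: "s \<ge> 0" if "s \<in> S" for s using that by (auto simp: S_def)
  have "closed S" unfolding S_def
  proof (intro closed_UN finite_Diff ballI)
    fix p q assume "p \<in> I" "q \<in> I - {p}"
    then have "continuous_on {0..} (\<lambda>s. cos (x p s - x q s))"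
      using cs_continuous(1)[OF sol] by (auto simp: I_def intro!: continuous_intros)
    then show "closed {s\<in>{0..}. cos (x p s - x q s) = 1}"
      by (rule continuous_closed_preimage_constant) auto
  qed (auto simp: I_def)
  moreover have bdd: "bdd_below S" using S_ge by (auto intro: bdd_belowI[of _ 0])
  moreover have "t \<in> S"
    unfolding S_def by (intro UN_I[of i] UN_I[of j]) (use coll ij t in \<open>auto simp: I_def\<close>)
  ultimately have TS: "T \<in> S" unfolding T_def by (intro closed_contains_Inf) auto
  then obtain p q where pq: "p \<in> I" "q \<in> I" "p \<noteq> q" "cos (x p T - x q T) = 1" by (auto simp: S_def)
  have before: "cos (x k s - x l s) \<noteq> 1" if "k \<in> I" "l \<in> I" "k \<noteq> l" "0 \<le> s" "s < T" for k l s
  proof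
    assume "cos (x k s - x l s) = 1"
    with that have "s \<in> S" by (auto simp: S_def)
    then have "T \<le> s" unfolding T_def using bdd by (intro cInf_lower)
    with that show False by simp
  qed
  have "T \<noteq> 0"
  proof
    assume "T = 0"
    with pq sol sing show False
      unfolding cs_solution_def noncollisional_def I_def torus_dist_eq_0_iff by auto
  qed
  with TS S_ge have T: "T > 0" by force
  have gap_before: "0 < gap x k l s \<and> gap x k l s < 2 * pi"
    if "k \<in> I" "l \<in> I" "k \<noteq> l" "0 \<le> s" "s < T" for k l s
    using gap_interval[OF sol, of k l s] before that by (auto simp: I_def)
  have gap_T: "0 \<le> gap x k l T \<and> gap x k l T \<le> 2 * pi" if "k \<in> I" "l \<in> I" "k \<noteq> l" for k l
    using stays_in_interval[OF gap_continuous[OF sol, of k l] gap_initial, of T] before that T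
    by (auto simp: I_def cos_gap)
  have tendsto_T: "(f \<longlongrightarrow> f T) (at_left T)" if "continuous_on {0..} f" for f :: "real \<Rightarrow> real"
  proof -
    have "continuous (at T within {0..}) f" using that T by (simp add: continuous_on_eq_continuous_within)
    moreover have "at T within {0..} = at T"
      using T by (intro at_within_interior) (simp add: interior_Ici[of "T/2"])
    ultimately have "(f \<longlongrightarrow> f T) (at T)" by (simp add: continuous_within)
    then show ?thesis by (rule filterlim_mono) (auto simp: at_le)
  qed

  define K where "K = {k\<in>I. cos (x k T - x p T) = 1}"
  have finK: "finite K" by (auto simp: K_def I_def)
  have "\<exists>m::int. x k T - x p T = 2 * pi * of_int m" if "k \<in> K" for k
    using that by (auto simp: K_def cos_one_2pi_int mult_ac)
  then obtain m :: "nat \<Rightarrow> int" where m: "\<And>k. k \<in> K \<Longrightarrow> x k T - x p T = 2 * pi * of_int (m k)" by metis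
  \<comment> \<open>lifts of the cluster that all meet in the same real point\<close>
  define y where "y k s = x k s - 2 * pi * of_int (m k)" for k s
  have yT: "y k T = x p T" if "k \<in> K" for k using m[OF that] by (simp add: y_def)
  have "eventually (\<lambda>s. \<forall>k\<in>K. \<bar>y k s - x p T\<bar> < 1) (at_left T)"
  proof (intro eventually_ball_finite finK ballI)
    fix k assume k: "k \<in> K"
    then have "continuous_on {0..} (y k)"
      using cs_continuous(1)[OF sol, of k] by (auto simp: y_def K_def I_def intro!: continuous_intros)
    from tendsto_T[OF this] yT[OF k] have "(y k \<longlongrightarrow> x p T) (at_left T)" by simp
    from tendstoD[OF this, of 1] show "\<forall>\<^sub>F s in at_left T. \<bar>y k s - x p T\<bar> < 1"
      by (simp add: dist_real_def)
  qed
  moreover have "eventually (\<lambda>s. s \<in> {0<..<T}) (at_left T)"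
    using T by (intro eventually_at_left_real)
  ultimately have "eventually (\<lambda>s. (\<forall>k\<in>K. \<bar>y k s - x p T\<bar> < 1) \<and> s \<in> {0<..<T}) (at_left T)"
    by (rule eventually_conj)
  then obtain s where s: "\<And>k. k \<in> K \<Longrightarrow> \<bar>y k s - x p T\<bar> < 1" "0 < s" "s < T"
    using eventually_happens'[OF trivial_limit_at_left_real] by fastforce
  have "p \<in> K" using pq by (auto simp: K_def)
  have "q \<in> K" using pq by (auto simp: K_def cos_diff mult.commute)
  have "Max ((\<lambda>k. y k s) ` K) \<in> (\<lambda>k. y k s) ` K"
    using finK \<open>p \<in> K\<close> by (intro Max_in) auto
  then obtain a where a: "a \<in> K" "y a s = Max ((\<lambda>k. y k s) ` K)" by auto
  have a_max: "y k s \<le> y a s" if "k \<in> K" for k using a(2) finK that by simp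
  have aI: "a \<in> I" using a by (simp add: K_def)
  have gap0: "gap x a k T = 0" if k: "k \<in> K" "k \<noteq> a" for k
  proof -
    define n where "n = m a - m k - \<lfloor>(x a 0 - x k 0) / (2 * pi)\<rfloor>"
    have eq: "gap x a k u = y a u - y k u + 2 * pi * of_int n" for u
      by (simp add: gap_def y_def n_def algebra_simps)
    have g: "0 < gap x a k s" "gap x a k s < 2 * pi"
      using gap_before[of a k s] aI k s by (auto simp: K_def)
    have d: "0 \<le> y a s - y k s" "y a s - y k s < 2"
      using a_max[OF k(1)] s(1)[OF k(1)] s(1)[OF a(1)] by auto
    \<comment> \<open>the lift \<open>gap x a k\<close> agrees with \<open>y a - y k\<close>: at time \<open>s\<close> both lie in intervals too short for a shift\<close>
    have "n = 0"
      by (rule multiple_2pi_open_interval) (use eq[of s] g d pi_gt3 in linarith)+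
    then show ?thesis using eq[of T] yT[OF k(1)] yT[OF a(1)] by simp
  qed
  obtain b where b: "b \<in> K" "b \<noteq> a" using \<open>p \<in> K\<close> \<open>q \<in> K\<close> pq(3) by metis
  have bI: "b \<in> I" using b by (simp add: K_def)
  have gap_lt: "gap x a k T < 2 * pi" if k: "k \<in> I" "k \<noteq> a" for k
  proof (cases "k \<in> K")
    case True then show ?thesis using gap0 k by simp
  next
    case False
    have "cos (x a T - x k T) \<noteq> 1"
    proof
      assume "cos (x a T - x k T) = 1"
      then obtain n1 where n1: "x a T - x k T = of_int n1 * 2 * pi" by (auto simp: cos_one_2pi_int)
      then have "x k T - x p T = of_int (m a - n1) * 2 * pi" using m[OF a(1)] by (simp add: algebra_simps)
      then have "cos (x k T - x p T) = 1" unfolding cos_one_2pi_int by blast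
      then show False using False k by (simp add: K_def)
    qed
    then show ?thesis using gap_T[of a k] k aI
      by (metis cos_gap cos_two_pi order_le_imp_less_or_eq)
  qed
  \<comment> \<open>near \<open>T\<close> the differences stay below a bound less than \<open>2\<pi>\<close>, so that all values of \<open>F\<close> are bounded above\<close>
  define B where "B k = F ((gap x a k T + 2 * pi) / 2)" for k
  have cont_gap: "continuous_on {0..} (gap x a k)" if "k \<in> I" for k
    using gap_continuous[OF sol] aI that by (auto simp: I_def)
  have ev_B: "\<forall>\<^sub>F u in at_left T. \<forall>k\<in>I-{a}. gap x a k u < (gap x a k T + 2 * pi) / 2"
  proof (intro eventually_ball_finite ballI)
    fix k assume k: "k \<in> I - {a}"
    then show "\<forall>\<^sub>F u in at_left T. gap x a k u < (gap x a k T + 2 * pi) / 2"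
      using gap_lt[of k] by (intro order_tendstoD(2)[OF tendsto_T[OF cont_gap]]) auto
  qed (auto simp: I_def)
  define w where "w = v a 0 + 1 / real N * (\<Sum>k\<in>I - {a}. F (gap x a k 0))"
  \<comment> \<open>chosen so that \<open>F (gap x a b u) < C\<close> is incompatible with \<open>v a u < v a T + 1\<close>\<close>
  define C where "C = real N * (w - v a T - 1) - (\<Sum>k\<in>I - {a} - {b}. B k)"
  obtain \<delta> where \<delta>: "\<delta> > 0" "\<And>z. 0 < z \<Longrightarrow> z < \<delta> \<Longrightarrow> F z < C"
    using antiderivative_at_0[OF sing nonneg F] by blast
  have "\<forall>\<^sub>F u in at_left T. gap x a b u < \<delta>"
    using \<delta> gap0[OF b] by (intro order_tendstoD(2)[OF tendsto_T[OF cont_gap[OF bI]]]) auto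
  moreover have "\<forall>\<^sub>F u in at_left T. v a u < v a T + 1"
    using cs_continuous(2)[OF sol, of a] aI
    by (intro order_tendstoD(2)[OF tendsto_T]) (auto simp: I_def)
  moreover have "eventually (\<lambda>s. s \<in> {0<..<T}) (at_left T)"
    using T by (intro eventually_at_left_real)
  ultimately have "\<forall>\<^sub>F u in at_left T. gap x a b u < \<delta> \<and> v a u < v a T + 1 \<and> u \<in> {0<..<T} \<and>
      (\<forall>k\<in>I-{a}. gap x a k u < (gap x a k T + 2 * pi) / 2)"
    using ev_B by eventually_elim auto
  then obtain u where u: "gap x a b u < \<delta>" "v a u < v a T + 1" "0 < u" "u < T"
      "\<And>k. k \<in> I - {a} \<Longrightarrow> gap x a k u < (gap x a k T + 2 * pi) / 2"
    using eventually_happens'[OF trivial_limit_at_left_real] by fastforce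
  have "v a u + 1 / real N * (\<Sum>k\<in>I - {a}. F (gap x a k u)) = w"
    unfolding w_def I_def
    by (rule conserved_quantity[OF sol _ _ F]) (use gap_before aI u in \<open>auto simp: I_def\<close>)
  moreover have "N > 0" using aI by (auto simp: I_def)
  ultimately have eq: "(\<Sum>k\<in>I - {a}. F (gap x a k u)) = real N * (w - v a u)"
    by (simp add: field_simps)
  have "(\<Sum>k\<in>I - {a}. F (gap x a k u)) = F (gap x a b u) + (\<Sum>k\<in>I - {a} - {b}. F (gap x a k u))"
    using b bI by (subst sum.remove[of _ b]) (auto simp: I_def)
  also have "F (gap x a b u) < C"
    using \<delta>(2) u gap_before[of a b u] aI bI b by auto
  also have "(\<Sum>k\<in>I - {a} - {b}. F (gap x a k u)) \<le> (\<Sum>k\<in>I - {a} - {b}. B k)"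
  proof (rule sum_mono)
    fix k assume k: "k \<in> I - {a} - {b}"
    then show "F (gap x a k u) \<le> B k"
      unfolding B_def using gap_before[of a k u] u(3-4) u(5)[of k] gap_lt[of k] aI
      by (intro F_mono) auto
  qed
  finally have "(\<Sum>k\<in>I - {a}. F (gap x a k u)) < C + (\<Sum>k\<in>I - {a} - {b}. B k)" by simp
  then have "real N * (w - v a u) < real N * (w - v a T - 1)" unfolding eq by (simp add: C_def)
  then have "w - v a u < w - v a T - 1" using \<open>N > 0\<close> by simp
  with u(2) show False by simp
qed

section \<open>Singular kernels: gradient flow of a convex energy\<close>

text \<open>Paired with an arbitrary direction \<open>c\<close>, the gradient of the energy, with the entries
  \<open>f i j - (w i - w j)\<close>, acts as the negative velocity.\<close>

lemma sum_gradient_identity: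
  fixes f :: "nat \<Rightarrow> nat \<Rightarrow> real"
  assumes "N \<ge> 1"
    and anti: "\<And>i j. i \<in> {1..N} \<Longrightarrow> j \<in> {1..N} \<Longrightarrow> f j i = - f i j"
    and w: "\<And>i. i \<in> {1..N} \<Longrightarrow> w i = u i + 1 / real N * (\<Sum>j=1..N. f i j)"
  shows "(\<Sum>i=1..N. \<Sum>j=1..N. (f i j - (w i - w j)) * (c i - c j))
    = - (\<Sum>i=1..N. \<Sum>j=1..N. (u i - u j) * (c i - c j))"
proof -
  define d where "d i = w i - u i" for i
  have d: "(\<Sum>j=1..N. f i j) = real N * d i" if "i \<in> {1..N}" for i
    using w[OF that] assms(1) by (simp add: d_def)
  have "(\<Sum>i=1..N. \<Sum>j=1..N. f i j * (1 - 1)) = 2 * (\<Sum>i=1..N. 1 * (\<Sum>j=1..N. f i j))"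
    by (rule sum_antisym) (rule anti)
  also have "(\<Sum>i=1..N. 1 * (\<Sum>j=1..N. f i j)) = real N * (\<Sum>i=1..N. d i)"
    unfolding sum_distrib_left by (intro sum.cong refl) (simp only: d mult_1)
  finally have sum_d: "(\<Sum>i=1..N. d i) = 0" using assms(1) by simp
  have "(\<Sum>i=1..N. \<Sum>j=1..N. f i j * (c i - c j)) = 2 * (\<Sum>i=1..N. c i * (\<Sum>j=1..N. f i j))"
    by (rule sum_antisym) (rule anti)
  also have "\<dots> = 2 * (real N * (\<Sum>i=1..N. c i * d i))"
  proof -
    have "c i * (\<Sum>j=1..N. f i j) = real N * (c i * d i)" if "i \<in> {1..N}" for i
      by (subst d[OF that]) simp
    then show ?thesis unfolding sum_distrib_left[of "real N"]
      by (intro arg_cong[of _ _ "(*) 2"] sum.cong refl)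
  qed
  also have "\<dots> = (\<Sum>i=1..N. \<Sum>j=1..N. (d i - d j) * (c i - c j))"
    by (subst sum_diff_mult_diff) (simp only: sum_d, simp)
  finally have "(\<Sum>i=1..N. \<Sum>j=1..N. f i j * (c i - c j) - (d i - d j) * (c i - c j)) = 0"
    by (simp add: sum_subtractf)
  also have "(\<Sum>i=1..N. \<Sum>j=1..N. f i j * (c i - c j) - (d i - d j) * (c i - c j))
    = (\<Sum>i=1..N. \<Sum>j=1..N. (f i j - (w i - w j)) * (c i - c j) + (u i - u j) * (c i - c j))"
    by (intro sum.cong refl) (simp add: d_def algebra_simps)
  finally show ?thesis by (simp add: sum.distrib)
qed

lemma convex_below_tangent:
  fixes H F :: "real \<Rightarrow> real"
  assumes H: "\<And>z. a < z \<Longrightarrow> z < b \<Longrightarrow> (H has_real_derivative F z) (at z)"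
    and mono: "\<And>y z. a < y \<Longrightarrow> y \<le> z \<Longrightarrow> z < b \<Longrightarrow> F y \<le> F z"
    and yz: "a < y" "y < b" "a < z" "z < b"
  shows "H z - H y \<le> F z * (z - y)"
proof -
  consider "y < z" | "y = z" | "z < y" by linarith
  then show ?thesis
  proof cases
    case 1
    then obtain c where "y < c" "c < z" "H z - H y = (z - y) * F c"
      using MVT2[of y z H F] H yz by auto
    moreover from this have "(z - y) * F c \<le> (z - y) * F z"
      using mono[of c z] yz 1 by (intro mult_left_mono) auto
    ultimately show ?thesis by (simp add: mult.commute)
  next
    case 3
    then obtain c where "z < c" "c < y" "H y - H z = (y - z) * F c"
      using MVT2[of z y H F] H yz by auto
    moreover from this have "(y - z) * F z \<le> (y - z) * F c"
      using mono[of z c] yz 3 by (intro mult_left_mono) auto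
    ultimately show ?thesis by (simp add: algebra_simps)
  qed auto
qed

text \<open>The factor \<open>t\<^sup>2\<close> is that of the gradient flow of any convex function; the constant is uniform in \<open>N\<close>
  because all lifted differences remain in \<open>(0, 2\<pi>)\<close>.\<close>

lemma variation_decay_singular:
  assumes sol: "cs_solution \<phi> N x v" and sing: "singular_kernel \<phi>"
    and nonneg: "\<And>r. r > 0 \<Longrightarrow> \<phi> r \<ge> 0" and N: "N \<ge> 1" and T: "T > 0"
  shows "variation N (\<lambda>i. v i T) \<le> 4 * pi\<^sup>2 / T\<^sup>2"
proof -
  define I where "I = {1..N}"
  obtain F where F: "\<And>z. 0 < z \<Longrightarrow> z < 2 * pi \<Longrightarrow> (F has_real_derivative \<phi> (arccos (cos z))) (at z)"
    using kernel_antiderivative kernel_continuous sing by blast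
  have nonneg': "0 \<le> \<phi> (arccos (cos z))" if "0 < z" "z < 2 * pi" for z
    using that by (intro nonneg arccos_cos_pos)
  have F_mono: "F y \<le> F z" if "0 < y" "y \<le> z" "z < 2 * pi" for y z
    by (rule deriv_nonneg_mono_2pi[OF F nonneg' that])
  \<comment> \<open>normalised to be odd about \<open>\<pi>\<close>, which makes the forces antisymmetric\<close>
  define F0 where "F0 z = F z - F pi" for z
  have F0: "(F0 has_real_derivative \<phi> (arccos (cos z))) (at z)" if "0 < z" "z < 2 * pi" for z
    unfolding F0_def using F[OF that] by (auto intro!: derivative_eq_intros)
  have F0_mono: "F0 y \<le> F0 z" if "0 < y" "y \<le> z" "z < 2 * pi" for y z
    using F_mono[OF that] by (simp add: F0_def)
  have F0_anti: "F0 (2 * pi - z) = - F0 z" if z: "0 < z" "z < 2 * pi" for z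
  proof -
    define g where "g u = F0 u + F0 (2 * pi - u)" for u
    have "(g has_real_derivative 0) (at u)" if u: "0 < u" "u < 2 * pi" for u
    proof -
      have "((\<lambda>u. F0 (2 * pi - u)) has_real_derivative \<phi> (arccos (cos (2 * pi - u))) * (- 1)) (at u)"
        by (rule DERIV_chain2[OF F0]) (use u in \<open>auto intro!: derivative_eq_intros\<close>)
      moreover have "cos (2 * pi - u) = cos u" by (simp add: cos_diff)
      ultimately show ?thesis unfolding g_def using F0[OF u] by (auto intro!: derivative_eq_intros)
    qed
    then have "g z = g pi"
      using has_field_derivative_zero_constant[of "{0<..<2*pi}" g] z
      by (smt (verit) at_within_open greaterThanLessThan_iff open_greaterThanLessThan convex_real_interval(8) pi_gt_zero)
    then show ?thesis by (simp add: g_def F0_def)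
  qed
  have "isCont F0 z" if "ereal 0 < ereal z" "ereal z < ereal (2 * pi)" for z
    using F0[of z] that by (auto intro: DERIV_isCont)
  from einterval_antiderivative[of "ereal 0" "ereal (2 * pi)", OF _ this] obtain H
    where H: "\<And>z. 0 < z \<Longrightarrow> z < 2 * pi \<Longrightarrow> (H has_real_derivative F0 z) (at z)"
    by (auto simp: has_real_derivative_iff_has_vector_derivative)

  have gap: "0 < gap x i j s" "gap x i j s < 2 * pi" if "i \<in> I" "j \<in> I" "i \<noteq> j" "0 \<le> s" for i j s
    using gap_interval[OF sol, of i j s] no_collision[OF sol sing nonneg, of i j] that
    by (auto simp: I_def)
  define f where "f i j s = (if i = j then 0 else F0 (gap x i j s))" for i j s
  define h where "h i j s = (if i = j then 0 else H (gap x i j s))" for i j s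
  define w where "w i = v i 0 + 1 / real N * (\<Sum>j\<in>I. f i j 0)" for i
  have f_anti: "f j i s = - f i j s" if "i \<in> I" "j \<in> I" "s \<ge> 0" for i j s
    using gap_swap[of x i j s] gap[of i j s] gap[of j i s] F0_anti[of "gap x i j s"] that
    by (auto simp: f_def)
  have w: "w i = v i s + 1 / real N * (\<Sum>j\<in>I. f i j s)" if i: "i \<in> I" and s: "s \<ge> 0" for i s
  proof -
    have eq: "(\<Sum>j\<in>I. f i j u) = (\<Sum>j\<in>I - {i}. F0 (gap x i j u))" for u
      using i by (subst sum.remove[of _ i]) (auto simp: I_def f_def intro!: sum.cong)
    show ?thesis unfolding w_def eq unfolding I_def
      by (rule conserved_quantity[OF sol _ s F0, symmetric]) (use i gap in \<open>auto simp: I_def\<close>)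
  qed
  \<comment> \<open>up to the factor \<open>(real N)\<^sup>2\<close>, \<open>V\<close> is the variation and \<open>\<Phi>\<close> the energy; \<open>2 * W\<close> is the derivative of \<open>Q\<close>\<close>
  define V where "V s = (\<Sum>i\<in>I. \<Sum>j\<in>I. (v i s - v j s)\<^sup>2)" for s
  define \<Phi> where "\<Phi> s = (\<Sum>i\<in>I. \<Sum>j\<in>I. h i j s - (w i - w j) * (x i s - x j s))" for s
  define Q where "Q s = (\<Sum>i\<in>I. \<Sum>j\<in>I. ((x i s - x j s) - (x i T - x j T))\<^sup>2)" for s
  define W where "W s = (\<Sum>i\<in>I. \<Sum>j\<in>I. (v i s - v j s) * ((x i s - x j s) - (x i T - x j T)))" for s
  have V_eq: "V s = (real N)\<^sup>2 * variation N (\<lambda>i. v i s)" for s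
    using N by (simp add: V_def variation_def I_def)
  have V': "(V has_real_derivative (real N)\<^sup>2 * (- (2 * 1 * dissipation \<phi> N (\<lambda>i. x i s) (\<lambda>i. v i s)))) (at s within {0..})"
    if "s \<ge> 0" for s
    unfolding V_eq by (rule DERIV_cmult[OF variation_derivative[OF sol that N]])
  have diss: "0 \<le> dissipation \<phi> N (\<lambda>i. x i s) (\<lambda>i. v i s)" if "s \<ge> 0" for s
  proof (rule dissipation_nonneg)
    fix i j assume "i \<in> {1..N}" "j \<in> {1..N}" "i \<noteq> j"
    then have "cos (gap x i j s) = cos (x i s - x j s)" "0 < gap x i j s" "gap x i j s < 2 * pi"
      using gap that by (auto simp: I_def cos_gap)
    then show "0 \<le> \<phi> (torus_dist (x i s) (x j s))" using nonneg'[of "gap x i j s"] by (simp add: torus_dist_eq)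
  qed
  have \<Phi>': "(\<Phi> has_real_derivative - V s) (at s within {0..})" if s: "s \<ge> 0" for s
  proof -
    have "(\<Phi> has_real_derivative (\<Sum>i\<in>I. \<Sum>j\<in>I. (f i j s - (w i - w j)) * (v i s - v j s))) (at s within {0..})"
      unfolding \<Phi>_def
    proof (intro DERIV_sum)
      fix i j assume ij: "i \<in> I" "j \<in> I"
      have "(h i j has_real_derivative f i j s * (v i s - v j s)) (at s within {0..})"
      proof (cases "i = j")
        case False
        then have h: "h i j = (\<lambda>s. H (gap x i j s))" by (simp add: h_def fun_eq_iff)
        show ?thesis unfolding h
          using DERIV_chain2[OF H[OF gap[OF ij False s]] gap_derivative[OF sol _ _ s]] ij False
          by (simp add: f_def I_def)
      next
        case True
        then have "h i j = (\<lambda>s. 0)" by (simp add: h_def fun_eq_iff)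
        then show ?thesis using True by (simp add: f_def)
      qed
      moreover have "((\<lambda>s. x i s - x j s) has_real_derivative (v i s - v j s)) (at s within {0..})"
        using ij s by (intro DERIV_diff cs_derivs[OF sol]) (auto simp: I_def)
      ultimately show "((\<lambda>s. h i j s - (w i - w j) * (x i s - x j s)) has_real_derivative
         (f i j s - (w i - w j)) * (v i s - v j s)) (at s within {0..})"
        unfolding left_diff_distrib[of "f i j s"] by (rule DERIV_diff[OF _ DERIV_cmult])
    qed
    also have "(\<Sum>i\<in>I. \<Sum>j\<in>I. (f i j s - (w i - w j)) * (v i s - v j s)) = - V s"
      unfolding I_def V_def power2_eq_square
      by (rule sum_gradient_identity[OF N f_anti[unfolded I_def] w[unfolded I_def]]; use s in \<open>simp add: I_def\<close>)
    finally show ?thesis .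
  qed
  have Q': "(Q has_real_derivative 2 * W s) (at s within {0..})" if s: "s \<ge> 0" for s
  proof -
    have "(Q has_real_derivative (\<Sum>i\<in>I. \<Sum>j\<in>I. 2 * ((v i s - v j s) * ((x i s - x j s) - (x i T - x j T))))) (at s within {0..})"
      unfolding Q_def
    proof (intro DERIV_sum)
      fix i j assume ij: "i \<in> I" "j \<in> I"
      have "((\<lambda>s. x i s - x j s) has_real_derivative (v i s - v j s)) (at s within {0..})"
        using ij s by (intro DERIV_diff cs_derivs[OF sol]) (auto simp: I_def)
      then show "((\<lambda>s. ((x i s - x j s) - (x i T - x j T))\<^sup>2) has_real_derivative
         2 * ((v i s - v j s) * ((x i s - x j s) - (x i T - x j T)))) (at s within {0..})"
        by (rule DERIV_power[where n = 2, OF DERIV_diff[OF _ DERIV_const], THEN DERIV_cong]) simp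
    qed
    then show ?thesis by (simp add: W_def sum_distrib_left)
  qed
  have convex: "\<Phi> s - \<Phi> T \<le> - W s" if s: "s \<ge> 0" for s
  proof -
    have "\<Phi> s - \<Phi> T \<le> (\<Sum>i\<in>I. \<Sum>j\<in>I. (f i j s - (w i - w j)) * ((x i s - x i T) - (x j s - x j T)))"
      unfolding \<Phi>_def sum_subtractf[symmetric]
    proof (intro sum_mono)
      fix i j assume ij: "i \<in> I" "j \<in> I"
      have "h i j s - h i j T \<le> f i j s * (gap x i j s - gap x i j T)"
      proof (cases "i = j")
        case False
        then show ?thesis
          using convex_below_tangent[of 0 "2 * pi" H F0, OF H F0_mono] gap[OF ij] s T
          by (simp add: h_def f_def)
      qed (simp add: h_def f_def)
      moreover have "gap x i j s - gap x i j T = (x i s - x i T) - (x j s - x j T)"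
        by (simp add: gap_def)
      ultimately show "h i j s - (w i - w j) * (x i s - x j s) - (h i j T - (w i - w j) * (x i T - x j T))
         \<le> (f i j s - (w i - w j)) * ((x i s - x i T) - (x j s - x j T))"
        by (simp add: algebra_simps)
    qed
    also have "\<dots> = - (\<Sum>i\<in>I. \<Sum>j\<in>I. (v i s - v j s) * ((x i s - x i T) - (x j s - x j T)))"
      unfolding I_def
      by (rule sum_gradient_identity[OF N f_anti[unfolded I_def] w[unfolded I_def]]; use s in \<open>simp add: I_def\<close>)
    also have "\<dots> = - W s" unfolding W_def by (intro arg_cong[of _ _ uminus] sum.cong refl) (simp add: algebra_simps)
    finally show ?thesis .
  qed
  \<comment> \<open>its terms vanish at the ends except for \<open>T\<^sup>2 * V T / 2\<close> at \<open>T\<close> and \<open>Q 0 / 2\<close> at \<open>0\<close>\<close>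
  define L where "L s = s\<^sup>2 * V s / 2 + s * (\<Phi> s - \<Phi> T) + Q s / 2" for s
  have "L T \<le> L 0"
  proof (rule nonincreasing_on_halfline[where f = L and f' = "\<lambda>s. s * V s
      + s\<^sup>2 * ((real N)\<^sup>2 * (- (2 * 1 * dissipation \<phi> N (\<lambda>i. x i s) (\<lambda>i. v i s)))) / 2
      + (\<Phi> s - \<Phi> T) + s * (- V s) + W s"])
    fix s assume s: "0 \<le> s" "s \<le> T"
    show "(L has_real_derivative s * V s
      + s\<^sup>2 * ((real N)\<^sup>2 * (- (2 * 1 * dissipation \<phi> N (\<lambda>i. x i s) (\<lambda>i. v i s)))) / 2
      + (\<Phi> s - \<Phi> T) + s * (- V s) + W s) (at s within {0..})"
      unfolding L_def
      by (rule derivative_eq_intros V'[OF s(1)] \<Phi>'[OF s(1)] Q'[OF s(1)] refl | simp add: field_simps)+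
  next
    fix s assume s: "0 < s" "s < T"
    have "0 \<le> s\<^sup>2 * ((real N)\<^sup>2 * (2 * 1 * dissipation \<phi> N (\<lambda>i. x i s) (\<lambda>i. v i s))) / 2"
      using diss[of s] s by simp
    then show "s * V s
      + s\<^sup>2 * ((real N)\<^sup>2 * (- (2 * 1 * dissipation \<phi> N (\<lambda>i. x i s) (\<lambda>i. v i s)))) / 2
      + (\<Phi> s - \<Phi> T) + s * (- V s) + W s \<le> 0"
      using convex[of s] s by simp
  qed (use T in auto)
  then have "T\<^sup>2 * V T \<le> Q 0" by (simp add: L_def Q_def)
  also have "Q 0 \<le> (\<Sum>i\<in>I. \<Sum>j\<in>I. (2 * pi)\<^sup>2)"
    unfolding Q_def
  proof (intro sum_mono)
    fix i j assume ij: "i \<in> I" "j \<in> I"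
    have "\<bar>(x i 0 - x j 0) - (x i T - x j T)\<bar> \<le> 2 * pi"
    proof (cases "i = j")
      case False
      have "(x i 0 - x j 0) - (x i T - x j T) = gap x i j 0 - gap x i j T" by (simp add: gap_def)
      then show ?thesis using gap[OF ij False, of 0] gap[OF ij False, of T] T by simp
    qed auto
    then show "((x i 0 - x j 0) - (x i T - x j T))\<^sup>2 \<le> (2 * pi)\<^sup>2" by (rule power2_le_iff_abs_le[THEN iffD2, rotated]) simp
  qed
  also have "\<dots> = (real N)\<^sup>2 * (4 * pi\<^sup>2)" by (simp add: I_def power2_eq_square)
  finally have "(real N)\<^sup>2 * (T\<^sup>2 * variation N (\<lambda>i. v i T)) \<le> (real N)\<^sup>2 * (4 * pi\<^sup>2)"
    by (simp add: V_eq mult_ac)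
  then have "T\<^sup>2 * variation N (\<lambda>i. v i T) \<le> 4 * pi\<^sup>2" using N by simp
  then show ?thesis using T by (simp add: field_simps)
qed

section \<open>The corrector\<close>

lemma periodic_antiderivative_shift:
  fixes A :: "real \<Rightarrow> real"
  assumes A: "\<And>z. (A has_real_derivative f z) (at z)" and per: "\<And>z. f (z + p) = f z"
  shows "A (z + p) - A z = A p - A 0"
proof -
  have "((\<lambda>z. A (z + p) - A z) has_real_derivative 0) (at u)" for u
    using DERIV_diff[OF DERIV_shift[THEN iffD1, OF A] A, of p u] per[of u] by simp
  then have "A (z + p) - A z = A (0 + p) - A 0"
    by (intro DERIV_isconst_all[of "\<lambda>z. A (z + p) - A z" z 0]) auto
  then show ?thesis by simp
qed

text \<open>The corrector is an odd function on the circle whose derivative \<open>g\<close> is at most \<open>-1\<close> wherever \<open>\<phi>\<close> vanishes.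
  At distance \<open>0\<close> the value \<open>\<phi> 0\<close> carries no meaning, so the kernel is replaced by \<open>0\<close> there.\<close>

definition is_corrector ::
    "(real \<Rightarrow> real) \<Rightarrow> (real \<Rightarrow> real) \<Rightarrow> (real \<Rightarrow> real) \<Rightarrow> real \<Rightarrow> real \<Rightarrow> bool" where
  "is_corrector \<phi> \<psi> g K \<Lambda> \<longleftrightarrow>
     (\<forall>z. (\<psi> has_real_derivative g z) (at z)) \<and> continuous_on UNIV g \<and>
     (\<forall>z. \<psi> (- z) = - \<psi> z) \<and> (\<forall>z. \<psi> (z + 2 * pi) = \<psi> z) \<and>
     (\<forall>z. \<bar>g z\<bar> \<le> \<Lambda>) \<and> K \<ge> 0 \<and>
     (\<forall>z. g z \<le> - 1 + K * (if cos z = 1 then 0 else \<phi> (arccos (cos z))))"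

lemma is_correctorD:
  assumes "is_corrector \<phi> \<psi> g K \<Lambda>"
  shows "(\<psi> has_real_derivative g z) (at z)" "continuous_on UNIV g"
    "\<psi> (- z) = - \<psi> z" "\<psi> (z + 2 * pi) = \<psi> z" "\<bar>g z\<bar> \<le> \<Lambda>" "K \<ge> 0"
    "g z \<le> - 1 + K * (if cos z = 1 then 0 else \<phi> (arccos (cos z)))"
    "continuous_on UNIV \<psi>" "\<bar>\<psi> z\<bar> \<le> \<Lambda> * pi" "\<Lambda> \<ge> 1"
proof -
  show \<psi>: "(\<psi> has_real_derivative g z) (at z)" "continuous_on UNIV g"
    "\<psi> (- z) = - \<psi> z" "\<psi> (z + 2 * pi) = \<psi> z" "\<bar>g z\<bar> \<le> \<Lambda>" "K \<ge> 0"
    "g z \<le> - 1 + K * (if cos z = 1 then 0 else \<phi> (arccos (cos z)))" for z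
    using assms unfolding is_corrector_def by blast+
  show "continuous_on UNIV \<psi>"
    using \<psi>(1) by (auto simp: continuous_on_eq_continuous_at intro: DERIV_isCont)
  show \<Lambda>: "\<Lambda> \<ge> 1" using \<psi>(5)[of 0] \<psi>(7)[of 0] by simp
  have "\<bar>\<psi> (z - 0) - \<psi> (0 - 0)\<bar> \<le> \<Lambda> * torus_dist z 0"
    by (rule lipschitz_torus_dist[OF \<psi>(4,1,5)])
  also have "\<dots> \<le> \<Lambda> * pi" using torus_dist_bounds[of z 0] \<Lambda> by (intro mult_left_mono) auto
  finally show "\<bar>\<psi> z\<bar> \<le> \<Lambda> * pi" using \<psi>(3)[of 0] by simp
qed

text \<open>The derivative \<open>g\<close> is \<open>-1\<close> plus a multiple of a bump \<open>\<eta>\<close>, which is a function of \<open>cos z\<close> supported where \<open>\<phi>\<close> is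
  bounded below; the multiple is determined by the condition that \<open>g\<close> has mean zero.\<close>

lemma corrector_exists:
  assumes cont: "continuous_on {0<..} \<phi>" and nonneg: "\<And>r. r > 0 \<Longrightarrow> \<phi> r \<ge> 0"
    and nontrivial: "nontrivial_kernel \<phi>"
  obtains \<psi> g K \<Lambda> where "is_corrector \<phi> \<psi> g K \<Lambda>"
proof -
  obtain r where r: "0 < r" "r \<le> pi" "\<phi> r > 0"
    using nontrivial nonneg unfolding nontrivial_kernel_def
    by (metis greaterThanAtMost_iff order_le_less)
  define c where "c = cos r"
  have c: "- 1 \<le> c" "c < 1"
    using cos_monotone_0_pi[of 0 r] r by (auto simp: c_def)
  have arc: "arccos c = r" using r by (simp add: c_def arccos_cos)
  define m where "m = \<phi> r / 2"
  have m: "m > 0" using r by (simp add: m_def)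
  have arccos_pos: "arccos y > 0" if "- 1 \<le> y" "y < 1" for y :: real
    using arccos_less_arccos[of y 1] that by simp
  have "continuous_on {-1..<1} (\<lambda>y. \<phi> (arccos y))"
  proof (rule continuous_on_compose2[OF cont])
    show "continuous_on {-1..<1} arccos"
      by (rule continuous_on_subset[OF continuous_on_arccos']) auto
  qed (use arccos_pos in auto)
  moreover have "c \<in> {-1..<1}" using c by auto
  ultimately obtain \<delta>0 where \<delta>0: "\<delta>0 > 0"
    "\<And>y. y \<in> {-1..<1} \<Longrightarrow> dist y c < \<delta>0 \<Longrightarrow> dist (\<phi> (arccos y)) (\<phi> (arccos c)) < m"
    using m unfolding continuous_on_iff by blast
  \<comment> \<open>keeps the support of the bump away from \<open>cos z = 1\<close>, that is from distance \<open>0\<close>\<close>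
  define \<delta> where "\<delta> = min \<delta>0 (1 - c)"
  have \<delta>: "\<delta> > 0" using \<delta>0 c by (simp add: \<delta>_def)
  define \<eta> where "\<eta> z = max 0 (\<delta> - \<bar>cos z - c\<bar>)" for z :: real
  have \<eta>_nonneg: "\<eta> z \<ge> 0" and \<eta>_le: "\<eta> z \<le> \<delta>" for z using \<delta> by (auto simp: \<eta>_def)
  have \<eta>_cont: "continuous_on S \<eta>" for S unfolding \<eta>_def by (intro continuous_intros)
  have \<eta>_even: "\<eta> (- z) = \<eta> z" and \<eta>_per: "\<eta> (z + 2 * pi) = \<eta> z" for z
    by (simp_all add: \<eta>_def)
  have \<eta>_phi: "\<eta> z \<le> \<delta> / m * (if cos z = 1 then 0 else \<phi> (arccos (cos z)))" for z
  proof (cases "\<bar>cos z - c\<bar> < \<delta>")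
    case True
    then have "cos z < 1" "dist (cos z) c < \<delta>0" by (auto simp: \<delta>_def dist_real_def)
    then have "\<bar>\<phi> (arccos (cos z)) - \<phi> r\<bar> < m"
      using \<delta>0(2)[of "cos z"] by (auto simp: dist_real_def arc)
    then have "\<phi> (arccos (cos z)) \<ge> m" unfolding m_def by linarith
    then have "\<delta> / m * \<phi> (arccos (cos z)) \<ge> \<delta> / m * m" using m \<delta> by (intro mult_left_mono) auto
    then show ?thesis using \<eta>_le[of z] \<open>cos z < 1\<close> m by simp
  next
    case False
    have "\<phi> (arccos (cos z)) \<ge> 0" if "cos z \<noteq> 1"
      using that arccos_pos[of "cos z"] nonneg by (simp add: order_less_le)
    then show ?thesis using False m \<delta> by (auto simp: \<eta>_def)
  qed
  have "isCont \<eta> z" for z using \<eta>_cont[of UNIV] by (simp add: continuous_on_eq_continuous_at)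
  then obtain A where A: "\<And>z. (A has_real_derivative \<eta> z) (at z)"
    using einterval_antiderivative[of "-\<infinity>" \<infinity> \<eta>]
    by (auto simp: has_real_derivative_iff_has_vector_derivative)
  have A_mono: "A y \<le> A z" if "y \<le> z" for y z
    by (rule DERIV_nonneg_imp_nondecreasing[OF that]) (use A \<eta>_nonneg in blast)
  have "\<eta> r > 0" using \<delta> by (simp add: \<eta>_def c_def)
  from DERIV_pos_inc_right[OF A this] obtain d where d: "d > 0" "\<And>h. 0 < h \<Longrightarrow> h < d \<Longrightarrow> A r < A (r + h)"
    by auto
  have pos: "A 0 < A (2 * pi)"
  proof -
    define h where "h = min (d / 2) pi"
    have h: "0 < h" "h < d" "h \<le> pi" using d by (auto simp: h_def)
    have "A 0 \<le> A r" using r by (intro A_mono) auto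
    also have "A r < A (r + h)" using d(2) h by blast
    also have "A (r + h) \<le> A (2 * pi)" using h r by (intro A_mono) auto
    finally show ?thesis .
  qed
  define k where "k = 2 * pi / (A (2 * pi) - A 0)"
  have k: "k > 0" using pos by (simp add: k_def)
  define \<psi>0 where "\<psi>0 z = - z + k * A z" for z
  \<comment> \<open>the odd part, which has the same derivative since \<open>g\<close> is even\<close>
  define \<psi> where "\<psi> z = (\<psi>0 z - \<psi>0 (- z)) / 2" for z
  define g where "g z = - 1 + k * \<eta> z" for z
  define \<Lambda> where "\<Lambda> = 1 + k * \<delta>"
  have \<psi>0_per: "\<psi>0 (z + 2 * pi) = \<psi>0 z" for z
  proof -
    have "k * (A (z + 2 * pi) - A z) = 2 * pi"
      unfolding periodic_antiderivative_shift[of A \<eta> "2 * pi", OF A \<eta>_per] k_def using pos by simp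
    then show ?thesis by (simp add: \<psi>0_def algebra_simps)
  qed
  have "(\<psi>0 has_real_derivative g z) (at z)" for z
    unfolding \<psi>0_def g_def by (auto intro!: derivative_eq_intros A)
  note \<psi>0' = this
  have \<psi>': "(\<psi> has_real_derivative g z) (at z)" for z
  proof -
    have "((\<lambda>z. \<psi>0 (- z)) has_real_derivative g (- z) * (- 1)) (at z)"
      by (rule DERIV_chain2[OF \<psi>0']) (auto intro!: derivative_eq_intros)
    moreover have "g (- z) = g z" by (simp add: g_def \<eta>_even)
    ultimately show ?thesis unfolding \<psi>_def by (auto intro!: derivative_eq_intros \<psi>0')
  qed
  have \<psi>_per: "\<psi> (z + 2 * pi) = \<psi> z" for z
    using \<psi>0_per[of z] \<psi>0_per[of "- z - 2 * pi"] by (simp add: \<psi>_def)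
  have g_bd: "\<bar>g z\<bar> \<le> \<Lambda>" for z
  proof -
    have "0 \<le> k * \<eta> z" "k * \<eta> z \<le> k * \<delta>" using k \<eta>_nonneg[of z] \<eta>_le[of z] by (auto intro: mult_left_mono)
    then show ?thesis by (auto simp: g_def \<Lambda>_def)
  qed
  have "is_corrector \<phi> \<psi> g (k * (\<delta> / m)) \<Lambda>"
    unfolding is_corrector_def
  proof (intro conjI allI)
    show "continuous_on UNIV g" unfolding g_def using \<eta>_cont by (intro continuous_intros)
    show "\<psi> (- z) = - \<psi> z" for z by (simp add: \<psi>_def field_simps)
    show "k * (\<delta> / m) \<ge> 0" using k \<delta> m by simp
    show "g z \<le> - 1 + k * (\<delta> / m) * (if cos z = 1 then 0 else \<phi> (arccos (cos z)))" for z
      using mult_left_mono[OF \<eta>_phi[of z], of k] k by (simp add: g_def mult.assoc)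
  qed (use \<psi>' \<psi>_per g_bd in auto)
  then show ?thesis by (rule that)
qed

section \<open>Smooth kernels\<close>

text \<open>The mean over ordered pairs of agents, including equal ones.\<close>

definition pair_mean :: "nat \<Rightarrow> (nat \<Rightarrow> nat \<Rightarrow> real) \<Rightarrow> real" where
  "pair_mean N f = 1 / (real N)\<^sup>2 * (\<Sum>i=1..N. \<Sum>j=1..N. f i j)"

lemma pair_mean_mono:
  assumes "\<And>i j. i \<in> {1..N} \<Longrightarrow> j \<in> {1..N} \<Longrightarrow> f i j \<le> g i j"
  shows "pair_mean N f \<le> pair_mean N g"
  unfolding pair_mean_def by (intro mult_left_mono sum_mono) (use assms in auto)

lemma pair_mean_add: "pair_mean N (\<lambda>i j. f i j + g i j) = pair_mean N f + pair_mean N g"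
  by (simp add: pair_mean_def sum.distrib distrib_left)

lemma pair_mean_cmult: "pair_mean N (\<lambda>i j. c * f i j) = c * pair_mean N f"
  by (simp add: pair_mean_def sum_distrib_left[symmetric] mult.left_commute)

lemma pair_mean_const: "N \<ge> 1 \<Longrightarrow> pair_mean N (\<lambda>i j. c) = c"
  by (simp add: pair_mean_def power2_eq_square)

lemma abs_pair_mean_le: "\<bar>pair_mean N f\<bar> \<le> pair_mean N (\<lambda>i j. \<bar>f i j\<bar>)"
  unfolding pair_mean_def abs_mult
  by (intro mult_mono) (auto intro!: order_trans[OF sum_abs] sum_mono)

lemma variation_eq_pair_mean: "variation N v = pair_mean N (\<lambda>i j. (v i - v j)\<^sup>2)"
  by (simp add: variation_def pair_mean_def)

lemma dissipation_eq_pair_mean: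
  "dissipation \<phi> N x v = pair_mean N (\<lambda>i j. \<phi> (torus_dist (x i) (x j)) * (v i - v j)\<^sup>2)"
  by (simp add: dissipation_def pair_mean_def)

lemma smooth_kernel_bounds:
  assumes smooth: "smooth_kernel \<phi>" and nonneg: "\<And>r. r > 0 \<Longrightarrow> \<phi> r \<ge> 0"
  obtains B where "B \<ge> 0" "\<And>x y. 0 \<le> \<phi> (torus_dist x y)" "\<And>x y. \<phi> (torus_dist x y) \<le> B"
proof -
  have cont: "continuous_on {0..} \<phi>" by (rule smooth_kernel_continuous[OF smooth])
  have "\<phi> 0 \<ge> 0"
  proof (rule tendsto_lowerbound)
    have "(\<phi> \<longlongrightarrow> \<phi> 0) (at 0 within {0..})" using cont by (auto simp: continuous_on_def)
    then show "(\<phi> \<longlongrightarrow> \<phi> 0) (at_right 0)" by (rule tendsto_within_subset) auto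
    show "\<forall>\<^sub>F r in at_right 0. 0 \<le> \<phi> r"
      using eventually_at_right_less[of 0] by eventually_elim (use nonneg in auto)
  qed simp
  then have nn: "\<phi> r \<ge> 0" if "r \<ge> 0" for r using nonneg[of r] that by (cases "r = 0") auto
  have "continuous_on {0..pi} \<phi>" by (rule continuous_on_subset[OF cont]) auto
  then have "bounded (\<phi> ` {0..pi})" by (intro compact_imp_bounded compact_continuous_image) auto
  then obtain B where "\<forall>y\<in>\<phi> ` {0..pi}. norm y \<le> B" unfolding bounded_iff by blast
  then have B: "\<And>r. r \<in> {0..pi} \<Longrightarrow> \<bar>\<phi> r\<bar> \<le> B" by simp
  show ?thesis
  proof (rule that[of B])
    show "B \<ge> 0" using B[of 0] by auto
    show "0 \<le> \<phi> (torus_dist x y)" for x y by (rule nn[OF torus_dist_bounds(1)])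
    show "\<phi> (torus_dist x y) \<le> B" for x y using B[of "torus_dist x y"] torus_dist_bounds[of x y] by auto
  qed
qed

lemma young: "\<tau> > 0 \<Longrightarrow> a * b \<le> \<tau> * a\<^sup>2 + b\<^sup>2 / (4 * \<tau>)" for a b \<tau> :: real
proof -
  assume t: "\<tau> > 0"
  have "0 \<le> (2 * \<tau> * a - b)\<^sup>2 / (4 * \<tau>)" using t by simp
  also have "\<dots> = \<tau> * a\<^sup>2 + b\<^sup>2 / (4 * \<tau>) - a * b" using t by (simp add: power2_eq_square field_simps)
  finally show ?thesis by simp
qed

text \<open>The bound \<open>m\<close> of the oscillation of \<open>\<psi>\<close> is \<open>\<Lambda> * torus_dist a b\<close> or a constant in the applications.\<close>

lemma corrector_derivative_le:
  assumes sol: "cs_solution \<phi> N x v" and t: "t \<ge> 0" and N: "N \<ge> 1"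
    and cor: "is_corrector \<phi> \<psi> g K \<Lambda>" and \<phi>: "\<And>a b. 0 \<le> \<phi> (torus_dist a b)"
    and m: "\<And>a b c. \<bar>\<psi> (a - c) - \<psi> (b - c)\<bar> \<le> m a b"
  obtains D where
    "((\<lambda>t. pair_mean N (\<lambda>i j. \<psi> (x i t - x j t) * (v i t - v j t))) has_real_derivative D) (at t within {0..})"
    "D \<le> - variation N (\<lambda>i. v i t) + K * dissipation \<phi> N (\<lambda>i. x i t) (\<lambda>i. v i t)
      + pair_mean N (\<lambda>i j. \<phi> (torus_dist (x i t) (x j t)) * \<bar>v i t - v j t\<bar> * m (x i t) (x j t))"
proof -
  note \<psi> = is_correctorD(1,3)[OF cor] and K = is_correctorD(6)[OF cor] and g = is_correctorD(7)[OF cor]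
  define R where "R i j = (\<Sum>l=1..N. \<psi> (x i t - x l t) * 1) - (\<Sum>l=1..N. \<psi> (x j t - x l t) * 1)" for i j
  define D where "D = pair_mean N (\<lambda>i j. g (x i t - x j t) * (v i t - v j t) * (v i t - v j t))
    + pair_mean N (\<lambda>i j. 1 / real N * (\<phi> (torus_dist (x i t) (x j t)) * (v j t - v i t) * R i j))"
  have "((\<lambda>t. \<Sum>i=1..N. \<Sum>j=1..N. \<psi> (x i t - x j t) * (v i t - v j t)) has_real_derivative
     (\<Sum>i=1..N. \<Sum>j=1..N. g (x i t - x j t) * (v i t - v j t) * (v i t - v j t))
     + 1 / real N * (\<Sum>i=1..N. \<Sum>j=1..N. \<phi> (torus_dist (x i t) (x j t)) * (v j t - v i t) * R i j))
     (at t within {0..})"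
    unfolding R_def
    by (rule pair_functional_derivative[OF sol t, where \<alpha> = \<psi> and b = "\<lambda>w. w" and b' = "\<lambda>_. 1"])
      (use \<psi> in auto)
  then have "((\<lambda>t. pair_mean N (\<lambda>i j. \<psi> (x i t - x j t) * (v i t - v j t))) has_real_derivative D) (at t within {0..})"
    unfolding D_def pair_mean_cmult unfolding pair_mean_def
    by (rule DERIV_cong[OF DERIV_cmult]) (simp add: distrib_left)
  moreover have "D \<le> (- variation N (\<lambda>i. v i t) + K * dissipation \<phi> N (\<lambda>i. x i t) (\<lambda>i. v i t))
      + pair_mean N (\<lambda>i j. \<phi> (torus_dist (x i t) (x j t)) * \<bar>v i t - v j t\<bar> * m (x i t) (x j t))"
    unfolding D_def
  proof (rule add_mono)
    have "pair_mean N (\<lambda>i j. g (x i t - x j t) * (v i t - v j t) * (v i t - v j t))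
      \<le> pair_mean N (\<lambda>i j. (- 1) * (v i t - v j t)\<^sup>2 + K * (\<phi> (torus_dist (x i t) (x j t)) * (v i t - v j t)\<^sup>2))"
    proof (rule pair_mean_mono)
      fix i j
      have "(if cos (x i t - x j t) = 1 then 0 else \<phi> (arccos (cos (x i t - x j t)))) \<le> \<phi> (torus_dist (x i t) (x j t))"
        using \<phi>[of "x i t" "x j t"]
        by (cases "cos (x i t - x j t) = 1") (simp_all add: torus_dist_eq)
      from mult_left_mono[OF this K] g[of "x i t - x j t"]
      have "g (x i t - x j t) \<le> - 1 + K * \<phi> (torus_dist (x i t) (x j t))" by linarith
      from mult_right_mono[OF this zero_le_power2[of "v i t - v j t"]]
      show "g (x i t - x j t) * (v i t - v j t) * (v i t - v j t)
        \<le> (- 1) * (v i t - v j t)\<^sup>2 + K * (\<phi> (torus_dist (x i t) (x j t)) * (v i t - v j t)\<^sup>2)"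
        by (simp only: power2_eq_square distrib_right mult.assoc)
    qed
    then show "pair_mean N (\<lambda>i j. g (x i t - x j t) * (v i t - v j t) * (v i t - v j t))
      \<le> - variation N (\<lambda>i. v i t) + K * dissipation \<phi> N (\<lambda>i. x i t) (\<lambda>i. v i t)"
      unfolding pair_mean_add pair_mean_cmult by (simp add: variation_eq_pair_mean dissipation_eq_pair_mean)
    show "pair_mean N (\<lambda>i j. 1 / real N * (\<phi> (torus_dist (x i t) (x j t)) * (v j t - v i t) * R i j))
      \<le> pair_mean N (\<lambda>i j. \<phi> (torus_dist (x i t) (x j t)) * \<bar>v i t - v j t\<bar> * m (x i t) (x j t))"
    proof (rule pair_mean_mono)
      fix i j
      have "R i j = (\<Sum>l=1..N. \<psi> (x i t - x l t) - \<psi> (x j t - x l t))"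
        by (simp add: R_def sum_subtractf)
      also have "\<bar>\<dots>\<bar> \<le> (\<Sum>l=1..N. m (x i t) (x j t))"
        by (intro order_trans[OF sum_abs] sum_mono m)
      finally have R: "\<bar>R i j\<bar> \<le> real N * m (x i t) (x j t)" by simp
      have "1 / real N * (\<phi> (torus_dist (x i t) (x j t)) * (v j t - v i t) * R i j)
        \<le> 1 / real N * (\<phi> (torus_dist (x i t) (x j t)) * \<bar>v i t - v j t\<bar> * \<bar>R i j\<bar>)"
      proof (intro mult_left_mono)
        have "(v j t - v i t) * R i j \<le> \<bar>v i t - v j t\<bar> * \<bar>R i j\<bar>"
          by (metis abs_ge_self abs_minus_commute abs_mult)
        from mult_left_mono[OF this \<phi>] show "\<phi> (torus_dist (x i t) (x j t)) * (v j t - v i t) * R i j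
          \<le> \<phi> (torus_dist (x i t) (x j t)) * \<bar>v i t - v j t\<bar> * \<bar>R i j\<bar>" by (simp add: mult.assoc)
      qed auto
      also have "\<dots> \<le> 1 / real N * (\<phi> (torus_dist (x i t) (x j t)) * \<bar>v i t - v j t\<bar> * (real N * m (x i t) (x j t)))"
        by (intro mult_left_mono R mult_nonneg_nonneg \<phi>) auto
      also have "\<dots> = \<phi> (torus_dist (x i t) (x j t)) * \<bar>v i t - v j t\<bar> * m (x i t) (x j t)"
        using N by simp
      finally show "1 / real N * (\<phi> (torus_dist (x i t) (x j t)) * (v j t - v i t) * R i j)
        \<le> \<phi> (torus_dist (x i t) (x j t)) * \<bar>v i t - v j t\<bar> * m (x i t) (x j t)" .
    qed
  qed
  ultimately show ?thesis by (intro that) auto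
qed

lemma abs_corrector_le:
  assumes N: "N \<ge> 1" and \<psi>: "\<And>z. \<bar>\<psi> z\<bar> \<le> P"
  shows "\<bar>pair_mean N (\<lambda>i j. \<psi> (x i - x j) * (v i - v j))\<bar> \<le> P * (1 + variation N v)"
proof -
  have "\<bar>pair_mean N (\<lambda>i j. \<psi> (x i - x j) * (v i - v j))\<bar>
    \<le> pair_mean N (\<lambda>i j. \<bar>\<psi> (x i - x j) * (v i - v j)\<bar>)" by (rule abs_pair_mean_le)
  also have "\<dots> \<le> pair_mean N (\<lambda>i j. P * (1 + (v i - v j)\<^sup>2))"
  proof (rule pair_mean_mono)
    fix i j
    have "\<bar>v i - v j\<bar> \<le> 1 + (v i - v j)\<^sup>2"
      using young[of 1 "\<bar>v i - v j\<bar>" 1] by simp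
    then show "\<bar>\<psi> (x i - x j) * (v i - v j)\<bar> \<le> P * (1 + (v i - v j)\<^sup>2)"
      unfolding abs_mult using \<psi>[of "x i - x j"] by (intro mult_mono) auto
  qed
  also have "\<dots> = P * (1 + variation N v)"
    unfolding pair_mean_cmult pair_mean_add variation_eq_pair_mean using pair_mean_const[OF N, of 1] by simp
  finally show ?thesis .
qed

lemma smooth_log_decay:
  assumes smooth: "smooth_kernel \<phi>" and nonneg: "\<And>r. r > 0 \<Longrightarrow> \<phi> r \<ge> 0"
    and nontrivial: "nontrivial_kernel \<phi>"
  shows "\<exists>C. \<forall>t\<ge>exp 1. \<forall>N\<ge>1. \<forall>x v. cs_solution \<phi> N x v \<and> velocity_spread_le N (\<lambda>i. v i 0) A \<longrightarrow>
    variation N (\<lambda>i. v i t) \<le> C * (ln t / t)"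
proof -
  obtain B where B: "B \<ge> 0" "\<And>x y. 0 \<le> \<phi> (torus_dist x y)" "\<And>x y. \<phi> (torus_dist x y) \<le> B"
    using smooth_kernel_bounds[OF smooth nonneg] by blast
  obtain \<psi> g K \<Lambda> where cor: "is_corrector \<phi> \<psi> g K \<Lambda>"
    using corrector_exists[OF kernel_continuous nonneg nontrivial] smooth by metis
  note \<psi> = is_correctorD(1,3,4,5,9,6)[OF cor]
  define D where "D = B * (\<Lambda> * pi)\<^sup>2 / 4"
  have "variation N (\<lambda>i. v i t) \<le> (A\<^sup>2 + K / (2 * 1) * A\<^sup>2 + 2 * (\<Lambda> * pi * (1 + A\<^sup>2)) + D) * (ln t / t)"
    if t: "t \<ge> exp 1" and N: "N \<ge> 1" and sol: "cs_solution \<phi> N x v"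
      and A: "velocity_spread_le N (\<lambda>i. v i 0) A" for t N x v
  proof -
    define G where "G t = pair_mean N (\<lambda>i j. \<psi> (x i t - x j t) * (v i t - v j t))" for t
    define V where "V t = variation N (\<lambda>i. v i t)" for t
    define J where "J t = dissipation \<phi> N (\<lambda>i. x i t) (\<lambda>i. v i t)" for t
    have V_le: "V t \<le> A\<^sup>2" if "t \<ge> 0" for t
      using variation_nonincreasing[OF sol N B(2), of 0 t] variation_initial_le[OF A N] that by (simp add: V_def)
    have "\<exists>D'. (G has_real_derivative D') (at t within {0..}) \<and>
        (t > 0 \<longrightarrow> D' \<le> - V t + K * J t + 1 * t * J t + D / t)" if t0: "t \<ge> 0" for t
    proof -
      obtain D' where D': "(G has_real_derivative D') (at t within {0..})"
        "D' \<le> - V t + K * J t + pair_mean N (\<lambda>i j. \<phi> (torus_dist (x i t) (x j t)) * \<bar>v i t - v j t\<bar> * (\<Lambda> * torus_dist (x i t) (x j t)))"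
        unfolding V_def J_def G_def
        using corrector_derivative_le[OF sol t0 N cor B(2), where m = "\<lambda>a b. \<Lambda> * torus_dist a b",
            OF lipschitz_torus_dist[OF \<psi>(3,1,4)]]
        by blast
      have "pair_mean N (\<lambda>i j. \<phi> (torus_dist (x i t) (x j t)) * \<bar>v i t - v j t\<bar> * (\<Lambda> * torus_dist (x i t) (x j t)))
        \<le> t * J t + D / t" if "t > 0"
      proof -
        have "pair_mean N (\<lambda>i j. \<phi> (torus_dist (x i t) (x j t)) * \<bar>v i t - v j t\<bar> * (\<Lambda> * torus_dist (x i t) (x j t)))
          \<le> pair_mean N (\<lambda>i j. t * (\<phi> (torus_dist (x i t) (x j t)) * (v i t - v j t)\<^sup>2) + D / t)"
        proof (rule pair_mean_mono)
          fix i j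
          let ?p = "\<phi> (torus_dist (x i t) (x j t))" and ?w = "\<bar>v i t - v j t\<bar>" and ?d = "torus_dist (x i t) (x j t)"
          have \<Lambda>: "\<Lambda> \<ge> 0" using \<psi>(4)[of 0] by linarith
          have "?p * (?w * (\<Lambda> * ?d)) \<le> ?p * (t * ?w\<^sup>2 + (\<Lambda> * ?d)\<^sup>2 / (4 * t))"
            by (intro mult_left_mono young that B)
          also have "\<dots> = t * (?p * ?w\<^sup>2) + ?p * ((\<Lambda> * ?d)\<^sup>2 / (4 * t))" by (simp add: algebra_simps)
          also have "?p * ((\<Lambda> * ?d)\<^sup>2 / (4 * t)) \<le> B * ((\<Lambda> * pi)\<^sup>2 / (4 * t))"
            using B \<Lambda> that torus_dist_bounds[of "x i t" "x j t"]
            by (intro mult_mono divide_right_mono power_mono) auto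
          finally show "?p * ?w * (\<Lambda> * ?d) \<le> t * (?p * (v i t - v j t)\<^sup>2) + D / t"
            by (simp add: D_def mult.assoc)
        qed
        also have "\<dots> = t * J t + D / t"
          unfolding pair_mean_add pair_mean_cmult pair_mean_const[OF N] J_def dissipation_eq_pair_mean ..
        finally show ?thesis .
      qed
      with D' show ?thesis by auto
    qed
    then obtain G' where G': "\<And>t. t \<ge> 0 \<Longrightarrow> (G has_real_derivative G' t) (at t within {0..})"
       "\<And>t. t > 0 \<Longrightarrow> G' t \<le> - V t + K * J t + 1 * t * J t + D / t"
      by (metis order_less_imp_le)
    have "V t \<le> (A\<^sup>2 + K / (2 * 1) * A\<^sup>2 + 2 * (\<Lambda> * pi * (1 + A\<^sup>2)) + D) * (ln t / t)"
    proof (rule logarithmic_decay[where V = V and G = G and J = J and G' = G'])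
      show "(V has_real_derivative - (2 * 1 * J t)) (at t within {0..})" if "t \<ge> 0" for t
        unfolding V_def J_def by (rule variation_derivative[OF sol that N])
      show "J t \<ge> 0" for t unfolding J_def by (intro dissipation_nonneg B)
      show "V t \<ge> 0" for t unfolding V_def by (rule variation_nonneg)
      show "\<bar>G t\<bar> \<le> \<Lambda> * pi * (1 + A\<^sup>2)" if "t \<ge> 0" for t
      proof -
        have "\<bar>G t\<bar> \<le> \<Lambda> * pi * (1 + V t)" unfolding G_def V_def by (rule abs_corrector_le[OF N \<psi>(5)])
        also have "\<dots> \<le> \<Lambda> * pi * (1 + A\<^sup>2)" using V_le[OF that] \<psi>(4)[of 0] by (intro mult_left_mono) auto
        finally show ?thesis .
      qed
    qed (use V_le \<psi>(6) t G' in auto)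
    then show ?thesis by (simp add: V_def)
  qed
  then show ?thesis by blast
qed

text \<open>A smooth convex approximation of the absolute value.\<close>

lemma smooth_abs:
  fixes \<epsilon> :: real assumes \<epsilon>: "\<epsilon> > 0"
  defines "h \<equiv> \<lambda>w. sqrt (w\<^sup>2 + \<epsilon>\<^sup>2)" and "h' \<equiv> \<lambda>w. w / sqrt (w\<^sup>2 + \<epsilon>\<^sup>2)"
  shows "(h has_real_derivative h' w) (at w)" and "h' (- w) = - h' w"
    and "u \<le> w \<Longrightarrow> h' u \<le> h' w" and "w * h' w \<ge> \<bar>w\<bar> - \<epsilon>" and "h w \<le> \<bar>w\<bar> + \<epsilon>" and "h w \<ge> 0"
proof -
  have pos: "w\<^sup>2 + \<epsilon>\<^sup>2 > 0" for w using \<epsilon> by (simp add: add_nonneg_pos)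
  show "(h has_real_derivative h' w) (at w)" for w
    unfolding h_def h'_def using pos[of w]
    by (auto intro!: derivative_eq_intros simp: field_simps)
  show "h' (- w) = - h' w" by (simp add: h'_def)
  show le: "h w \<le> \<bar>w\<bar> + \<epsilon>" for w
    unfolding h_def using \<epsilon> by (intro real_le_lsqrt) (auto simp: power2_eq_square algebra_simps)
  show "h w \<ge> 0" by (simp add: h_def)
  have hw: "h w > 0" "h w * h w = w\<^sup>2 + \<epsilon>\<^sup>2" "\<epsilon> \<le> h w" for w
    using pos[of w] \<epsilon> by (auto simp: h_def intro!: real_le_rsqrt)
  show "w * h' w \<ge> \<bar>w\<bar> - \<epsilon>"
  proof -
    have "w * h' w = (h w * h w - \<epsilon>\<^sup>2) / h w" unfolding hw(2) by (simp add: h'_def h_def power2_eq_square)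
    also have "\<dots> = h w - \<epsilon> * (\<epsilon> / h w)" using hw(1)[of w] by (simp add: diff_divide_distrib power2_eq_square)
    also have "\<dots> \<ge> h w - \<epsilon> * 1" using hw(1)[of w] hw(3)[of w] \<epsilon> by (intro diff_left_mono mult_left_mono) auto
    moreover have "\<bar>w\<bar> \<le> h w" unfolding h_def by (rule real_le_rsqrt) simp
    ultimately show ?thesis by linarith
  qed
  show "h' u \<le> h' w" if "u \<le> w"
  proof (rule DERIV_nonneg_imp_nondecreasing[OF that])
    fix y
    have "(h' has_real_derivative (\<epsilon>\<^sup>2 / (h y * h y * h y))) (at y)"
    proof -
      have "(h' has_real_derivative ((1 * h y - y * (inverse (h y) / 2 * (2 * y))) / (h y * h y))) (at y)"
        unfolding h'_def h_def using pos[of y] by (auto intro!: derivative_eq_intros simp del: real_sqrt_mult_self)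
      also have "((1 * h y - y * (inverse (h y) / 2 * (2 * y))) / (h y * h y)) = (h y * h y - y\<^sup>2) / (h y * h y * h y)"
        using hw(1)[of y] by (simp add: field_simps power2_eq_square)
      also have "h y * h y - y\<^sup>2 = \<epsilon>\<^sup>2" by (simp add: hw(2))
      finally show ?thesis .
    qed
    then show "\<exists>z. (h' has_real_derivative z) (at y) \<and> 0 \<le> z"
      using hw(1)[of y] by (intro exI conjI) auto
  qed
qed

text \<open>All contributions of third agents \<open>l\<close> have a favourable sign by convexity; only \<open>l = i\<close> is kept, which
  costs the factor \<open>N\<close>.\<close>

lemma regularized_l1_dissipation:
  assumes sol: "cs_solution \<phi> N x v" and t: "t \<ge> 0" and N: "N \<ge> 1" and \<epsilon>: "\<epsilon> > 0"
    and \<phi>: "\<And>a b. 0 \<le> \<phi> (torus_dist a b)" "\<And>a b. \<phi> (torus_dist a b) \<le> B"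
  obtains D where
    "((\<lambda>t. real N * pair_mean N (\<lambda>i j. sqrt ((v i t - v j t)\<^sup>2 + \<epsilon>\<^sup>2))) has_real_derivative D) (at t within {0..})"
    "D \<le> B * \<epsilon> - pair_mean N (\<lambda>i j. \<phi> (torus_dist (x i t) (x j t)) * \<bar>v i t - v j t\<bar>)"
proof -
  define h where "h = (\<lambda>w. sqrt (w\<^sup>2 + \<epsilon>\<^sup>2))"
  define h' where "h' = (\<lambda>w. w / sqrt (w\<^sup>2 + \<epsilon>\<^sup>2))"
  have h: "(h has_real_derivative h' w) (at w)" "h' (- w) = - h' w"
    "u \<le> w \<Longrightarrow> h' u \<le> h' w" "w * h' w \<ge> \<bar>w\<bar> - \<epsilon>" for u w
    using smooth_abs[OF \<epsilon>] by (auto simp: h_def h'_def)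
  define R where "R i j = (\<Sum>l=1..N. 1 * h' (v i t - v l t)) - (\<Sum>l=1..N. 1 * h' (v j t - v l t))" for i j
  define D where "D = pair_mean N (\<lambda>i j. \<phi> (torus_dist (x i t) (x j t)) * (v j t - v i t) * R i j)"
  have "((\<lambda>t. \<Sum>i=1..N. \<Sum>j=1..N. 1 * h (v i t - v j t)) has_real_derivative
     (\<Sum>i=1..N. \<Sum>j=1..N. 0 * (v i t - v j t) * h (v i t - v j t))
     + 1 / real N * (\<Sum>i=1..N. \<Sum>j=1..N. \<phi> (torus_dist (x i t) (x j t)) * (v j t - v i t) * R i j))
     (at t within {0..})"
    unfolding R_def
    by (rule pair_functional_derivative[OF sol t, where \<alpha> = "\<lambda>_. 1" and b = h and b' = h'])
      (use h(1,2) in auto)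
  from DERIV_cmult[OF this, of "real N * (1 / (real N)\<^sup>2)"]
  have "((\<lambda>t. real N * pair_mean N (\<lambda>i j. h (v i t - v j t))) has_real_derivative D) (at t within {0..})"
    using N by (simp add: D_def pair_mean_def power2_eq_square)
  moreover have "D \<le> pair_mean N (\<lambda>i j. B * \<epsilon> + (- 1) * (\<phi> (torus_dist (x i t) (x j t)) * \<bar>v i t - v j t\<bar>))"
    unfolding D_def
  proof (rule pair_mean_mono)
    fix i j assume ij: "i \<in> {1..N}" "j \<in> {1..N}"
    define w where "w = v j t - v i t"
    define p where "p = \<phi> (torus_dist (x i t) (x j t))"
    have le0: "w * (h' (v i t - v l t) - h' (v j t - v l t)) \<le> 0" for l
    proof (cases "w \<ge> 0")
      case True
      then show ?thesis using h(3)[of "v i t - v l t" "v j t - v l t"]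
        by (intro mult_nonneg_nonpos) (auto simp: w_def)
    next
      case False
      then show ?thesis using h(3)[of "v j t - v l t" "v i t - v l t"]
        by (intro mult_nonpos_nonneg) (auto simp: w_def)
    qed
    have "w * R i j = (\<Sum>l=1..N. w * (h' (v i t - v l t) - h' (v j t - v l t)))"
      by (simp add: R_def sum_subtractf sum_distrib_left right_diff_distrib)
    also have "\<dots> = w * (h' (v i t - v i t) - h' (v j t - v i t))
        + (\<Sum>l\<in>{1..N} - {i}. w * (h' (v i t - v l t) - h' (v j t - v l t)))"
      by (rule sum.remove[OF _ ij(1)]) simp
    also have "\<dots> \<le> w * (h' (v i t - v i t) - h' (v j t - v i t)) + 0"
      by (intro add_left_mono sum_nonpos le0)
    also have "\<dots> = - (w * h' w)" by (simp add: w_def h'_def)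
    also have "\<dots> \<le> \<epsilon> - \<bar>w\<bar>" using h(4)[of w] by simp
    finally have "p * (w * R i j) \<le> p * (\<epsilon> - \<bar>w\<bar>)" using \<phi>(1) by (intro mult_left_mono) (auto simp: p_def)
    also have "\<dots> \<le> B * \<epsilon> - p * \<bar>w\<bar>"
      using mult_right_mono[OF \<phi>(2)[of "x i t" "x j t"], of \<epsilon>] \<epsilon> by (simp add: p_def right_diff_distrib)
    finally show "\<phi> (torus_dist (x i t) (x j t)) * (v j t - v i t) * R i j
      \<le> B * \<epsilon> + (- 1) * (\<phi> (torus_dist (x i t) (x j t)) * \<bar>v i t - v j t\<bar>)"
      by (simp add: p_def w_def mult.assoc abs_minus_commute)
  qed
  moreover have "\<dots> = B * \<epsilon> - pair_mean N (\<lambda>i j. \<phi> (torus_dist (x i t) (x j t)) * \<bar>v i t - v j t\<bar>)"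
    unfolding pair_mean_add pair_mean_cmult pair_mean_const[OF N] by simp
  ultimately show ?thesis by (intro that) (auto simp: h_def)
qed

text \<open>For the bound at time \<open>T\<close> the regularisation parameter is \<open>1 / T\<close>, so that the error, integrated over
  \<open>[0, T]\<close>, is bounded.\<close>

lemma smooth_N_decay:
  assumes smooth: "smooth_kernel \<phi>" and nonneg: "\<And>r. r > 0 \<Longrightarrow> \<phi> r \<ge> 0"
    and nontrivial: "nontrivial_kernel \<phi>"
  shows "\<exists>C. \<forall>t\<ge>1. \<forall>N\<ge>1. \<forall>x v. cs_solution \<phi> N x v \<and> velocity_spread_le N (\<lambda>i. v i 0) A \<longrightarrow>
    variation N (\<lambda>i. v i t) \<le> C * real N / t"
proof -
  obtain B where B: "B \<ge> 0" "\<And>x y. 0 \<le> \<phi> (torus_dist x y)" "\<And>x y. \<phi> (torus_dist x y) \<le> B"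
    using smooth_kernel_bounds[OF smooth nonneg] by blast
  obtain \<psi> g K \<Lambda> where cor: "is_corrector \<phi> \<psi> g K \<Lambda>"
    using corrector_exists[OF kernel_continuous nonneg nontrivial] smooth by metis
  note \<psi> = is_correctorD(1,3,5,9,6)[OF cor]
  define P where "P = \<Lambda> * pi"
  have P: "P \<ge> 0" using \<psi>(4)[of 0] by (auto simp: P_def)
  define C where "C = K / 2 * A\<^sup>2 + 2 * P * (1 + A\<^sup>2) + 2 * P * (\<bar>A\<bar> + 1) + 2 * P * B"
  have "variation N (\<lambda>i. v i T) \<le> C * real N / T"
    if T: "T \<ge> 1" and N: "N \<ge> 1" and sol: "cs_solution \<phi> N x v"
      and A: "velocity_spread_le N (\<lambda>i. v i 0) A" for T N x v
  proof -
    define \<epsilon> where "\<epsilon> = 1 / T"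
    have \<epsilon>: "\<epsilon> > 0" "\<epsilon> \<le> 1" "\<epsilon> * T = 1" using T by (auto simp: \<epsilon>_def)
    define G where "G t = pair_mean N (\<lambda>i j. \<psi> (x i t - x j t) * (v i t - v j t))" for t
    define V where "V t = variation N (\<lambda>i. v i t)" for t
    define J where "J t = dissipation \<phi> N (\<lambda>i. x i t) (\<lambda>i. v i t)" for t
    define S where "S t = real N * pair_mean N (\<lambda>i j. sqrt ((v i t - v j t)\<^sup>2 + \<epsilon>\<^sup>2))" for t
    define X where "X t = pair_mean N (\<lambda>i j. \<phi> (torus_dist (x i t) (x j t)) * \<bar>v i t - v j t\<bar>)" for t
    have V': "(V has_real_derivative - (2 * J t)) (at t within {0..})" if "t \<ge> 0" for t
      unfolding V_def J_def using variation_derivative[OF sol that N] by simp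
    have J: "J t \<ge> 0" for t unfolding J_def by (intro dissipation_nonneg B)
    have V_le: "V t \<le> A\<^sup>2" if "t \<ge> 0" for t
      using variation_nonincreasing[OF sol N B(2), of 0 t] variation_initial_le[OF A N] that by (simp add: V_def)
    have m: "\<bar>\<psi> (a - c) - \<psi> (b - c)\<bar> \<le> 2 * P" for a b c
      using \<psi>(4)[of "a - c"] \<psi>(4)[of "b - c"] by (simp add: P_def)
    have "\<exists>D. (G has_real_derivative D) (at t within {0..}) \<and> D \<le> - V t + K * J t + 2 * P * X t"
      if t0: "t \<ge> 0" for t
    proof -
      obtain D where D: "(G has_real_derivative D) (at t within {0..})"
        "D \<le> - V t + K * J t + pair_mean N (\<lambda>i j. \<phi> (torus_dist (x i t) (x j t)) * \<bar>v i t - v j t\<bar> * (2 * P))"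
        unfolding V_def J_def G_def
        using corrector_derivative_le[OF sol t0 N cor B(2), where m = "\<lambda>_ _. 2 * P", OF m]
        by blast
      moreover have "pair_mean N (\<lambda>i j. \<phi> (torus_dist (x i t) (x j t)) * \<bar>v i t - v j t\<bar> * (2 * P)) = 2 * P * X t"
        unfolding X_def pair_mean_cmult[symmetric] by (simp add: mult.commute)
      ultimately show ?thesis by auto
    qed
    then obtain G' where G': "\<And>t. t \<ge> 0 \<Longrightarrow> (G has_real_derivative G' t) (at t within {0..})"
       "\<And>t. t \<ge> 0 \<Longrightarrow> G' t \<le> - V t + K * J t + 2 * P * X t"
      by metis
    have "\<exists>D. (S has_real_derivative D) (at t within {0..}) \<and> D \<le> B * \<epsilon> - X t" if "t \<ge> 0" for t
      unfolding S_def X_def using regularized_l1_dissipation[OF sol that N \<epsilon>(1) B(2,3)] by blast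
    then obtain S' where S': "\<And>t. t \<ge> 0 \<Longrightarrow> (S has_real_derivative S' t) (at t within {0..})"
       "\<And>t. t \<ge> 0 \<Longrightarrow> S' t \<le> B * \<epsilon> - X t"
      by metis
    define F where "F t = t * V t + G t + K / 2 * V t + 2 * P * S t - 2 * P * B * \<epsilon> * t" for t
    have "F T \<le> F 0"
    proof (rule nonincreasing_on_halfline[where f = F and f' = "\<lambda>t. V t - t * (2 * J t) + G' t - K * J t
        + 2 * P * S' t - 2 * P * B * \<epsilon>"])
      fix t assume t: "0 \<le> t" "t \<le> T"
      show "(F has_real_derivative (V t - t * (2 * J t) + G' t - K * J t
        + 2 * P * S' t - 2 * P * B * \<epsilon>)) (at t within {0..})"
        unfolding F_def using t by (auto intro!: derivative_eq_intros V' G' S')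
    next
      fix t assume t: "0 < t" "t < T"
      have "2 * P * S' t \<le> 2 * P * (B * \<epsilon> - X t)" using S'(2)[of t] t P by (intro mult_left_mono) auto
      moreover have "0 \<le> t * (2 * J t)" using t J[of t] by simp
      ultimately show "V t - t * (2 * J t) + G' t - K * J t + 2 * P * S' t - 2 * P * B * \<epsilon> \<le> 0"
        using G'(2)[of t] t by (simp add: algebra_simps)
    qed (use T in auto)
    moreover have "2 * P * B * \<epsilon> * T = 2 * P * B" using \<epsilon>(3) by (simp add: mult.assoc)
    moreover have "0 \<le> K / 2 * V T" using \<psi>(5) variation_nonneg by (simp add: V_def)
    moreover have "0 \<le> 2 * P * S T"
    proof -
      have "0 \<le> pair_mean N (\<lambda>i j. sqrt ((v i T - v j T)\<^sup>2 + \<epsilon>\<^sup>2))"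
        unfolding pair_mean_def by (intro mult_nonneg_nonneg sum_nonneg) auto
      then show ?thesis using P by (simp add: S_def)
    qed
    ultimately have "T * V T \<le> G 0 - G T + K / 2 * V 0 + 2 * P * S 0 + 2 * P * B" by (simp add: F_def)
    also have "G 0 - G T \<le> 2 * P * (1 + A\<^sup>2)"
    proof -
      have "\<bar>G t\<bar> \<le> P * (1 + A\<^sup>2)" if "t \<ge> 0" for t
      proof -
        have "\<bar>G t\<bar> \<le> P * (1 + V t)" unfolding G_def V_def P_def by (rule abs_corrector_le[OF N \<psi>(4)])
        also have "\<dots> \<le> P * (1 + A\<^sup>2)" using V_le[OF that] P by (intro mult_left_mono) auto
        finally show ?thesis .
      qed
      from this[of 0] this[of T] show ?thesis using T by simp
    qed
    also have "K / 2 * V 0 \<le> K / 2 * A\<^sup>2" using V_le[of 0] \<psi>(5) by (intro mult_left_mono) auto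
    also have "2 * P * S 0 \<le> 2 * P * (real N * (\<bar>A\<bar> + 1))"
    proof -
      have "pair_mean N (\<lambda>i j. sqrt ((v i 0 - v j 0)\<^sup>2 + \<epsilon>\<^sup>2)) \<le> pair_mean N (\<lambda>i j. \<bar>A\<bar> + 1)"
      proof (rule pair_mean_mono)
        fix i j assume "i \<in> {1..N}" "j \<in> {1..N}"
        then have "\<bar>v i 0 - v j 0\<bar> \<le> A" using A by (auto simp: velocity_spread_le_def)
        then show "sqrt ((v i 0 - v j 0)\<^sup>2 + \<epsilon>\<^sup>2) \<le> \<bar>A\<bar> + 1"
          using smooth_abs(5)[OF \<epsilon>(1), of "v i 0 - v j 0"] \<epsilon>(2) by linarith
      qed
      then show ?thesis using P pair_mean_const[OF N] unfolding S_def by (intro mult_left_mono) auto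
    qed
    finally have "T * V T \<le> (K / 2 * A\<^sup>2 + 2 * P * (1 + A\<^sup>2) + 2 * P * B) + 2 * P * (\<bar>A\<bar> + 1) * real N"
      by (simp add: algebra_simps)
    also have "\<dots> \<le> (K / 2 * A\<^sup>2 + 2 * P * (1 + A\<^sup>2) + 2 * P * B) * real N + 2 * P * (\<bar>A\<bar> + 1) * real N"
    proof -
      have "0 \<le> K / 2 * A\<^sup>2 + 2 * P * (1 + A\<^sup>2) + 2 * P * B" using \<psi>(5) P B(1) by simp
      from mult_left_mono[of 1 "real N", OF _ this] N show ?thesis by simp
    qed
    also have "\<dots> = C * real N" by (simp add: C_def algebra_simps)
    finally show ?thesis using T by (simp add: V_def field_simps)
  qed
  then show ?thesis by blast
qed

section \<open>Fields on the circle\<close>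

lemma C1_field_periodic: "C1_field f \<Longrightarrow> t \<ge> 0 \<Longrightarrow> f (x + 2 * pi) t = f x t"
  by (simp add: C1_field_def)

lemma C1_field_dx: "C1_field f \<Longrightarrow> t \<ge> 0 \<Longrightarrow> ((\<lambda>y. f y t) has_real_derivative dx f x t) (at x)"
  unfolding C1_field_def dx_def by (metis DERIV_deriv_iff_real_differentiable)

lemma C1_field_dt: "C1_field f \<Longrightarrow> t \<ge> 0 \<Longrightarrow> (f x has_real_derivative dt f x t) (at t within {0..})"
  unfolding C1_field_def dt_def
  by (metis has_real_derivative_iff_has_vector_derivative vector_derivative_works)

lemma C1_field_continuous:
  assumes f: "C1_field f"
  shows "continuous_on (UNIV \<times> {0..}) (\<lambda>(x, t). f x t)"
proof -
  have dxc: "continuous_on (UNIV \<times> {0..}) (\<lambda>(x, t). dx f x t)" using f by (simp add: C1_field_def)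
  have swap: "continuous_on ({0..} \<times> UNIV) (\<lambda>p::real \<times> real. (snd p, fst p))" by (intro continuous_intros)
  have dxc': "continuous_on ({0..} \<times> UNIV) (\<lambda>(t, x). blinfun_mult_left (dx f x t))"
  proof -
    have "(\<lambda>p::real \<times> real. (snd p, fst p)) ` ({0..} \<times> UNIV) \<subseteq> UNIV \<times> {0..}" by auto
    from bounded_linear.continuous_on[OF bounded_linear_blinfun_mult_left continuous_on_compose2[OF dxc swap this]]
    show ?thesis by (simp add: split_beta)
  qed
  have "continuous_on ({0..} \<times> UNIV) (\<lambda>(t, x). f x t)"
    unfolding continuous_on_eq_continuous_within
  proof safe
    fix t x :: real assume t: "t \<ge> 0"
    have "((\<lambda>(t, x). f x t) has_derivative (\<lambda>(h, k). dt f x t * h + blinfun_mult_left (dx f x t) k)) (at (t, x) within {0..} \<times> UNIV)"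
    proof (rule has_derivative_partialsI)
      show "((\<lambda>t. f x t) has_derivative (*) (dt f x t)) (at t within {0..})"
        using C1_field_dt[OF f t] by (simp add: has_field_derivative_def)
      show "((\<lambda>y. f y s) has_derivative blinfun_apply (blinfun_mult_left (dx f y s))) (at y within UNIV)"
        if "s \<in> {0..}" for s y
        using C1_field_dx[OF f, of s y] that by (simp add: has_field_derivative_def mult_commute_abs)
      show "continuous (at (t, x) within {0..} \<times> UNIV) (\<lambda>(t, x). blinfun_mult_left (dx f x t))"
        using dxc' t unfolding continuous_on_eq_continuous_within by auto
    qed auto
    then show "continuous (at (t, x) within {0..} \<times> UNIV) (\<lambda>(t, x). f x t)"
      by (rule has_derivative_continuous)
  qed
  moreover have "continuous_on (UNIV \<times> {0..}) (\<lambda>p::real \<times> real. (snd p, fst p))" by (intro continuous_intros)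
  moreover have "(\<lambda>p::real \<times> real. (snd p, fst p)) ` (UNIV \<times> {0..}) \<subseteq> {0..} \<times> UNIV" by auto
  ultimately show ?thesis using continuous_on_compose2 by (fastforce simp: split_beta)
qed

lemma C1_field_continuous_compose:
  assumes f: "C1_field f" and p: "continuous_on S p" and q: "continuous_on S q" and nn: "\<And>s. s \<in> S \<Longrightarrow> q s \<ge> 0"
  shows "continuous_on S (\<lambda>s. f (p s) (q s))"
    "continuous_on S (\<lambda>s. dx f (p s) (q s))"
    "continuous_on S (\<lambda>s. dt f (p s) (q s))"
proof -
  have pq: "continuous_on S (\<lambda>s. (p s, q s))" using p q by (intro continuous_intros)
  have im: "(\<lambda>s. (p s, q s)) \<in> S \<rightarrow> UNIV \<times> {0..}" using nn by auto
  have c: "continuous_on (UNIV \<times> {0..}) (\<lambda>(x, t). dx f x t)" "continuous_on (UNIV \<times> {0..}) (\<lambda>(x, t). dt f x t)"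
    using f by (auto simp: C1_field_def)
  show "continuous_on S (\<lambda>s. f (p s) (q s))" "continuous_on S (\<lambda>s. dx f (p s) (q s))" "continuous_on S (\<lambda>s. dt f (p s) (q s))"
    using continuous_on_compose2[OF C1_field_continuous[OF f] pq] continuous_on_compose2[OF c(1) pq]
      continuous_on_compose2[OF c(2) pq] im by auto
qed

section \<open>Transport of pair functionals\<close>

text \<open>Two copies of a fundamental domain of the circle.\<close>

abbreviation box2 :: "(real \<times> real) set" where
  "box2 \<equiv> cbox (0, 0) (2 * pi, 2 * pi)"

lemma mem_box2: "(x, y) \<in> box2 \<longleftrightarrow> x \<in> {0..2 * pi} \<and> y \<in> {0..2 * pi}"
  by (auto simp: cbox_Pair_eq)

lemma integral_periodic_derivative_fst:
  fixes P P' :: "real \<Rightarrow> real \<Rightarrow> real"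
  assumes cont: "continuous_on UNIV (\<lambda>(x, y). P' x y)"
    and der: "\<And>x y. ((\<lambda>x. P x y) has_real_derivative P' x y) (at x)"
    and per: "\<And>y. P (2 * pi) y = P 0 y"
  shows "integral box2 (\<lambda>(x, y). P' x y) = 0"
proof -
  have c: "continuous_on box2 (\<lambda>(x, y). P' x y)" by (rule continuous_on_subset[OF cont]) auto
  have "integral box2 (\<lambda>(x, y). P' x y) = integral {0..2*pi} (\<lambda>x. integral {0..2*pi} (\<lambda>y. P' x y))"
    using integral_prod_continuous[OF c] by simp
  also have "\<dots> = integral {0..2*pi} (\<lambda>y. integral {0..2*pi} (\<lambda>x. P' x y))"
    using integral_swap_continuous[OF c] by simp
  also have "(\<lambda>y. integral {0..2*pi} (\<lambda>x. P' x y)) = (\<lambda>y. 0)"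
  proof
    fix y
    have "((\<lambda>x. P' x y) has_integral (P (2*pi) y - P 0 y)) {0..2*pi}"
      by (intro fundamental_theorem_of_calculus)
        (use der in \<open>auto simp: has_real_derivative_iff_has_vector_derivative[symmetric] intro: has_field_derivative_at_within\<close>)
    then show "integral {0..2*pi} (\<lambda>x. P' x y) = 0" using per by (simp add: integral_unique)
  qed
  finally show ?thesis by simp
qed

lemma integral_periodic_derivative_snd:
  fixes P P' :: "real \<Rightarrow> real \<Rightarrow> real"
  assumes cont: "continuous_on UNIV (\<lambda>(x, y). P' x y)"
    and der: "\<And>x y. ((\<lambda>y. P x y) has_real_derivative P' x y) (at y)"
    and per: "\<And>x. P x (2 * pi) = P x 0"
  shows "integral box2 (\<lambda>(x, y). P' x y) = 0"
proof -
  have c: "continuous_on box2 (\<lambda>(x, y). P' x y)" by (rule continuous_on_subset[OF cont]) auto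
  have "integral box2 (\<lambda>(x, y). P' x y) = integral box2 (\<lambda>(x, y). P' y x)"
    by (rule integral_swap_2dim[OF c])
  also have "\<dots> = 0"
  proof (rule integral_periodic_derivative_fst[where P = "\<lambda>x y. P y x"])
    show "continuous_on UNIV (\<lambda>(x, y). P' y x)"
    proof -
      have "continuous_on UNIV (\<lambda>p::real \<times> real. (snd p, fst p))" by (intro continuous_intros)
      from continuous_on_compose2[OF cont this] show ?thesis by (simp add: split_beta)
    qed
  qed (use der per in auto)
  finally show ?thesis .
qed

text \<open>The two summands with divergence form, \<open>X\<close> and \<open>Y\<close>, integrate to zero by periodicity; what remains of the time
  derivative is the derivative along the flow, with acceleration \<open>a\<close>.\<close>

lemma pair_transport:
  assumes \<rho>: "C1_field \<rho>" and v: "C1_field v"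
    and conserve: "\<And>x t. t \<ge> 0 \<Longrightarrow> dt \<rho> x t + dx (\<lambda>y s. v y s * \<rho> y s) x t = 0"
    and \<alpha>: "\<And>z. (\<alpha> has_real_derivative \<alpha>' z) (at z)" "continuous_on UNIV \<alpha>'" "\<And>z. \<alpha> (z + 2 * pi) = \<alpha> z"
    and b: "\<And>w. (b has_real_derivative b' w) (at w)" "continuous_on UNIV b'"
    and t: "t \<ge> 0"
  defines "a \<equiv> \<lambda>x. dt v x t + v x t * dx v x t"
  shows "((\<lambda>t. integral box2 (\<lambda>(x, y). \<alpha> (x - y) * b (v x t - v y t) * \<rho> x t * \<rho> y t)) has_real_derivative
    integral box2 (\<lambda>(x, y). (\<alpha>' (x - y) * (v x t - v y t) * b (v x t - v y t)
        + \<alpha> (x - y) * b' (v x t - v y t) * (a x - a y)) * \<rho> x t * \<rho> y t)) (at t within {0..})"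
proof -
  have c\<alpha>: "continuous_on UNIV \<alpha>" and cb: "continuous_on UNIV b"
    using \<alpha>(1) b(1) by (auto simp: continuous_on_eq_continuous_at intro: DERIV_isCont)
  note [continuous_intros] = continuous_on_compose2[OF c\<alpha> _ subset_UNIV] continuous_on_compose2[OF cb _ subset_UNIV]
    continuous_on_compose2[OF \<alpha>(2) _ subset_UNIV] continuous_on_compose2[OF b(2) _ subset_UNIV]
    C1_field_continuous_compose[OF \<rho>] C1_field_continuous_compose[OF v]
  define c where "c x y s = \<alpha> (x - y) * b (v x s - v y s)" for x y s
  define cw where "cw x y s = \<alpha> (x - y) * b' (v x s - v y s)" for x y s
  define D where "D s p = (case p of (x, y) \<Rightarrow>
      cw x y s * (dt v x s - dt v y s) * \<rho> x s * \<rho> y s + c x y s * (dt \<rho> x s * \<rho> y s + \<rho> x s * dt \<rho> y s))" for s p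
  have "((\<lambda>t. integral box2 (\<lambda>(x, y). c x y t * \<rho> x t * \<rho> y t)) has_real_derivative integral box2 (D t)) (at t within {0..})"
  proof (rule leibniz_rule_field_derivative)
    fix s :: real and p :: "real \<times> real" assume s: "s \<in> {0..}"
    obtain x y where p: "p = (x, y)" by force
    note d = C1_field_dt[OF v, of s] C1_field_dt[OF \<rho>, of s]
    have "((\<lambda>s. c x y s * \<rho> x s * \<rho> y s) has_real_derivative
       ((\<alpha> (x - y) * (b' (v x s - v y s) * (dt v x s - dt v y s))) * \<rho> x s + dt \<rho> x s * c x y s) * \<rho> y s
          + dt \<rho> y s * (c x y s * \<rho> x s)) (at s within {0..})"
      unfolding c_def using s
      by (intro DERIV_mult d DERIV_cmult DERIV_chain2[OF b(1)] DERIV_diff) auto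
    then show "((\<lambda>s. case p of (x, y) \<Rightarrow> c x y s * \<rho> x s * \<rho> y s) has_real_derivative D s p) (at s within {0..})"
      unfolding p D_def by (simp add: cw_def algebra_simps)
  next
    fix s :: real assume "s \<in> {0..}"
    then show "(\<lambda>(x, y). c x y s * \<rho> x s * \<rho> y s) integrable_on box2"
      unfolding c_def split_beta by (intro integrable_continuous continuous_intros) auto
  next
    show "continuous_on ({0..} \<times> box2) (\<lambda>(s, p). D s p)"
      unfolding D_def c_def cw_def split_beta by (intro continuous_intros) auto
  qed (use t in auto)
  also have "integral box2 (D t) = integral box2 (\<lambda>(x, y). (\<alpha>' (x - y) * (v x t - v y t) * b (v x t - v y t)
        + \<alpha> (x - y) * b' (v x t - v y t) * (a x - a y)) * \<rho> x t * \<rho> y t)" (is "_ = integral box2 ?R")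
  proof -
    define m' where "m' x = dx v x t * \<rho> x t + dx \<rho> x t * v x t" for x
    have m: "((\<lambda>x. v x t * \<rho> x t) has_real_derivative m' x) (at x)" for x
      unfolding m'_def by (intro DERIV_mult C1_field_dx[OF v t] C1_field_dx[OF \<rho> t])
    have dtr: "dt \<rho> x t = - m' x" for x
      using conserve[OF t, of x] DERIV_imp_deriv[OF m[of x]] by (simp add: dx_def)
    define X where "X x y = ((\<alpha>' (x - y) * b (v x t - v y t) + cw x y t * dx v x t) * (v x t * \<rho> x t) + m' x * c x y t) * \<rho> y t" for x y
    define Y where "Y x y = ((- \<alpha>' (x - y) * b (v x t - v y t) - cw x y t * dx v y t) * (v y t * \<rho> y t) + m' y * c x y t) * \<rho> x t" for x y
    have X0: "integral box2 (\<lambda>(x, y). X x y) = 0"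
    proof (rule integral_periodic_derivative_fst[where P = "\<lambda>x y. c x y t * (v x t * \<rho> x t) * \<rho> y t"])
      show "continuous_on UNIV (\<lambda>(x, y). X x y)"
        unfolding X_def m'_def c_def cw_def split_beta by (intro continuous_intros t)
      fix x y
      have "((\<lambda>x. c x y t) has_real_derivative \<alpha>' (x - y) * b (v x t - v y t) + cw x y t * dx v x t) (at x)"
        unfolding c_def cw_def
        by (auto intro!: derivative_eq_intros DERIV_chain2[OF \<alpha>(1)] DERIV_chain2[OF b(1)] C1_field_dx[OF v t])
      then show "((\<lambda>x. c x y t * (v x t * \<rho> x t) * \<rho> y t) has_real_derivative X x y) (at x)"
        unfolding X_def by (intro DERIV_cmult_right DERIV_mult m)
      show "c (2 * pi) y t * (v (2 * pi) t * \<rho> (2 * pi) t) * \<rho> y t = c 0 y t * (v 0 t * \<rho> 0 t) * \<rho> y t"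
        using C1_field_periodic[OF v t, of 0] C1_field_periodic[OF \<rho> t, of 0] \<alpha>(3)[of "- y"]
        by (simp add: c_def algebra_simps)
    qed
    have Y0: "integral box2 (\<lambda>(x, y). Y x y) = 0"
    proof (rule integral_periodic_derivative_snd[where P = "\<lambda>x y. c x y t * (v y t * \<rho> y t) * \<rho> x t"])
      show "continuous_on UNIV (\<lambda>(x, y). Y x y)"
        unfolding Y_def m'_def c_def cw_def split_beta by (intro continuous_intros t)
      fix x y
      have "((\<lambda>y. c x y t) has_real_derivative - \<alpha>' (x - y) * b (v x t - v y t) - cw x y t * dx v y t) (at y)"
        unfolding c_def cw_def
        by (auto intro!: derivative_eq_intros DERIV_chain2[OF \<alpha>(1)] DERIV_chain2[OF b(1)] C1_field_dx[OF v t])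
      then show "((\<lambda>y. c x y t * (v y t * \<rho> y t) * \<rho> x t) has_real_derivative Y x y) (at y)"
        unfolding Y_def by (intro DERIV_cmult_right DERIV_mult m)
    next
      fix x
      show "c x (2 * pi) t * (v (2 * pi) t * \<rho> (2 * pi) t) * \<rho> x t = c x 0 t * (v 0 t * \<rho> 0 t) * \<rho> x t"
        using C1_field_periodic[OF v t, of 0] C1_field_periodic[OF \<rho> t, of 0] \<alpha>(3)[of "x - 2 * pi"]
        by (simp add: c_def)
    qed
    have intX: "(\<lambda>(x, y). X x y) integrable_on box2" "(\<lambda>(x, y). Y x y) integrable_on box2"
      unfolding X_def Y_def m'_def c_def cw_def split_beta
      by (intro integrable_continuous continuous_intros t)+
    have intD: "D t integrable_on box2"
      unfolding D_def c_def cw_def split_beta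
      by (intro integrable_continuous continuous_intros t)
    have "?R p = D t p + (case p of (x, y) \<Rightarrow> X x y) + (case p of (x, y) \<Rightarrow> Y x y)" for p
      by (cases p) (simp add: D_def X_def Y_def dtr a_def c_def cw_def algebra_simps)
    then have "integral box2 ?R = integral box2 (\<lambda>p. D t p + (case p of (x, y) \<Rightarrow> X x y) + (case p of (x, y) \<Rightarrow> Y x y))"
      by (intro integral_cong) blast
    also have "\<dots> = integral box2 (D t)"
      using intX intD X0 Y0 by (simp add: integral_add integrable_add)
    finally show ?thesis by simp
  qed
  finally show ?thesis unfolding c_def .
qed

section \<open>Alignment with respect to a finite measure on the circle\<close>

text \<open>The kernel restricted to distances greater than \<open>\<epsilon>\<close>.\<close>

definition truncated_kernel :: "(real \<Rightarrow> real) \<Rightarrow> real \<Rightarrow> real \<Rightarrow> real \<Rightarrow> real" where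
  "truncated_kernel \<phi> \<epsilon> x y = (if \<epsilon> < torus_dist x y then \<phi> (torus_dist x y) else 0)"

lemma truncated_kernel_sym: "truncated_kernel \<phi> \<epsilon> y x = truncated_kernel \<phi> \<epsilon> x y"
  by (simp add: truncated_kernel_def torus_dist_commute)

lemma truncated_kernel_nonneg:
  assumes "\<And>r. r > 0 \<Longrightarrow> \<phi> r \<ge> 0" "\<epsilon> > 0"
  shows "0 \<le> truncated_kernel \<phi> \<epsilon> x y"
  using assms by (auto simp: truncated_kernel_def)

lemma truncated_kernel_bounded:
  assumes cont: "continuous_on {0<..} \<phi>" and \<epsilon>: "\<epsilon> > 0"
  obtains B where "\<And>x y. \<bar>truncated_kernel \<phi> \<epsilon> x y\<bar> \<le> B"
proof -
  have "continuous_on {\<epsilon>..pi} \<phi>" by (rule continuous_on_subset[OF cont]) (use \<epsilon> in auto)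
  then have "bounded (\<phi> ` {\<epsilon>..pi})" by (intro compact_imp_bounded compact_continuous_image) auto
  then obtain B where "\<forall>y\<in>\<phi> ` {\<epsilon>..pi}. norm y \<le> B" unfolding bounded_iff by blast
  then have "\<bar>\<phi> r\<bar> \<le> B" if "\<epsilon> \<le> r" "r \<le> pi" for r using that by simp
  then have "\<bar>truncated_kernel \<phi> \<epsilon> x y\<bar> \<le> max B 0" for x y
    using torus_dist_bounds[of x y] by (simp add: truncated_kernel_def le_max_iff_disj)
  then show ?thesis by (rule that)
qed

lemma measurable_continuous2:
  fixes f :: "real \<Rightarrow> real \<Rightarrow> real"
  assumes "continuous_on UNIV (\<lambda>(x, y). f x y)"
  shows "(\<lambda>(x, y). f x y) \<in> borel_measurable (borel \<Otimes>\<^sub>M borel)"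
  using borel_measurable_continuous_onI[OF assms] by (simp add: borel_prod)

lemma truncated_kernel_measurable:
  assumes cont: "continuous_on {0<..} \<phi>" and \<epsilon>: "\<epsilon> > 0"
  shows "(\<lambda>(x, y). truncated_kernel \<phi> \<epsilon> x y) \<in> borel_measurable (borel \<Otimes>\<^sub>M borel)"
proof -
  have [measurable]: "(\<lambda>(x, y). torus_dist x y) \<in> borel_measurable (borel \<Otimes>\<^sub>M borel)"
    by (intro measurable_continuous2) (auto simp: split_beta intro!: continuous_intros)
  have "(\<lambda>r. indicator {\<epsilon><..} r *\<^sub>R \<phi> r) \<in> borel_measurable borel"
    by (intro borel_measurable_continuous_on_indicator continuous_on_subset[OF cont]) (use \<epsilon> in auto)
  then have [measurable]: "(\<lambda>r. if \<epsilon> < r then \<phi> r else 0) \<in> borel_measurable borel"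
    by (rule measurable_cong[THEN iffD1, rotated]) (auto simp: indicator_def)
  have "(\<lambda>p. (\<lambda>r. if \<epsilon> < r then \<phi> r else 0) ((\<lambda>(x, y). torus_dist x y) p)) \<in> borel_measurable (borel \<Otimes>\<^sub>M borel)"
    by measurable
  then show ?thesis by (simp add: truncated_kernel_def split_beta)
qed

text \<open>A finite mass distribution, carried by the fundamental domain \<open>[0, 2\<pi>]\<close> of the circle.\<close>

locale circle_mass = finite_measure \<mu> for \<mu> :: "real measure" +
  assumes sets_\<mu> [measurable_cong]: "sets \<mu> = sets borel"
    and AE_\<mu>: "AE x in \<mu>. x \<in> {0..2 * pi}"
begin

sublocale pair_sigma_finite \<mu> \<mu> ..

lemma space_\<mu>: "space \<mu> = UNIV"
  using sets_eq_imp_space_eq[OF sets_\<mu>] by simp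

abbreviation M where "M \<equiv> measure \<mu> UNIV"

lemma integrable_bounded:
  fixes f :: "real \<Rightarrow> real"
  assumes f: "f \<in> borel_measurable borel" and bd: "\<And>x. x \<in> {0..2 * pi} \<Longrightarrow> \<bar>f x\<bar> \<le> B"
  shows "integrable \<mu> f"
proof (rule integrable_const_bound[of _ B])
  show "AE x in \<mu>. norm (f x) \<le> B" using AE_\<mu> by eventually_elim (use bd in auto)
  show "f \<in> borel_measurable \<mu>" using f by measurable
qed

lemma sets_\<mu>2 [measurable_cong]: "sets (\<mu> \<Otimes>\<^sub>M \<mu>) = sets (borel \<Otimes>\<^sub>M borel)"
  by (intro sets_pair_measure_cong sets_\<mu>)

lemma AE_\<mu>2: "AE p in \<mu> \<Otimes>\<^sub>M \<mu>. p \<in> box2"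
proof (rule AE_pair_measure)
  have "box2 \<in> sets (borel :: (real \<times> real) measure)" by (intro borel_closed) auto
  then have "box2 \<in> sets (\<mu> \<Otimes>\<^sub>M \<mu>)" by (simp only: sets_\<mu>2 borel_prod)
  moreover have "{p \<in> space (\<mu> \<Otimes>\<^sub>M \<mu>). p \<in> box2} = box2" by (auto simp: space_pair_measure space_\<mu>)
  ultimately show "{p \<in> space (\<mu> \<Otimes>\<^sub>M \<mu>). p \<in> box2} \<in> sets (\<mu> \<Otimes>\<^sub>M \<mu>)" by simp
  show "AE x in \<mu>. AE y in \<mu>. (x, y) \<in> box2"
    using AE_\<mu>
  proof eventually_elim
    case (elim x)
    show ?case using AE_\<mu> by eventually_elim (use elim in \<open>auto simp: mem_box2\<close>)
  qed
qed

sublocale P: finite_measure "\<mu> \<Otimes>\<^sub>M \<mu>"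
  by (intro finite_measure_pair_measure finite_measure_axioms)

text \<open>The double integral against \<open>\<mu>\<close>, in both variables.\<close>

definition pair_integral :: "(real \<Rightarrow> real \<Rightarrow> real) \<Rightarrow> real" where
  "pair_integral f = (\<integral>p. f (fst p) (snd p) \<partial>(\<mu> \<Otimes>\<^sub>M \<mu>))"

text \<open>Measurable functions that are bounded on the fundamental domain; they are integrable with respect
  to \<open>\<mu> \<Otimes>\<^sub>M \<mu>\<close>.\<close>

definition bounded_pair :: "(real \<Rightarrow> real \<Rightarrow> real) \<Rightarrow> bool" where
  "bounded_pair f \<longleftrightarrow> (\<lambda>(x, y). f x y) \<in> borel_measurable (borel \<Otimes>\<^sub>M borel) \<and> (\<exists>B. \<forall>p\<in>box2. \<bar>f (fst p) (snd p)\<bar> \<le> B)"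

lemma bounded_pair_measurable:
  assumes "bounded_pair f" shows "(\<lambda>p. f (fst p) (snd p)) \<in> borel_measurable (\<mu> \<Otimes>\<^sub>M \<mu>)"
  using assms by (simp add: bounded_pair_def split_beta' measurable_cong_sets[OF sets_\<mu>2 refl])

lemma bounded_pair_integrable:
  assumes "bounded_pair f"
  shows "integrable (\<mu> \<Otimes>\<^sub>M \<mu>) (\<lambda>p. f (fst p) (snd p))"
proof -
  obtain B where B: "\<And>p. p \<in> box2 \<Longrightarrow> \<bar>f (fst p) (snd p)\<bar> \<le> B" using assms by (auto simp: bounded_pair_def)
  show ?thesis
  proof (rule P.integrable_const_bound[of _ B])
    show "AE p in \<mu> \<Otimes>\<^sub>M \<mu>. norm (f (fst p) (snd p)) \<le> B" using AE_\<mu>2 by eventually_elim (use B in auto)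
    show "(\<lambda>p. f (fst p) (snd p)) \<in> borel_measurable (\<mu> \<Otimes>\<^sub>M \<mu>)"
      using assms by (rule bounded_pair_measurable)
  qed
qed

lemma bounded_pair_continuous:
  assumes "continuous_on UNIV (\<lambda>p. f (fst p) (snd p))"
  shows "bounded_pair f"
proof -
  have "continuous_on box2 (\<lambda>p. f (fst p) (snd p))" by (rule continuous_on_subset[OF assms]) auto
  then have "bounded ((\<lambda>p. f (fst p) (snd p)) ` box2)" by (intro compact_imp_bounded compact_continuous_image) auto
  then obtain B where "\<forall>y\<in>(\<lambda>p. f (fst p) (snd p)) ` box2. norm y \<le> B" unfolding bounded_iff by blast
  moreover have "(\<lambda>(x, y). f x y) \<in> borel_measurable (borel \<Otimes>\<^sub>M borel)"
    by (rule measurable_continuous2) (use assms in \<open>simp add: split_beta\<close>)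
  ultimately show ?thesis unfolding bounded_pair_def by auto
qed

lemma bounded_pair_mult:
  assumes "bounded_pair f" "bounded_pair g" shows "bounded_pair (\<lambda>x y. f x y * g x y)"
proof -
  obtain A B where "\<forall>p\<in>box2. \<bar>f (fst p) (snd p)\<bar> \<le> A" "\<forall>p\<in>box2. \<bar>g (fst p) (snd p)\<bar> \<le> B"
    using assms unfolding bounded_pair_def by blast
  then have "\<forall>p\<in>box2. \<bar>f (fst p) (snd p) * g (fst p) (snd p)\<bar> \<le> \<bar>A\<bar> * \<bar>B\<bar>"
    unfolding abs_mult by (intro ballI mult_mono) (auto intro: order_trans)
  moreover have "(\<lambda>(x, y). f x y * g x y) \<in> borel_measurable (borel \<Otimes>\<^sub>M borel)"
    using assms unfolding bounded_pair_def split_beta by (auto intro: borel_measurable_times)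
  ultimately show ?thesis unfolding bounded_pair_def by blast
qed

lemma bounded_pair_add:
  assumes "bounded_pair f" "bounded_pair g" shows "bounded_pair (\<lambda>x y. f x y + g x y)"
proof -
  obtain A B where "\<forall>p\<in>box2. \<bar>f (fst p) (snd p)\<bar> \<le> A" "\<forall>p\<in>box2. \<bar>g (fst p) (snd p)\<bar> \<le> B"
    using assms unfolding bounded_pair_def by blast
  then have "\<forall>p\<in>box2. \<bar>f (fst p) (snd p) + g (fst p) (snd p)\<bar> \<le> A + B"
    by (intro ballI order_trans[OF abs_triangle_ineq] add_mono) auto
  moreover have "(\<lambda>(x, y). f x y + g x y) \<in> borel_measurable (borel \<Otimes>\<^sub>M borel)"
    using assms unfolding bounded_pair_def split_beta by (auto intro: borel_measurable_add)
  ultimately show ?thesis unfolding bounded_pair_def by blast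
qed

lemma bounded_pair_cmult: "bounded_pair f \<Longrightarrow> bounded_pair (\<lambda>x y. c * f x y)"
  by (rule bounded_pair_mult[OF bounded_pair_continuous]) (intro continuous_intros)

lemma bounded_pair_truncated_kernel:
  assumes "continuous_on {0<..} \<phi>" "\<epsilon> > 0"
  shows "bounded_pair (truncated_kernel \<phi> \<epsilon>)"
  using truncated_kernel_measurable[OF assms] truncated_kernel_bounded[OF assms]
  unfolding bounded_pair_def by (metis (full_types))

lemma pair_integral_add: "bounded_pair f \<Longrightarrow> bounded_pair g \<Longrightarrow> pair_integral (\<lambda>x y. f x y + g x y) = pair_integral f + pair_integral g"
  unfolding pair_integral_def by (intro Bochner_Integration.integral_add bounded_pair_integrable)

lemma pair_integral_cmult: "pair_integral (\<lambda>x y. c * f x y) = c * pair_integral f"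
  unfolding pair_integral_def by simp

lemma pair_integral_mono:
  assumes "bounded_pair f" "bounded_pair g" and le: "\<And>x y. x \<in> {0..2 * pi} \<Longrightarrow> y \<in> {0..2 * pi} \<Longrightarrow> f x y \<le> g x y"
  shows "pair_integral f \<le> pair_integral g"
  unfolding pair_integral_def
proof (rule integral_mono_AE)
  show "AE p in \<mu> \<Otimes>\<^sub>M \<mu>. f (fst p) (snd p) \<le> g (fst p) (snd p)"
    using AE_\<mu>2 by eventually_elim (use le in \<open>auto simp: mem_box2\<close>)
qed (use assms bounded_pair_integrable in auto)

lemma pair_integral_swap:
  assumes "bounded_pair f" shows "pair_integral (\<lambda>x y. f y x) = pair_integral f"
proof -
  have [measurable]: "(\<lambda>(x, y). f x y) \<in> borel_measurable (\<mu> \<Otimes>\<^sub>M \<mu>)"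
    using bounded_pair_measurable[OF assms] by (simp add: split_beta')
  show ?thesis
    using integral_product_swap[of "\<lambda>(x, y). f x y"] by (simp add: pair_integral_def split_beta')
qed

lemma pair_integral_iterated:
  assumes "bounded_pair f" shows "pair_integral f = (\<integral>x. \<integral>y. f x y \<partial>\<mu> \<partial>\<mu>)"
  using integral_fst'[OF bounded_pair_integrable[OF assms]] by (simp add: pair_integral_def)

lemma pair_integral_const: "pair_integral (\<lambda>x y. c) = c * M\<^sup>2"
proof -
  have "bounded_pair (\<lambda>x y. c)" by (intro bounded_pair_continuous continuous_intros)
  then show ?thesis unfolding pair_integral_iterated[OF \<open>bounded_pair (\<lambda>x y. c)\<close>] by (simp add: space_\<mu> power2_eq_square)
qed

lemma bounded_pair_swap:
  assumes "bounded_pair f" shows "bounded_pair (\<lambda>x y. f y x)"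
proof -
  obtain B where B: "\<And>p. p \<in> box2 \<Longrightarrow> \<bar>f (fst p) (snd p)\<bar> \<le> B" using assms by (auto simp: bounded_pair_def)
  have "(\<lambda>(x, y). f x y) \<in> borel_measurable (borel \<Otimes>\<^sub>M borel)" using assms by (simp add: bounded_pair_def)
  from measurable_compose[OF measurable_pair_swap' this]
  have "(\<lambda>(x, y). f y x) \<in> borel_measurable (borel \<Otimes>\<^sub>M borel)" by (simp add: split_beta)
  moreover have "\<forall>p\<in>box2. \<bar>f (snd p) (fst p)\<bar> \<le> B"
  proof
    fix p assume "p \<in> box2"
    then have "(snd p, fst p) \<in> box2" by (cases p) (auto simp: mem_box2)
    from B[OF this] show "\<bar>f (snd p) (fst p)\<bar> \<le> B" by simp
  qed
  ultimately show ?thesis unfolding bounded_pair_def by auto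
qed

lemma pair_integral_antisym:
  assumes \<beta>: "bounded_pair \<beta>" "\<And>x y. \<beta> y x = - \<beta> x y" and a: "bounded_pair (\<lambda>x y. a x)"
  shows "pair_integral (\<lambda>x y. \<beta> x y * (a x - a y)) = 2 * (\<integral>x. a x * (\<integral>y. \<beta> x y \<partial>\<mu>) \<partial>\<mu>)"
proof -
  have ba: "bounded_pair (\<lambda>x y. \<beta> x y * a x)" by (intro bounded_pair_mult \<beta> a)
  have "pair_integral (\<lambda>x y. \<beta> x y * (a x - a y)) = pair_integral (\<lambda>x y. \<beta> x y * a x + \<beta> y x * a y)"
  proof (intro arg_cong[of _ _ pair_integral] ext)
    fix x y show "\<beta> x y * (a x - a y) = \<beta> x y * a x + \<beta> y x * a y"
      using \<beta>(2)[of x y] by (simp add: algebra_simps)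
  qed
  also have "\<dots> = pair_integral (\<lambda>x y. \<beta> x y * a x) + pair_integral (\<lambda>x y. \<beta> y x * a y)"
    by (rule pair_integral_add[OF ba bounded_pair_swap[OF ba]])
  also have "pair_integral (\<lambda>x y. \<beta> y x * a y) = pair_integral (\<lambda>x y. \<beta> x y * a x)" by (rule pair_integral_swap[OF ba])
  also have "pair_integral (\<lambda>x y. \<beta> x y * a x) = (\<integral>x. a x * (\<integral>y. \<beta> x y \<partial>\<mu>) \<partial>\<mu>)"
    unfolding pair_integral_iterated[OF ba] by (simp add: mult.commute)
  finally show ?thesis by simp
qed

lemma partial_integral_measurable:
  assumes "bounded_pair f" shows "(\<lambda>x. \<integral>y. f x y \<partial>\<mu>) \<in> borel_measurable borel"
proof -
  have [measurable]: "(\<lambda>(x, y). f x y) \<in> borel_measurable (borel \<Otimes>\<^sub>M \<mu>)"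
    using assms unfolding bounded_pair_def by (simp cong: measurable_cong_sets add: sets_\<mu> sets_pair_measure_cong[OF refl sets_\<mu>])
  show ?thesis by measurable
qed

lemma partial_integrable:
  assumes "bounded_pair f" "x \<in> {0..2 * pi}" shows "integrable \<mu> (f x)"
proof -
  obtain B where B: "\<And>p. p \<in> box2 \<Longrightarrow> \<bar>f (fst p) (snd p)\<bar> \<le> B" using assms by (auto simp: bounded_pair_def)
  show ?thesis
  proof (rule integrable_bounded[where B = B])
    have "(\<lambda>(x, y). f x y) \<in> borel_measurable (borel \<Otimes>\<^sub>M borel)" using assms by (simp add: bounded_pair_def)
    from measurable_compose[OF measurable_Pair1'[of x borel borel] this]
    show "f x \<in> borel_measurable borel" by simp
    show "\<bar>f x y\<bar> \<le> B" if "y \<in> {0..2 * pi}" for y using B[of "(x, y)"] assms(2) that by (simp add: mem_box2)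
  qed
qed

lemma abs_integral_le:
  fixes f :: "real \<Rightarrow> real"
  assumes "integrable \<mu> f" "\<And>y. y \<in> {0..2 * pi} \<Longrightarrow> \<bar>f y\<bar> \<le> B"
  shows "\<bar>\<integral>y. f y \<partial>\<mu>\<bar> \<le> B * M"
proof -
  have "\<bar>\<integral>y. f y \<partial>\<mu>\<bar> \<le> (\<integral>y. \<bar>f y\<bar> \<partial>\<mu>)" using integral_norm_bound[of \<mu> f] by simp
  also have "\<dots> \<le> (\<integral>y. B \<partial>\<mu>)"
  proof (rule integral_mono_AE)
    show "AE y in \<mu>. \<bar>f y\<bar> \<le> B" using AE_\<mu> by eventually_elim (use assms(2) in auto)
  qed (use assms in auto)
  finally show ?thesis by (simp add: space_\<mu> mult.commute)
qed

lemma bounded_pair_partial_integral: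
  assumes "bounded_pair f" shows "bounded_pair (\<lambda>x y. \<integral>z. f x z \<partial>\<mu>)"
proof -
  obtain B where B: "\<And>p. p \<in> box2 \<Longrightarrow> \<bar>f (fst p) (snd p)\<bar> \<le> B" using assms by (auto simp: bounded_pair_def)
  have "(\<lambda>p. \<integral>z. f (fst p) z \<partial>\<mu>) \<in> borel_measurable (borel \<Otimes>\<^sub>M borel)"
    by (rule measurable_compose[OF measurable_fst partial_integral_measurable[OF assms]])
  moreover have "\<bar>\<integral>z. f (fst p) z \<partial>\<mu>\<bar> \<le> B * M" if p: "p \<in> box2" for p
  proof -
    obtain x y where xy: "p = (x, y)" "x \<in> {0..2 * pi}" using p by (cases p) (auto simp: mem_box2)
    have "\<bar>\<integral>z. f x z \<partial>\<mu>\<bar> \<le> B * M"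
    proof (rule abs_integral_le[OF partial_integrable[OF assms xy(2)]])
      fix z assume "z \<in> {0..2 * pi}"
      then show "\<bar>f x z\<bar> \<le> B" using B[of "(x, z)"] xy(2) by (simp add: mem_box2)
    qed
    then show ?thesis by (simp add: xy)
  qed
  ultimately show ?thesis unfolding bounded_pair_def split_beta' by blast
qed

text \<open>The continuous counterpart of \<open>sum_alignment_symmetrized\<close>.\<close>

lemma alignment_symmetrized:
  assumes k: "bounded_pair k" "\<And>x y. k y x = k x y" and f: "bounded_pair (\<lambda>x y. f x)" and v: "bounded_pair (\<lambda>x y. v x)"
  shows "2 * (\<integral>x. f x * (\<integral>y. k x y * (v y - v x) \<partial>\<mu>) \<partial>\<mu>) = pair_integral (\<lambda>x y. k x y * (v y - v x) * (f x - f y))"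
proof -
  have "bounded_pair (\<lambda>x y. v y + (- 1) * v x)" by (intro bounded_pair_add bounded_pair_cmult v bounded_pair_swap[OF v])
  then have kv: "bounded_pair (\<lambda>x y. k x y * (v y - v x))" using bounded_pair_mult[OF k(1)] by simp
  show ?thesis
  proof (rule pair_integral_antisym[OF kv _ f, symmetric])
    fix x y show "k y x * (v x - v y) = - (k x y * (v y - v x))"
      using k(2)[of x y] by (simp add: algebra_simps)
  qed
qed

lemma alignment_limit:
  assumes cont: "continuous_on {0<..} \<phi>" and f: "bounded_pair (\<lambda>x y. f x)" and v: "continuous_on UNIV v"
    and a: "continuous_on UNIV a"
    and lim: "uniform_limit UNIV (\<lambda>\<epsilon> x. \<integral>y. truncated_kernel \<phi> \<epsilon> x y * (v y - v x) \<partial>\<mu>) a (at_right 0)"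
  shows "((\<lambda>\<epsilon>. pair_integral (\<lambda>x y. truncated_kernel \<phi> \<epsilon> x y * (v y - v x) * (f x - f y))) \<longlongrightarrow> 2 * (\<integral>x. a x * f x \<partial>\<mu>)) (at_right 0)"
proof -
  define A where "A \<epsilon> x = (\<integral>y. truncated_kernel \<phi> \<epsilon> x y * (v y - v x) \<partial>\<mu>)" for \<epsilon> x
  have vv: "bounded_pair (\<lambda>x y. v x)"
    by (intro bounded_pair_continuous continuous_on_compose2[OF v] continuous_intros) auto
  have aa: "bounded_pair (\<lambda>x y. a x)"
    by (intro bounded_pair_continuous continuous_on_compose2[OF a] continuous_intros) auto
  have int1: "integrable \<mu> g" if g: "bounded_pair (\<lambda>x y. g x)" for g
  proof -
    have "bounded_pair (\<lambda>x y. g y)" by (rule bounded_pair_swap[OF g])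
    from partial_integrable[OF this, of 0] show ?thesis by simp
  qed
  obtain F where F: "\<And>p. p \<in> box2 \<Longrightarrow> \<bar>f (fst p)\<bar> \<le> F" using f by (auto simp: bounded_pair_def)
  then have F': "\<bar>f x\<bar> \<le> F" if "x \<in> {0..2 * pi}" for x using F[of "(x, x)"] that by (simp add: mem_box2)
  have F0: "F \<ge> 0" using F'[of 0] by auto
  have "((\<lambda>\<epsilon>. \<integral>x. f x * A \<epsilon> x \<partial>\<mu>) \<longlongrightarrow> (\<integral>x. a x * f x \<partial>\<mu>)) (at_right 0)"
  proof (rule tendstoI)
    fix e :: real assume e: "e > 0"
    define e' where "e' = e / (2 * (F * M + 1))"
    have FM: "0 \<le> F * M" using F0 by simp
    have e': "e' > 0" using e FM by (simp add: e'_def)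
    from lim have "\<forall>\<^sub>F \<epsilon> in at_right 0. \<forall>x\<in>UNIV. dist (A \<epsilon> x) (a x) < e'"
      unfolding A_def by (rule uniform_limitD) (rule e')
    moreover have "\<forall>\<^sub>F \<epsilon> in at_right 0. (0::real) < \<epsilon>" by (rule eventually_at_right_less)
    ultimately show "\<forall>\<^sub>F \<epsilon> in at_right 0. dist (\<integral>x. f x * A \<epsilon> x \<partial>\<mu>) (\<integral>x. a x * f x \<partial>\<mu>) < e"
    proof eventually_elim
      case (elim \<epsilon>)
      have "bounded_pair (\<lambda>x y. v y + (- 1) * v x)" by (intro bounded_pair_add bounded_pair_cmult vv bounded_pair_swap[OF vv])
      then have kv: "bounded_pair (\<lambda>x y. truncated_kernel \<phi> \<epsilon> x y * (v y - v x))"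
        using bounded_pair_mult[OF bounded_pair_truncated_kernel[OF cont elim(2)]] by simp
      have AA: "bounded_pair (\<lambda>x y. A \<epsilon> x)" unfolding A_def by (rule bounded_pair_partial_integral[OF kv])
      have i1: "integrable \<mu> (\<lambda>x. f x * A \<epsilon> x)" "integrable \<mu> (\<lambda>x. a x * f x)"
        by (intro int1 bounded_pair_mult f AA aa)+
      have "(\<integral>x. f x * A \<epsilon> x \<partial>\<mu>) - (\<integral>x. a x * f x \<partial>\<mu>) = (\<integral>x. f x * A \<epsilon> x - a x * f x \<partial>\<mu>)"
        using i1 by (rule Bochner_Integration.integral_diff[symmetric])
      also have "\<bar>\<dots>\<bar> \<le> (F * e') * M"
      proof (rule abs_integral_le)
        show "integrable \<mu> (\<lambda>x. f x * A \<epsilon> x - a x * f x)" using i1 by (rule Bochner_Integration.integrable_diff)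
        fix x assume x: "x \<in> {0..2 * pi}"
        have "\<bar>f x * A \<epsilon> x - a x * f x\<bar> = \<bar>f x\<bar> * \<bar>A \<epsilon> x - a x\<bar>" by (simp add: abs_mult[symmetric] algebra_simps)
        also have "\<dots> \<le> F * e'" using F'[OF x] elim(1) F0
          by (intro mult_mono) (auto simp: dist_real_def intro: less_imp_le)
        finally show "\<bar>f x * A \<epsilon> x - a x * f x\<bar> \<le> F * e'" .
      qed
      also have "(F * e') * M = (F * M) * e / (2 * (F * M + 1))" by (simp add: e'_def)
      also have "\<dots> < e"
      proof -
        have "0 \<le> (F * M) * e" using FM e by simp
        then have "(F * M) * e < e * (2 * (F * M + 1))" using e by (simp add: algebra_simps)
        then show ?thesis using FM by (subst pos_divide_less_eq) auto
      qed
      finally show ?case by (simp add: dist_real_def)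
    qed
  qed
  then have "((\<lambda>\<epsilon>. 2 * (\<integral>x. f x * A \<epsilon> x \<partial>\<mu>)) \<longlongrightarrow> 2 * (\<integral>x. a x * f x \<partial>\<mu>)) (at_right 0)"
    by (intro tendsto_intros)
  then show ?thesis
  proof (rule tendsto_cong[THEN iffD1, rotated])
    show "\<forall>\<^sub>F \<epsilon> in at_right 0. 2 * (\<integral>x. f x * A \<epsilon> x \<partial>\<mu>) = pair_integral (\<lambda>x y. truncated_kernel \<phi> \<epsilon> x y * (v y - v x) * (f x - f y))"
      using eventually_at_right_less[of 0]
    proof eventually_elim
      case (elim \<epsilon>)
      show ?case unfolding A_def
        by (rule alignment_symmetrized[OF bounded_pair_truncated_kernel[OF cont elim] truncated_kernel_sym f vv])
    qed
  qed
qed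

end

text \<open>A mass distribution \<open>\<mu>\<close> at a fixed time, with a velocity \<open>v\<close> and an acceleration \<open>a\<close> that is the uniform limit
  of the truncated alignment forces.\<close>

locale circle_alignment = circle_mass \<mu> for \<mu> :: "real measure" +
  fixes \<phi> :: "real \<Rightarrow> real" and v a :: "real \<Rightarrow> real"
  assumes kernel_cont: "continuous_on {0<..} \<phi>"
    and kernel_nonneg: "\<And>r. r > 0 \<Longrightarrow> \<phi> r \<ge> 0"
    and v_cont: "continuous_on UNIV v" and v_per: "\<And>x. v (x + 2 * pi) = v x"
    and a_cont: "continuous_on UNIV a"
    and a_lim: "uniform_limit UNIV (\<lambda>\<epsilon> x. \<integral>y. truncated_kernel \<phi> \<epsilon> x y * (v y - v x) \<partial>\<mu>) a (at_right 0)"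
begin

lemma v_eq_if_torus_dist_0:
  assumes "torus_dist x y = 0" shows "v x = v y"
proof -
  obtain k :: int where "torus_dist x y = \<bar>x - y + 2 * pi * of_int k\<bar>" using torus_dist_witness by blast
  with assms have "y = x + 2 * pi * of_int k" by simp
  then show ?thesis using periodic_int[of v x k, OF v_per] by simp
qed

lemma v_continuous_compose: "continuous_on S p \<Longrightarrow> continuous_on S (\<lambda>s. v (p s))"
  by (rule continuous_on_compose2[OF v_cont]) auto

lemma a_continuous_compose: "continuous_on S p \<Longrightarrow> continuous_on S (\<lambda>s. a (p s))"
  by (rule continuous_on_compose2[OF a_cont]) auto

lemma bounded_pair_square: "bounded_pair (\<lambda>x y. (v x - v y)\<^sup>2)"
  by (intro bounded_pair_continuous continuous_intros v_continuous_compose)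

text \<open>The acceleration, tested against an antisymmetric weight \<open>\<beta>\<close>, is the limit of symmetrised truncations.\<close>

lemma pair_limit:
  assumes \<beta>: "continuous_on UNIV (\<lambda>p. \<beta> (fst p) (snd p))" "\<And>x y. \<beta> y x = - \<beta> x y"
  shows "((\<lambda>\<epsilon>. pair_integral (\<lambda>x y. truncated_kernel \<phi> \<epsilon> x y * (v y - v x) * ((\<integral>z. \<beta> x z \<partial>\<mu>) - (\<integral>z. \<beta> y z \<partial>\<mu>))))
    \<longlongrightarrow> pair_integral (\<lambda>x y. \<beta> x y * (a x - a y))) (at_right 0)"
proof -
  have a: "bounded_pair (\<lambda>x y. a x)" by (intro bounded_pair_continuous continuous_intros a_continuous_compose)
  show ?thesis
    unfolding pair_integral_antisym[OF bounded_pair_continuous[OF \<beta>(1)] \<beta>(2) a]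
    by (rule alignment_limit[OF kernel_cont bounded_pair_partial_integral[OF bounded_pair_continuous[OF \<beta>(1)]] v_cont a_cont a_lim])
qed

text \<open>The dissipation at distances greater than \<open>\<epsilon>\<close>, and, for positive mass, its limit \<open>J\<close> as \<open>\<epsilon>\<close> tends to \<open>0\<close>. The limit is
  expressed by the rate of change of the variation, so that it needs no integrability of the full integrand.\<close>

definition truncated_dissipation where "truncated_dissipation \<epsilon> = pair_integral (\<lambda>x y. truncated_kernel \<phi> \<epsilon> x y * (v x - v y)\<^sup>2)"

definition J where "J = - pair_integral (\<lambda>x y. 2 * (v x - v y) * (a x - a y)) / (2 * M)"

lemma truncated_dissipation_tendsto:
  assumes M: "M > 0" shows "(truncated_dissipation \<longlongrightarrow> J) (at_right 0)"
proof -
  have int_v: "integrable \<mu> v"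
  proof -
    have "bounded_pair (\<lambda>x y. v y)" by (intro bounded_pair_continuous v_continuous_compose continuous_intros)
    from partial_integrable[OF this, of 0] show ?thesis by simp
  qed
  have diff: "(\<integral>z. 2 * (v x - v z) \<partial>\<mu>) = 2 * M * v x - 2 * (\<integral>z. v z \<partial>\<mu>)" for x
    using int_v by (simp add: space_\<mu> algebra_simps)
  have "((\<lambda>\<epsilon>. pair_integral (\<lambda>x y. truncated_kernel \<phi> \<epsilon> x y * (v y - v x) *
      ((\<integral>z. 2 * (v x - v z) \<partial>\<mu>) - (\<integral>z. 2 * (v y - v z) \<partial>\<mu>))))
    \<longlongrightarrow> pair_integral (\<lambda>x y. 2 * (v x - v y) * (a x - a y))) (at_right 0)"
    by (rule pair_limit) (auto intro!: continuous_intros v_continuous_compose)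
  also have "(\<lambda>\<epsilon>. pair_integral (\<lambda>x y. truncated_kernel \<phi> \<epsilon> x y * (v y - v x) *
      ((\<integral>z. 2 * (v x - v z) \<partial>\<mu>) - (\<integral>z. 2 * (v y - v z) \<partial>\<mu>)))) = (\<lambda>\<epsilon>. - (2 * M) * truncated_dissipation \<epsilon>)"
    unfolding diff truncated_dissipation_def pair_integral_cmult[symmetric]
    by (intro ext arg_cong[of _ _ pair_integral]) (simp add: power2_eq_square algebra_simps)
  finally have "((\<lambda>\<epsilon>. - (2 * M) * truncated_dissipation \<epsilon> / (- (2 * M))) \<longlongrightarrow> pair_integral (\<lambda>x y. 2 * (v x - v y) * (a x - a y)) / (- (2 * M))) (at_right 0)"
    using M by (intro tendsto_divide tendsto_const) auto
  then show ?thesis using M by (simp add: J_def)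
qed

lemma bounded_pair_kernel_mult: "\<epsilon> > 0 \<Longrightarrow> bounded_pair g \<Longrightarrow> bounded_pair (\<lambda>x y. truncated_kernel \<phi> \<epsilon> x y * g x y)"
  by (intro bounded_pair_mult bounded_pair_truncated_kernel kernel_cont)

lemma truncated_dissipation_le:
  assumes M: "M > 0" and \<epsilon>: "\<epsilon> > 0" shows "truncated_dissipation \<epsilon> \<le> J"
proof (rule tendsto_lowerbound[OF truncated_dissipation_tendsto[OF M]])
  have "\<forall>\<^sub>F e in at_right 0. e \<in> {0<..<\<epsilon>}" using \<epsilon> by (rule eventually_at_right_real)
  then show "\<forall>\<^sub>F e in at_right 0. truncated_dissipation \<epsilon> \<le> truncated_dissipation e"
  proof eventually_elim
    case (elim e)
    show ?case unfolding truncated_dissipation_def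
    proof (rule pair_integral_mono)
      fix x y
      show "truncated_kernel \<phi> \<epsilon> x y * (v x - v y)\<^sup>2 \<le> truncated_kernel \<phi> e x y * (v x - v y)\<^sup>2"
        using elim kernel_nonneg[of "torus_dist x y"] by (intro mult_right_mono) (auto simp: truncated_kernel_def)
    qed (use elim \<epsilon> bounded_pair_square in \<open>auto intro: bounded_pair_kernel_mult\<close>)
  qed
qed simp

lemma J_nonneg: assumes "M > 0" shows "J \<ge> 0"
proof -
  have z: "bounded_pair (\<lambda>x y. 0)" by (intro bounded_pair_continuous continuous_intros)
  have "0 \<le> truncated_dissipation 1" unfolding truncated_dissipation_def
    using pair_integral_mono[OF z bounded_pair_kernel_mult[OF zero_less_one bounded_pair_square]]
      truncated_kernel_nonneg[OF kernel_nonneg zero_less_one] pair_integral_const[where c = 0]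
    by simp
  then show ?thesis using truncated_dissipation_le[OF assms, of 1] by simp
qed

text \<open>As \<open>truncated_dissipation \<epsilon> \<le> J\<close> for every \<open>\<epsilon>\<close>, the limit \<open>J\<close> dominates integrals over all distances.\<close>

lemma pair_integral_le_J:
  assumes M: "M > 0" and g: "bounded_pair g" and c: "c \<ge> 0"
    and zero: "\<And>x y. torus_dist x y = 0 \<Longrightarrow> g x y = 0"
    and le: "\<And>x y. torus_dist x y > 0 \<Longrightarrow> g x y \<le> c * (\<phi> (torus_dist x y) * (v x - v y)\<^sup>2)"
  shows "pair_integral g \<le> c * J"
proof -
  define h where "h n x y = truncated_kernel (\<lambda>_. 1) (1 / real (Suc n)) x y * g x y" for n x y
  have bounded_pair_h: "bounded_pair (h n)" for n
    unfolding h_def by (intro bounded_pair_mult bounded_pair_truncated_kernel g continuous_intros) simp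
  have pair_integral_h: "pair_integral (h n) \<le> c * J" for n
  proof -
    have "pair_integral (h n) \<le> pair_integral (\<lambda>x y. c * (truncated_kernel \<phi> (1 / real (Suc n)) x y * (v x - v y)\<^sup>2))"
    proof (rule pair_integral_mono[OF bounded_pair_h])
      show "bounded_pair (\<lambda>x y. c * (truncated_kernel \<phi> (1 / real (Suc n)) x y * (v x - v y)\<^sup>2))"
        by (intro bounded_pair_cmult bounded_pair_kernel_mult bounded_pair_square) simp
      fix x y
      have n: "0 < 1 / real (Suc n)" by simp
      show "h n x y \<le> c * (truncated_kernel \<phi> (1 / real (Suc n)) x y * (v x - v y)\<^sup>2)"
        using le[of x y] less_trans[OF n, of "torus_dist x y"] by (auto simp: h_def truncated_kernel_def)
    qed
    also have "\<dots> = c * truncated_dissipation (1 / real (Suc n))" by (simp add: pair_integral_cmult truncated_dissipation_def)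
    also have "\<dots> \<le> c * J" using truncated_dissipation_le[OF M] c by (intro mult_left_mono) auto
    finally show ?thesis .
  qed
  have "(\<lambda>n. pair_integral (h n)) \<longlonglongrightarrow> pair_integral g"
    unfolding pair_integral_def
  proof (rule integral_dominated_convergence[where w = "\<lambda>p. \<bar>g (fst p) (snd p)\<bar>"])
    show "AE p in \<mu> \<Otimes>\<^sub>M \<mu>. (\<lambda>n. h n (fst p) (snd p)) \<longlonglongrightarrow> g (fst p) (snd p)"
    proof (rule AE_I2)
      fix p :: "real \<times> real"
      show "(\<lambda>n. h n (fst p) (snd p)) \<longlonglongrightarrow> g (fst p) (snd p)"
      proof (cases "torus_dist (fst p) (snd p) = 0")
        case True
        then show ?thesis using zero by (simp add: h_def)
      next
        case False
        then have pos: "torus_dist (fst p) (snd p) > 0" using torus_dist_bounds(1)[of "fst p" "snd p"] by simp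
        then have "\<forall>\<^sub>F n in sequentially. 1 / real (Suc n) < torus_dist (fst p) (snd p)"
          using order_tendstoD(2)[OF LIMSEQ_Suc[OF lim_1_over_n]] by simp
        then have "\<forall>\<^sub>F n in sequentially. h n (fst p) (snd p) = g (fst p) (snd p)"
          by eventually_elim (simp add: h_def truncated_kernel_def)
        then show ?thesis by (rule tendsto_eventually)
      qed
    qed
    show "AE p in \<mu> \<Otimes>\<^sub>M \<mu>. norm (h n (fst p) (snd p)) \<le> \<bar>g (fst p) (snd p)\<bar>" for n
      by (intro AE_I2) (simp add: h_def truncated_kernel_def)
  qed (use bounded_pair_measurable[OF g] bounded_pair_measurable[OF bounded_pair_h] bounded_pair_integrable[OF g] in auto)
  then show ?thesis by (rule LIMSEQ_le_const2) (use pair_integral_h in auto)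
qed

lemma corrector_alignment_le:
  assumes M: "M > 0" and \<psi>: "continuous_on UNIV \<psi>" "\<And>z. \<psi> (- z) = - \<psi> z"
    and lip: "\<And>x y z. \<bar>\<psi> (x - z) - \<psi> (y - z)\<bar> \<le> \<Lambda> * torus_dist x y"
    and D: "\<And>\<epsilon>. \<epsilon> > 0 \<Longrightarrow> pair_integral (\<lambda>x y. truncated_kernel \<phi> \<epsilon> x y * (torus_dist x y)\<^sup>2) \<le> D"
    and \<Lambda>: "\<Lambda> \<ge> 0" and \<tau>: "\<tau> > 0"
  shows "pair_integral (\<lambda>x y. \<psi> (x - y) * (a x - a y)) \<le> \<Lambda> * M * (\<tau> * J + D / (4 * \<tau>))"
proof -
  have c\<psi>: "continuous_on UNIV (\<lambda>p::real \<times> real. \<psi> (fst p - snd p))"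
    by (intro continuous_on_compose2[OF \<psi>(1)] continuous_intros) auto
  define f where "f x = (\<integral>z. \<psi> (x - z) \<partial>\<mu>)" for x
  have int_\<psi>: "integrable \<mu> (\<lambda>z. \<psi> (x - z))" for x
  proof -
    have "continuous_on UNIV (\<lambda>p::real \<times> real. \<psi> (x - snd p))"
      by (intro continuous_on_compose2[OF \<psi>(1)] continuous_intros) auto
    from partial_integrable[OF bounded_pair_continuous[of "\<lambda>_ z. \<psi> (x - z)"], of 0] this show ?thesis by simp
  qed
  have f_lip: "\<bar>f x - f y\<bar> \<le> \<Lambda> * M * torus_dist x y" for x y
  proof -
    have "f x - f y = (\<integral>z. \<psi> (x - z) - \<psi> (y - z) \<partial>\<mu>)"
      unfolding f_def using int_\<psi> by (intro Bochner_Integration.integral_diff[symmetric])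
    also have "\<bar>\<dots>\<bar> \<le> (\<Lambda> * torus_dist x y) * M"
      using int_\<psi> lip by (intro abs_integral_le) auto
    finally show ?thesis by (simp add: mult_ac)
  qed
  have bounded_pair_f: "bounded_pair (\<lambda>x y. f x)" unfolding f_def by (rule bounded_pair_partial_integral[OF bounded_pair_continuous[OF c\<psi>]])
  have lim: "((\<lambda>\<epsilon>. pair_integral (\<lambda>x y. truncated_kernel \<phi> \<epsilon> x y * (v y - v x) * (f x - f y)))
    \<longlongrightarrow> pair_integral (\<lambda>x y. \<psi> (x - y) * (a x - a y))) (at_right 0)"
    unfolding f_def
  proof (rule pair_limit[OF c\<psi>])
    show "\<psi> (y - x) = - \<psi> (x - y)" for x y using \<psi>(2)[of "x - y"] by simp
  qed
  show ?thesis
  proof (rule tendsto_upperbound[OF lim])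
    show "\<forall>\<^sub>F \<epsilon> in at_right 0. pair_integral (\<lambda>x y. truncated_kernel \<phi> \<epsilon> x y * (v y - v x) * (f x - f y)) \<le> \<Lambda> * M * (\<tau> * J + D / (4 * \<tau>))"
      using eventually_at_right_less[of 0]
    proof eventually_elim
      case (elim \<epsilon>)
      let ?k = "truncated_kernel \<phi> \<epsilon>"
      have dist2: "bounded_pair (\<lambda>x y. (torus_dist x y)\<^sup>2)" by (intro bounded_pair_continuous continuous_intros)
      have a1: "bounded_pair (\<lambda>x y. \<Lambda> * M * (\<tau> * (?k x y * (v x - v y)\<^sup>2)))"
        by (intro bounded_pair_cmult bounded_pair_kernel_mult elim bounded_pair_square)
      have a2: "bounded_pair (\<lambda>x y. \<Lambda> * M * (1 / (4 * \<tau>) * (?k x y * (torus_dist x y)\<^sup>2)))"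
        by (intro bounded_pair_cmult bounded_pair_kernel_mult elim dist2)
      have "bounded_pair (\<lambda>x y. f x + (- 1) * f y)" by (intro bounded_pair_add bounded_pair_cmult bounded_pair_f bounded_pair_swap[OF bounded_pair_f])
      then have af: "bounded_pair (\<lambda>x y. f x - f y)" by simp
      have av: "bounded_pair (\<lambda>x y. v y - v x)" by (intro bounded_pair_continuous continuous_intros v_continuous_compose)
      have "pair_integral (\<lambda>x y. ?k x y * (v y - v x) * (f x - f y))
        \<le> pair_integral (\<lambda>x y. \<Lambda> * M * (\<tau> * (?k x y * (v x - v y)\<^sup>2)) + \<Lambda> * M * (1 / (4 * \<tau>) * (?k x y * (torus_dist x y)\<^sup>2)))"
      proof (rule pair_integral_mono)
        show "bounded_pair (\<lambda>x y. ?k x y * (v y - v x) * (f x - f y))"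
          by (intro bounded_pair_mult af av bounded_pair_truncated_kernel kernel_cont elim)
        show "bounded_pair (\<lambda>x y. \<Lambda> * M * (\<tau> * (?k x y * (v x - v y)\<^sup>2)) + \<Lambda> * M * (1 / (4 * \<tau>) * (?k x y * (torus_dist x y)\<^sup>2)))"
          by (intro bounded_pair_add a1 a2)
        fix x y
        have k: "0 \<le> ?k x y" by (rule truncated_kernel_nonneg[OF kernel_nonneg elim])
        have LM: "0 \<le> \<Lambda> * M" using \<Lambda> M by simp
        have "(v y - v x) * (f x - f y) \<le> \<bar>v x - v y\<bar> * (\<Lambda> * M * torus_dist x y)"
        proof -
          have "(v y - v x) * (f x - f y) \<le> \<bar>v x - v y\<bar> * \<bar>f x - f y\<bar>"
            by (metis abs_ge_self abs_minus_commute abs_mult)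
          also have "\<dots> \<le> \<bar>v x - v y\<bar> * (\<Lambda> * M * torus_dist x y)" by (intro mult_left_mono f_lip) simp
          finally show ?thesis .
        qed
        also have "\<dots> = \<Lambda> * M * (\<bar>v x - v y\<bar> * torus_dist x y)" by simp
        also have "\<dots> \<le> \<Lambda> * M * (\<tau> * (v x - v y)\<^sup>2 + (torus_dist x y)\<^sup>2 / (4 * \<tau>))"
          using young[OF \<tau>, of "\<bar>v x - v y\<bar>" "torus_dist x y"] LM by (intro mult_left_mono) auto
        finally have "?k x y * ((v y - v x) * (f x - f y)) \<le> ?k x y * (\<Lambda> * M * (\<tau> * (v x - v y)\<^sup>2 + (torus_dist x y)\<^sup>2 / (4 * \<tau>)))"
          using k by (intro mult_left_mono)
        then show "?k x y * (v y - v x) * (f x - f y)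
          \<le> \<Lambda> * M * (\<tau> * (?k x y * (v x - v y)\<^sup>2)) + \<Lambda> * M * (1 / (4 * \<tau>) * (?k x y * (torus_dist x y)\<^sup>2))"
          by (simp add: algebra_simps)
      qed
      also have "\<dots> = \<Lambda> * M * (\<tau> * truncated_dissipation \<epsilon>) + \<Lambda> * M * (1 / (4 * \<tau>) * pair_integral (\<lambda>x y. ?k x y * (torus_dist x y)\<^sup>2))"
        unfolding pair_integral_add[OF a1 a2] pair_integral_cmult truncated_dissipation_def ..
      also have "\<dots> \<le> \<Lambda> * M * (\<tau> * J) + \<Lambda> * M * (1 / (4 * \<tau>) * D)"
        using \<Lambda> M \<tau> truncated_dissipation_le[OF M elim] D[OF elim] by (intro add_mono mult_left_mono) auto
      finally show ?case by (simp add: algebra_simps)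
    qed
  qed simp
qed

lemma corrector_transport_le:
  assumes M: "M > 0" and K: "K \<ge> 0" and g: "continuous_on UNIV g"
    and g_le: "\<And>z. g z \<le> - 1 + K * (if cos z = 1 then 0 else \<phi> (arccos (cos z)))"
  shows "pair_integral (\<lambda>x y. g (x - y) * (v x - v y) * (v x - v y)) \<le> - pair_integral (\<lambda>x y. (v x - v y)\<^sup>2) + K * J"
proof -
  define h where "h x y = max 0 (g (x - y) + 1) * (v x - v y)\<^sup>2" for x y
  have cg: "continuous_on UNIV (\<lambda>p::real \<times> real. g (fst p - snd p))"
    by (intro continuous_on_compose2[OF g] continuous_intros) auto
  have bounded_pair_h: "bounded_pair h" unfolding h_def by (intro bounded_pair_continuous continuous_intros cg v_continuous_compose)
  have neg: "bounded_pair (\<lambda>x y. - 1 * (v x - v y)\<^sup>2)" by (intro bounded_pair_cmult bounded_pair_square)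
  have "pair_integral (\<lambda>x y. g (x - y) * (v x - v y) * (v x - v y)) \<le> pair_integral (\<lambda>x y. - 1 * (v x - v y)\<^sup>2 + h x y)"
  proof (rule pair_integral_mono)
    show "bounded_pair (\<lambda>x y. g (x - y) * (v x - v y) * (v x - v y))"
      by (intro bounded_pair_continuous continuous_intros cg v_continuous_compose)
    show "bounded_pair (\<lambda>x y. - 1 * (v x - v y)\<^sup>2 + h x y)" by (intro bounded_pair_add neg bounded_pair_h)
    fix x y
    have "g (x - y) * (v x - v y)\<^sup>2 \<le> (- 1 + max 0 (g (x - y) + 1)) * (v x - v y)\<^sup>2"
      by (intro mult_right_mono) auto
    then show "g (x - y) * (v x - v y) * (v x - v y) \<le> - 1 * (v x - v y)\<^sup>2 + h x y"
      by (simp add: h_def power2_eq_square algebra_simps)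
  qed
  also have "\<dots> = - pair_integral (\<lambda>x y. (v x - v y)\<^sup>2) + pair_integral h"
    unfolding pair_integral_add[OF neg bounded_pair_h] pair_integral_cmult by simp
  also have "pair_integral h \<le> K * J"
  proof (rule pair_integral_le_J[OF M bounded_pair_h K])
    show "h x y = 0" if "torus_dist x y = 0" for x y
      using v_eq_if_torus_dist_0[OF that] by (simp add: h_def)
    fix x y assume d: "torus_dist x y > 0"
    then have "cos (x - y) \<noteq> 1" using torus_dist_eq_0_iff[of x y] by simp
    then have "max 0 (g (x - y) + 1) \<le> K * \<phi> (torus_dist x y)"
      using g_le[of "x - y"] K kernel_nonneg[OF d] by (simp add: torus_dist_eq)
    from mult_right_mono[OF this, of "(v x - v y)\<^sup>2"]
    show "h x y \<le> K * (\<phi> (torus_dist x y) * (v x - v y)\<^sup>2)" by (simp add: h_def mult.assoc)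
  qed
  finally show ?thesis by simp
qed

end

section \<open>Mass density\<close>

text \<open>The measure with density \<open>r\<close> on \<open>[0, 2\<pi>]\<close>.\<close>

definition mass_measure :: "(real \<Rightarrow> real) \<Rightarrow> real measure" where
  "mass_measure r = density lborel (\<lambda>x. ennreal (indicator {0..2 * pi} x * r x))"

lemma mass_measure_integral:
  fixes f :: "real \<Rightarrow> real"
  assumes r: "continuous_on UNIV r" "\<And>x. r x \<ge> 0" and f: "f \<in> borel_measurable borel"
  shows "(\<integral>x. f x \<partial>mass_measure r) = (LINT x:{0..2 * pi}|lborel. f x * r x)"
proof -
  have [measurable]: "r \<in> borel_measurable borel" using r(1) by (rule borel_measurable_continuous_onI)
  have [measurable]: "f \<in> borel_measurable borel" by (rule f)
  show ?thesis
    unfolding mass_measure_def set_lebesgue_integral_def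
    by (subst integral_density) (auto simp: r(2) mult_ac)
qed

lemma mass_measure_integral_continuous:
  fixes f :: "real \<Rightarrow> real"
  assumes r: "continuous_on UNIV r" "\<And>x. r x \<ge> 0" and f: "continuous_on UNIV f"
  shows "(\<integral>x. f x \<partial>mass_measure r) = integral {0..2 * pi} (\<lambda>x. f x * r x)"
proof -
  have "continuous_on {0..2 * pi} (\<lambda>x. f x * r x)"
    by (intro continuous_intros continuous_on_subset[OF f] continuous_on_subset[OF r(1)]) auto
  then have "set_integrable lborel {0..2 * pi} (\<lambda>x. f x * r x)" by (rule borel_integrable_atLeastAtMost')
  then show ?thesis
    unfolding mass_measure_integral[OF r borel_measurable_continuous_onI[OF f]]
    by (rule set_borel_integral_eq_integral(2))
qed

lemma circle_mass_mass_measure: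
  assumes r: "continuous_on UNIV r" "\<And>x. r x \<ge> 0"
  shows "circle_mass (mass_measure r)"
proof (intro circle_mass.intro finite_measureI circle_mass_axioms.intro)
  have [measurable]: "r \<in> borel_measurable borel" using r(1) by (rule borel_measurable_continuous_onI)
  have "set_integrable lborel {0..2 * pi} r"
    by (intro borel_integrable_atLeastAtMost' continuous_on_subset[OF r(1)]) auto
  then have int: "integrable lborel (\<lambda>x. indicator {0..2 * pi} x * r x)"
    by (simp add: set_integrable_def)
  have "emeasure (mass_measure r) (space (mass_measure r)) = (\<integral>\<^sup>+x. ennreal (indicator {0..2 * pi} x * r x) \<partial>lborel)"
    unfolding mass_measure_def by (subst emeasure_density) (auto intro!: nn_integral_cong)
  also have "\<dots> = ennreal (\<integral>x. indicator {0..2 * pi} x * r x \<partial>lborel)"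
    by (rule nn_integral_eq_integral[OF int]) (auto simp: r(2))
  finally show "emeasure (mass_measure r) (space (mass_measure r)) \<noteq> \<infinity>" by simp
  show "sets (mass_measure r) = sets borel" by (simp add: mass_measure_def)
  show "AE x in mass_measure r. x \<in> {0..2 * pi}"
    unfolding mass_measure_def by (subst AE_density) (auto simp: indicator_def intro!: AE_I2)
qed

lemma pair_integral_mass_measure:
  assumes r: "continuous_on UNIV r" "\<And>x. r x \<ge> 0"
    and f: "continuous_on UNIV (\<lambda>p. f (fst p) (snd p))"
  shows "circle_mass.pair_integral (mass_measure r) f = integral box2 (\<lambda>(x, y). f x y * r x * r y)"
proof -
  interpret circle_mass "mass_measure r" by (rule circle_mass_mass_measure[OF r])
  have fx: "continuous_on UNIV (f x)" for x
  proof -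
    have "continuous_on UNIV (\<lambda>y::real. (x, y))" by (intro continuous_intros)
    from continuous_on_compose2[OF f this] show ?thesis by simp
  qed
  have rS: "continuous_on S (\<lambda>s. r (p s))" if "continuous_on S p" for S :: "(real \<times> real) set" and p
    by (rule continuous_on_compose2[OF r(1) that]) auto
  have c2: "continuous_on UNIV (\<lambda>(x, y). f x y * r y)"
    unfolding split_beta' by (intro continuous_intros f rS)
  define h where "h x = integral {0..2 * pi} (\<lambda>y. f x y * r y)" for x
  have h: "continuous_on UNIV h"
  proof -
    have "continuous_on (UNIV \<times> cbox 0 (2 * pi)) (\<lambda>(x, y). f x y * r y)"
      by (rule continuous_on_subset[OF c2]) auto
    from integral_continuous_on_param[OF this] show ?thesis by (simp add: h_def)
  qed
  have "pair_integral f = (\<integral>x. \<integral>y. f x y \<partial>mass_measure r \<partial>mass_measure r)" by (rule pair_integral_iterated[OF bounded_pair_continuous[OF f]])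
  also have "\<dots> = (\<integral>x. h x \<partial>mass_measure r)"
    by (simp add: mass_measure_integral_continuous[OF r fx] h_def)
  also have "\<dots> = integral {0..2 * pi} (\<lambda>x. h x * r x)" by (rule mass_measure_integral_continuous[OF r h])
  also have "\<dots> = integral {0..2 * pi} (\<lambda>x. integral {0..2 * pi} (\<lambda>y. f x y * r x * r y))"
    unfolding h_def by (simp add: integral_mult_left[symmetric] mult_ac)
  also have "\<dots> = integral box2 (\<lambda>(x, y). f x y * r x * r y)"
  proof -
    have "continuous_on box2 (\<lambda>(x, y). f x y * r x * r y)"
      unfolding split_beta'
      by (intro continuous_intros rS continuous_on_subset[OF f]) auto
    from integral_prod_continuous[OF this] show ?thesis by simp
  qed
  finally show ?thesis .
qed

lemma truncated_alignment_eq: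
  assumes r: "continuous_on UNIV r" "\<And>x. r x \<ge> 0" and u: "continuous_on UNIV u"
    and \<phi>: "continuous_on {0<..} \<phi>" and \<epsilon>: "\<epsilon> > 0"
  shows "truncated_alignment \<phi> r u \<epsilon> x = (\<integral>y. truncated_kernel \<phi> \<epsilon> x y * (u y - u x) \<partial>mass_measure r)"
proof -
  have [measurable]: "u \<in> borel_measurable borel" using u by (rule borel_measurable_continuous_onI)
  have "(\<lambda>y. truncated_kernel \<phi> \<epsilon> x y) \<in> borel_measurable borel"
    using measurable_compose[OF measurable_Pair1'[of x borel borel] truncated_kernel_measurable[OF \<phi> \<epsilon>]] by simp
  then have m: "(\<lambda>y. truncated_kernel \<phi> \<epsilon> x y * (u y - u x)) \<in> borel_measurable borel" by measurable
  show ?thesis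
    unfolding mass_measure_integral[OF r m] truncated_alignment_def set_lebesgue_integral_def
    by (intro Bochner_Integration.integral_cong) (auto simp: indicator_def truncated_kernel_def)
qed

lemma hydro_variation_eq:
  assumes r: "continuous_on UNIV r" and u: "continuous_on UNIV u"
  shows "hydro_variation r u = integral box2 (\<lambda>(x, y). 1 * (u x - u y)\<^sup>2 * r x * r y)"
proof -
  have rS: "continuous_on S (\<lambda>s. r (p s))" if "continuous_on S p" for S :: "(real \<times> real) set" and p
    by (rule continuous_on_compose2[OF r that]) auto
  have uS: "continuous_on S (\<lambda>s. u (p s))" if "continuous_on S p" for S :: "(real \<times> real) set" and p
    by (rule continuous_on_compose2[OF u that]) auto
  have box: "{0..2 * pi} \<times> {0..2 * pi} = box2" by (auto simp: mem_box2)
  have "set_integrable lborel box2 (\<lambda>p. \<bar>u (fst p) - u (snd p)\<bar>\<^sup>2 * r (fst p) * r (snd p))"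
    unfolding set_integrable_def
    by (intro borel_integrable_compact compact_cbox continuous_intros rS uS)
  from set_borel_integral_eq_integral(2)[OF this]
  show ?thesis unfolding hydro_variation_def box by (simp add: split_beta')
qed

section \<open>Strong solutions of the Euler alignment system\<close>

text \<open>A strong solution of the Euler alignment system. At time \<open>t\<close>, \<open>\<mu> t\<close> is the mass distribution, \<open>M t\<close> its total mass,
  \<open>a t\<close> the acceleration, \<open>J t\<close> the dissipation and \<open>V t\<close> the variation; \<open>I t\<close> integrates over pairs of points
  against \<open>\<mu> t\<close>.\<close>

locale euler_flow =
  fixes \<phi> :: "real \<Rightarrow> real" and \<rho> v :: "real \<Rightarrow> real \<Rightarrow> real"
  assumes sol: "euler_alignment_solution \<phi> \<rho> v"
    and kernel_cont: "continuous_on {0<..} \<phi>"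
    and kernel_nonneg: "\<And>r. r > 0 \<Longrightarrow> \<phi> r \<ge> 0"
begin

lemma fields: "C1_field \<rho>" "C1_field v"
  and rho_nonneg: "t \<ge> 0 \<Longrightarrow> \<rho> x t \<ge> 0"
  and mass_conservation: "t \<ge> 0 \<Longrightarrow> dt \<rho> x t + dx (\<lambda>y s. v y s * \<rho> y s) x t = 0"
  and momentum: "t \<ge> 0 \<Longrightarrow> uniform_limit UNIV
        (\<lambda>\<epsilon> x. truncated_alignment \<phi> (\<lambda>y. \<rho> y t) (\<lambda>y. v y t) \<epsilon> x)
        (\<lambda>x. dt v x t + v x t * dx v x t) (at_right 0)"
  using sol by (auto simp: euler_alignment_solution_def)

definition \<mu> where "\<mu> t = mass_measure (\<lambda>x. \<rho> x t)"

definition a where "a t x = dt v x t + v x t * dx v x t"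

definition I where "I t = circle_mass.pair_integral (\<mu> t)"

definition M where "M t = measure (\<mu> t) UNIV"

definition J where "J t = circle_alignment.J (\<mu> t) (\<lambda>x. v x t) (a t)"

definition V where "V t = hydro_variation (\<lambda>x. \<rho> x t) (\<lambda>x. v x t)"

lemma rho_cont: "t \<ge> 0 \<Longrightarrow> continuous_on UNIV (\<lambda>x. \<rho> x t)"
  and v_cont: "t \<ge> 0 \<Longrightarrow> continuous_on UNIV (\<lambda>x. v x t)"
  and a_cont: "t \<ge> 0 \<Longrightarrow> continuous_on UNIV (a t)"
  unfolding a_def
  by (intro continuous_intros C1_field_continuous_compose[OF fields(1)] C1_field_continuous_compose[OF fields(2)]; simp)+

lemma alignment:
  assumes t: "t \<ge> 0" shows "circle_alignment (\<mu> t) \<phi> (\<lambda>x. v x t) (a t)"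
proof (intro circle_alignment.intro circle_alignment_axioms.intro)
  show "circle_mass (\<mu> t)"
    unfolding \<mu>_def by (rule circle_mass_mass_measure[OF rho_cont[OF t] rho_nonneg[OF t]])
  show "uniform_limit UNIV (\<lambda>\<epsilon> x. \<integral>y. truncated_kernel \<phi> \<epsilon> x y * (v y t - v x t) \<partial>\<mu> t) (a t) (at_right 0)"
  proof (rule uniform_limit_cong[THEN iffD1, OF _ _ momentum[OF t]])
    show "\<forall>\<^sub>F \<epsilon> in at_right 0. \<forall>x\<in>UNIV. truncated_alignment \<phi> (\<lambda>y. \<rho> y t) (\<lambda>y. v y t) \<epsilon> x
        = (\<integral>y. truncated_kernel \<phi> \<epsilon> x y * (v y t - v x t) \<partial>\<mu> t)"
      using eventually_at_right_less[of 0]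
    proof eventually_elim
      case (elim \<epsilon>)
      show ?case unfolding \<mu>_def
        using truncated_alignment_eq[OF rho_cont[OF t] rho_nonneg[OF t] v_cont[OF t] kernel_cont elim] by blast
    qed
  qed (simp add: a_def)
qed (use t kernel_cont kernel_nonneg v_cont a_cont C1_field_periodic[OF fields(2) t] in auto)

lemma I_eq:
  assumes t: "t \<ge> 0" and f: "continuous_on UNIV (\<lambda>p. f (fst p) (snd p))"
  shows "I t f = integral box2 (\<lambda>(x, y). f x y * \<rho> x t * \<rho> y t)"
  unfolding I_def \<mu>_def by (rule pair_integral_mass_measure[OF rho_cont[OF t] rho_nonneg[OF t] f])

lemma I_derivative:
  assumes \<alpha>: "\<And>z. (\<alpha> has_real_derivative \<alpha>' z) (at z)" "continuous_on UNIV \<alpha>'" "\<And>z. \<alpha> (z + 2 * pi) = \<alpha> z"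
    and b: "\<And>w. (b has_real_derivative b' w) (at w)" "continuous_on UNIV b'"
    and t: "t \<ge> 0"
  shows "((\<lambda>t. I t (\<lambda>x y. \<alpha> (x - y) * b (v x t - v y t))) has_real_derivative
     I t (\<lambda>x y. \<alpha>' (x - y) * (v x t - v y t) * b (v x t - v y t))
     + I t (\<lambda>x y. \<alpha> (x - y) * b' (v x t - v y t) * (a t x - a t y))) (at t within {0..})"
proof -
  have c\<alpha>: "continuous_on UNIV \<alpha>" and cb: "continuous_on UNIV b"
    using \<alpha>(1) b(1) by (auto simp: continuous_on_eq_continuous_at intro: DERIV_isCont)
  have va: "continuous_on S (\<lambda>s. v (p s) t)" "continuous_on S (\<lambda>s. a t (p s))"
    if "continuous_on S p" "t \<ge> 0" for S :: "(real \<times> real) set" and p t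
    using continuous_on_compose2[OF v_cont[OF that(2)] that(1)] continuous_on_compose2[OF a_cont[OF that(2)] that(1)] by auto
  note [continuous_intros] = continuous_on_compose2[OF c\<alpha> _ subset_UNIV] continuous_on_compose2[OF cb _ subset_UNIV]
    continuous_on_compose2[OF \<alpha>(2) _ subset_UNIV] continuous_on_compose2[OF b(2) _ subset_UNIV] va
  interpret A: circle_alignment "\<mu> t" \<phi> "\<lambda>x. v x t" "a t" by (rule alignment[OF t])
  have c1: "continuous_on UNIV (\<lambda>p::real \<times> real. \<alpha>' (fst p - snd p) * (v (fst p) t - v (snd p) t) * b (v (fst p) t - v (snd p) t))"
    and c2: "continuous_on UNIV (\<lambda>p::real \<times> real. \<alpha> (fst p - snd p) * b' (v (fst p) t - v (snd p) t) * (a t (fst p) - a t (snd p)))"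
    by (intro continuous_intros t)+
  have "I t (\<lambda>x y. \<alpha>' (x - y) * (v x t - v y t) * b (v x t - v y t))
     + I t (\<lambda>x y. \<alpha> (x - y) * b' (v x t - v y t) * (a t x - a t y))
    = I t (\<lambda>x y. \<alpha>' (x - y) * (v x t - v y t) * b (v x t - v y t) + \<alpha> (x - y) * b' (v x t - v y t) * (a t x - a t y))"
    unfolding I_def by (rule A.pair_integral_add[symmetric]; rule A.bounded_pair_continuous) (fact c1 c2)+
  also have "\<dots> = integral box2 (\<lambda>(x, y). (\<alpha>' (x - y) * (v x t - v y t) * b (v x t - v y t)
        + \<alpha> (x - y) * b' (v x t - v y t) * (a t x - a t y)) * \<rho> x t * \<rho> y t)"
    by (rule I_eq[OF t]) (intro continuous_on_add c1 c2)
  finally have eq: "I t (\<lambda>x y. \<alpha>' (x - y) * (v x t - v y t) * b (v x t - v y t))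
     + I t (\<lambda>x y. \<alpha> (x - y) * b' (v x t - v y t) * (a t x - a t y)) = \<dots>" .
  show ?thesis
  proof (rule has_field_derivative_transform_within[OF pair_transport[OF fields mass_conservation \<alpha> b t, folded a_def, folded eq] zero_less_one])
    fix s :: real assume "s \<in> {0..}"
    then show "integral box2 (\<lambda>(x, y). \<alpha> (x - y) * b (v x s - v y s) * \<rho> x s * \<rho> y s) = I s (\<lambda>x y. \<alpha> (x - y) * b (v x s - v y s))"
      by (intro I_eq[symmetric] continuous_intros) auto
  qed (use t in auto)
qed

lemma M_nonneg: "M t \<ge> 0" by (simp add: M_def)

lemma M_constant:
  assumes t: "t \<ge> 0" shows "M t = M 0"
proof -
  have M2: "I s (\<lambda>x y. 1 * 1) = (M s)\<^sup>2" if "s \<ge> 0" for s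
  proof -
    interpret A: circle_alignment "\<mu> s" \<phi> "\<lambda>x. v x s" "a s" by (rule alignment[OF that])
    show ?thesis using A.pair_integral_const[where c = 1] by (simp add: I_def M_def)
  qed
  have zero: "I s (\<lambda>x y. 0) = 0" if "s \<ge> 0" for s
  proof -
    interpret A: circle_alignment "\<mu> s" \<phi> "\<lambda>x. v x s" "a s" by (rule alignment[OF that])
    show ?thesis using A.pair_integral_const[where c = 0] by (simp add: I_def)
  qed
  have der: "((\<lambda>s. I s (\<lambda>x y. 1 * 1)) has_real_derivative 0) (at s within {0..})" if s: "s \<ge> 0" for s
    using I_derivative[of "\<lambda>_. 1" "\<lambda>_. 0" "\<lambda>_. 1" "\<lambda>_. 0" s] s zero by simp
  have "I t (\<lambda>x y. 1 * 1) \<le> I 0 (\<lambda>x y. 1 * 1)"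
    by (rule nonincreasing_on_halfline[where f = "\<lambda>s. I s (\<lambda>x y. 1 * 1)" and f' = "\<lambda>_. 0"]) (use der t in auto)
  moreover have "- I t (\<lambda>x y. 1 * 1) \<le> - I 0 (\<lambda>x y. 1 * 1)"
  proof (rule nonincreasing_on_halfline[where f = "\<lambda>s. - I s (\<lambda>x y. 1 * 1)" and f' = "\<lambda>_. 0"])
    fix s assume "0 \<le> s" "s \<le> t"
    then show "((\<lambda>s. - I s (\<lambda>x y. 1 * 1)) has_real_derivative 0) (at s within {0..})"
      using DERIV_minus[OF der[of s]] by simp
  qed (use t in auto)
  ultimately have "(M t)\<^sup>2 = (M 0)\<^sup>2" using M2[OF t] M2[of 0] by simp
  then show ?thesis using M_nonneg by (simp add: power2_eq_iff_nonneg)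
qed

lemma V_eq: "t \<ge> 0 \<Longrightarrow> V t = I t (\<lambda>x y. 1 * (v x t - v y t)\<^sup>2)"
  unfolding V_def using hydro_variation_eq[OF rho_cont v_cont]
  by (subst I_eq) (auto intro!: continuous_intros continuous_on_compose2[OF v_cont])

lemma V_derivative:
  assumes t: "t \<ge> 0" and M: "M 0 > 0"
  shows "(V has_real_derivative - (2 * M 0 * J t)) (at t within {0..})"
proof -
  interpret A: circle_alignment "\<mu> t" \<phi> "\<lambda>x. v x t" "a t" by (rule alignment[OF t])
  have Mt: "M t = M 0" by (rule M_constant[OF t])
  have "((\<lambda>t. I t (\<lambda>x y. 1 * (v x t - v y t)\<^sup>2)) has_real_derivative
     I t (\<lambda>x y. 0 * (v x t - v y t) * (v x t - v y t)\<^sup>2)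
     + I t (\<lambda>x y. 1 * (2 * (v x t - v y t)) * (a t x - a t y))) (at t within {0..})"
    by (rule I_derivative[where \<alpha> = "\<lambda>_. 1" and b = "\<lambda>w. w\<^sup>2" and b' = "\<lambda>w. 2 * w", OF _ _ _ _ _ t])
      (auto intro!: derivative_eq_intros continuous_intros)
  moreover have "I t (\<lambda>x y. 0 * (v x t - v y t) * (v x t - v y t)\<^sup>2) = 0"
    using A.pair_integral_const[where c = 0] by (simp add: I_def)
  moreover have "I t (\<lambda>x y. 1 * (2 * (v x t - v y t)) * (a t x - a t y)) = - (2 * M 0 * J t)"
    using M Mt by (simp add: J_def A.J_def I_def M_def)
  ultimately have "((\<lambda>t. I t (\<lambda>x y. 1 * (v x t - v y t)\<^sup>2)) has_real_derivative - (2 * M 0 * J t)) (at t within {0..})"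
    by simp
  then show ?thesis
    by (rule has_field_derivative_transform_within[OF _ zero_less_one]) (use t V_eq in auto)
qed

lemma J_ge_0: assumes "t \<ge> 0" "M 0 > 0" shows "J t \<ge> 0"
  unfolding J_def
  by (rule circle_alignment.J_nonneg[OF alignment[OF assms(1)]])
    (use M_constant[OF assms(1)] assms(2) in \<open>simp add: M_def\<close>)

lemma V_nonneg: "t \<ge> 0 \<Longrightarrow> V t \<ge> 0"
proof -
  assume t: "t \<ge> 0"
  interpret A: circle_alignment "\<mu> t" \<phi> "\<lambda>x. v x t" "a t" by (rule alignment[OF t])
  have "A.pair_integral (\<lambda>x y. 0) \<le> A.pair_integral (\<lambda>x y. (v x t - v y t)\<^sup>2)"
    by (intro A.pair_integral_mono A.bounded_pair_square A.bounded_pair_continuous continuous_intros) auto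
  then show ?thesis using A.pair_integral_const[where c = 0] V_eq[OF t] by (simp add: I_def)
qed

lemma V_le:
  assumes t: "t \<ge> 0" and M: "M 0 > 0" shows "V t \<le> V 0"
  by (rule nonincreasing_on_halfline[where f = V and f' = "\<lambda>t. - (2 * M 0 * J t)"])
    (use t M V_derivative J_ge_0 in auto)

lemma V_zero:
  assumes t: "t \<ge> 0" and M: "M 0 = 0" shows "V t = 0"
proof -
  interpret A: circle_alignment "\<mu> t" \<phi> "\<lambda>x. v x t" "a t" by (rule alignment[OF t])
  obtain B where B: "\<forall>p\<in>box2. \<bar>(v (fst p) t - v (snd p) t)\<^sup>2\<bar> \<le> B" using A.bounded_pair_square unfolding A.bounded_pair_def by blast
  have "A.pair_integral (\<lambda>x y. (v x t - v y t)\<^sup>2) \<le> A.pair_integral (\<lambda>x y. B)"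
  proof (rule A.pair_integral_mono)
    fix x y assume "x \<in> {0..2 * pi}" "y \<in> {0..2 * pi}"
    then have "(x, y) \<in> box2" by (simp add: mem_box2)
    from bspec[OF B this] show "(v x t - v y t)\<^sup>2 \<le> B" by simp
  qed (auto intro!: A.bounded_pair_square A.bounded_pair_continuous continuous_intros)
  then have "V t \<le> B * (M t)\<^sup>2" using V_eq[OF t] A.pair_integral_const[where c = B] by (simp add: I_def M_def)
  then show ?thesis using M M_constant[OF t] V_nonneg[OF t] by simp
qed

text \<open>The hypothesis on \<open>D\<close> bounds the second moment of the kernel, uniformly in the truncation.\<close>

lemma corrector_derivative:
  assumes cor: "is_corrector \<phi> \<psi> g K \<Lambda>"
    and M: "M 0 > 0"
  obtains G' where
    "\<And>t. t \<ge> 0 \<Longrightarrow> ((\<lambda>t. I t (\<lambda>x y. \<psi> (x - y) * (v x t - v y t))) has_real_derivative G' t) (at t within {0..})"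
    "\<And>t \<tau> D. t \<ge> 0 \<Longrightarrow> \<tau> > 0 \<Longrightarrow>
      (\<And>\<epsilon>. \<epsilon> > 0 \<Longrightarrow> I t (\<lambda>x y. truncated_kernel \<phi> \<epsilon> x y * (torus_dist x y)\<^sup>2) \<le> D) \<Longrightarrow>
      G' t \<le> - V t + K * J t + \<Lambda> * M 0 * (\<tau> * J t + D / (4 * \<tau>))"
proof -
  note \<psi> = is_correctorD[OF cor]
  define G' where "G' t = I t (\<lambda>x y. g (x - y) * (v x t - v y t) * (v x t - v y t))
     + I t (\<lambda>x y. \<psi> (x - y) * 1 * (a t x - a t y))" for t
  show ?thesis
  proof (rule that[of G'])
    fix t :: real assume t: "t \<ge> 0"
    show "((\<lambda>t. I t (\<lambda>x y. \<psi> (x - y) * (v x t - v y t))) has_real_derivative G' t) (at t within {0..})"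
      unfolding G'_def
      by (rule I_derivative[where b = "\<lambda>w. w" and b' = "\<lambda>_. 1", OF \<psi>(1,2,4) _ _ t])
        (auto intro!: continuous_intros)
    fix \<tau> D :: real assume \<tau>: "\<tau> > 0"
      and D: "\<And>\<epsilon>. \<epsilon> > 0 \<Longrightarrow> I t (\<lambda>x y. truncated_kernel \<phi> \<epsilon> x y * (torus_dist x y)\<^sup>2) \<le> D"
    interpret A: circle_alignment "\<mu> t" \<phi> "\<lambda>x. v x t" "a t" by (rule alignment[OF t])
    have Mt: "measure (\<mu> t) UNIV = M 0" using M_constant[OF t] by (simp add: M_def)
    have "\<Lambda> \<ge> 0" using \<psi>(10) by linarith
    have "A.pair_integral (\<lambda>x y. \<psi> (x - y) * (a t x - a t y)) \<le> \<Lambda> * M 0 * (\<tau> * J t + D / (4 * \<tau>))"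
      unfolding Mt[symmetric] J_def
      by (rule A.corrector_alignment_le[OF _ \<psi>(8,3) lipschitz_torus_dist[OF \<psi>(4,1,5)] _ \<open>\<Lambda> \<ge> 0\<close> \<tau>])
        (use M Mt D in \<open>auto simp: I_def\<close>)
    moreover have "A.pair_integral (\<lambda>x y. g (x - y) * (v x t - v y t) * (v x t - v y t)) \<le> - V t + K * J t"
      using A.corrector_transport_le[OF _ \<psi>(6,2,7)] M Mt V_eq[OF t] by (simp add: J_def I_def)
    ultimately show "G' t \<le> - V t + K * J t + \<Lambda> * M 0 * (\<tau> * J t + D / (4 * \<tau>))"
      unfolding G'_def I_def by simp
  qed
qed

lemma corrector_bounded:
  assumes t: "t \<ge> 0" and \<psi>: "continuous_on UNIV \<psi>" "\<And>z. \<bar>\<psi> z\<bar> \<le> P"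
  shows "\<bar>I t (\<lambda>x y. \<psi> (x - y) * (v x t - v y t))\<bar> \<le> P * ((M 0)\<^sup>2 + V t)"
proof -
  interpret A: circle_alignment "\<mu> t" \<phi> "\<lambda>x. v x t" "a t" by (rule alignment[OF t])
  have adm1: "A.bounded_pair (\<lambda>x y. \<psi> (x - y) * (v x t - v y t))"
    by (intro A.bounded_pair_continuous continuous_intros continuous_on_compose2[OF \<psi>(1)] A.v_continuous_compose) auto
  have c1: "A.bounded_pair (\<lambda>x y. 1)" by (intro A.bounded_pair_continuous continuous_intros)
  have adm2: "A.bounded_pair (\<lambda>x y. P * (1 + (v x t - v y t)\<^sup>2))" by (intro A.bounded_pair_cmult A.bounded_pair_add c1 A.bounded_pair_square)
  have pt: "\<bar>\<psi> (x - y) * (v x t - v y t)\<bar> \<le> P * (1 + (v x t - v y t)\<^sup>2)" for x y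
  proof -
    have "\<bar>v x t - v y t\<bar> \<le> 1 + (v x t - v y t)\<^sup>2" using young[of 1 "\<bar>v x t - v y t\<bar>" 1] by simp
    then show ?thesis unfolding abs_mult using \<psi>(2)[of "x - y"] by (intro mult_mono) auto
  qed
  have "A.pair_integral (\<lambda>x y. P * (1 + (v x t - v y t)\<^sup>2)) = P * ((M 0)\<^sup>2 + V t)"
    unfolding A.pair_integral_cmult A.pair_integral_add[OF c1 A.bounded_pair_square]
    using A.pair_integral_const[where c = 1] V_eq[OF t] M_constant[OF t] by (simp add: I_def M_def)
  moreover have "A.pair_integral (\<lambda>x y. \<psi> (x - y) * (v x t - v y t)) \<le> A.pair_integral (\<lambda>x y. P * (1 + (v x t - v y t)\<^sup>2))"
    using pt by (intro A.pair_integral_mono adm1 adm2) (simp add: abs_le_iff)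
  moreover have "- A.pair_integral (\<lambda>x y. \<psi> (x - y) * (v x t - v y t)) \<le> A.pair_integral (\<lambda>x y. P * (1 + (v x t - v y t)\<^sup>2))"
  proof -
    have "A.pair_integral (\<lambda>x y. - 1 * (\<psi> (x - y) * (v x t - v y t))) \<le> A.pair_integral (\<lambda>x y. P * (1 + (v x t - v y t)\<^sup>2))"
      using pt by (intro A.pair_integral_mono A.bounded_pair_cmult adm1 adm2) (simp add: abs_le_iff)
    then show ?thesis unfolding A.pair_integral_cmult by simp
  qed
  ultimately show ?thesis unfolding I_def by (simp add: abs_le_iff)
qed

text \<open>All constants depend on the initial datum only, as \<open>M 0\<close> and \<open>V 0\<close> do.\<close>

lemma log_decay:
  assumes cor: "is_corrector \<phi> \<psi> g K \<Lambda>"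
    and B: "B \<ge> 0" "\<And>r. 0 < r \<Longrightarrow> r \<le> pi \<Longrightarrow> \<phi> r * r\<^sup>2 \<le> B" and t: "t \<ge> exp 1"
  shows "V t \<le> (V 0 + K / (2 * M 0) * V 0 + 2 * (\<Lambda> * pi * ((M 0)\<^sup>2 + V 0)) + \<Lambda> * M 0 * (B * (M 0)\<^sup>2) * \<Lambda> / 4) * (ln t / t)"
proof -
  note \<psi> = is_correctorD[OF cor] and c\<psi> = is_correctorD(8)[OF cor] and \<Lambda> = is_correctorD(10)[OF cor]
  have P0: "\<Lambda> * pi \<ge> 0" using \<Lambda> by simp
  have t0: "t \<ge> 1" using t one_le_exp_iff[of 1] by linarith
  show ?thesis
  proof (cases "M 0 = 0")
    case True
    have "0 \<le> V 0" by (rule V_nonneg) simp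
    then have "0 \<le> (V 0 + K / (2 * M 0) * V 0 + 2 * (\<Lambda> * pi * ((M 0)\<^sup>2 + V 0)) + \<Lambda> * M 0 * (B * (M 0)\<^sup>2) * \<Lambda> / 4) * (ln t / t)"
      using True P0 t0 by simp
    moreover have "V t = 0" using V_zero[OF _ True] t0 by simp
    ultimately show ?thesis by simp
  next
    case False
    then have M: "M 0 > 0" using M_nonneg[of 0] by simp
    obtain G' where G': "\<And>t. t \<ge> 0 \<Longrightarrow> ((\<lambda>t. I t (\<lambda>x y. \<psi> (x - y) * (v x t - v y t))) has_real_derivative G' t) (at t within {0..})"
    "\<And>t \<tau> D. t \<ge> 0 \<Longrightarrow> \<tau> > 0 \<Longrightarrow>
      (\<And>\<epsilon>. \<epsilon> > 0 \<Longrightarrow> I t (\<lambda>x y. truncated_kernel \<phi> \<epsilon> x y * (torus_dist x y)\<^sup>2) \<le> D) \<Longrightarrow>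
      G' t \<le> - V t + K * J t + \<Lambda> * M 0 * (\<tau> * J t + D / (4 * \<tau>))"
      using corrector_derivative[OF cor M] by blast
    have second_moment: "I t (\<lambda>x y. truncated_kernel \<phi> \<epsilon> x y * (torus_dist x y)\<^sup>2) \<le> B * (M 0)\<^sup>2"
      if t: "t \<ge> 0" and \<epsilon>: "\<epsilon> > 0" for t \<epsilon>
    proof -
      interpret A: circle_alignment "\<mu> t" \<phi> "\<lambda>x. v x t" "a t" by (rule alignment[OF t])
      have "A.pair_integral (\<lambda>x y. truncated_kernel \<phi> \<epsilon> x y * (torus_dist x y)\<^sup>2) \<le> A.pair_integral (\<lambda>x y. B)"
      proof (rule A.pair_integral_mono)
        show "A.bounded_pair (\<lambda>x y. truncated_kernel \<phi> \<epsilon> x y * (torus_dist x y)\<^sup>2)"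
          by (intro A.bounded_pair_kernel_mult[OF \<epsilon>] A.bounded_pair_continuous continuous_intros)
        show "A.bounded_pair (\<lambda>x y. B)" by (intro A.bounded_pair_continuous continuous_intros)
        fix x y show "truncated_kernel \<phi> \<epsilon> x y * (torus_dist x y)\<^sup>2 \<le> B"
          using B(2)[of "torus_dist x y"] torus_dist_bounds[of x y] B(1) \<epsilon> by (simp add: truncated_kernel_def)
      qed
      then show ?thesis using A.pair_integral_const[where c = B] M_constant[OF t] by (simp add: I_def M_def)
    qed
    show ?thesis
    proof (rule logarithmic_decay[where V = V and J = J and G' = G' and M = "M 0"
          and G = "\<lambda>t. I t (\<lambda>x y. \<psi> (x - y) * (v x t - v y t))"])
      fix t :: real assume t: "t > 0"
      have "G' t \<le> - V t + K * J t + \<Lambda> * M 0 * (t / \<Lambda> * J t + B * (M 0)\<^sup>2 / (4 * (t / \<Lambda>)))"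
        by (rule G'(2)) (use t \<Lambda> second_moment in auto)
      also have "\<dots> = - V t + K * J t + M 0 * t * J t + (\<Lambda> * M 0 * (B * (M 0)\<^sup>2) * \<Lambda> / 4) / t"
        using \<Lambda> t by (simp add: field_simps)
      finally show "G' t \<le> - V t + K * J t + M 0 * t * J t + (\<Lambda> * M 0 * (B * (M 0)\<^sup>2) * \<Lambda> / 4) / t" .
    next
      fix t :: real assume t: "t \<ge> 0"
      have "\<bar>I t (\<lambda>x y. \<psi> (x - y) * (v x t - v y t))\<bar> \<le> \<Lambda> * pi * ((M 0)\<^sup>2 + V t)" by (rule corrector_bounded[OF t c\<psi> \<psi>(9)])
      also have "\<dots> \<le> \<Lambda> * pi * ((M 0)\<^sup>2 + V 0)" using V_le[OF t M] P0 by (intro mult_left_mono) auto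
      finally show "\<bar>I t (\<lambda>x y. \<psi> (x - y) * (v x t - v y t))\<bar> \<le> \<Lambda> * pi * ((M 0)\<^sup>2 + V 0)" .
    qed (use M V_derivative G'(1) J_ge_0 V_nonneg V_le \<psi>(6) t in auto)
  qed
qed

end

text \<open>The condition near \<open>0\<close> extends to all distances on the circle by continuity.\<close>

lemma subquadratic_bound:
  assumes cont: "continuous_on {0<..} \<phi>" and sub: "subquadratic \<phi>"
  obtains B where "B \<ge> 0" "\<And>r. 0 < r \<Longrightarrow> r \<le> pi \<Longrightarrow> \<phi> r * r\<^sup>2 \<le> B"
proof -
  obtain r0 B1 where r0: "r0 > 0" and B1: "\<And>r. 0 < r \<Longrightarrow> r < r0 \<Longrightarrow> r\<^sup>2 * \<phi> r \<le> B1"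
    using sub unfolding subquadratic_def bdd_above_def by fastforce
  have "continuous_on {r0..pi} (\<lambda>r. r\<^sup>2 * \<phi> r)"
    by (intro continuous_intros continuous_on_subset[OF cont]) (use r0 in auto)
  then have "bounded ((\<lambda>r. r\<^sup>2 * \<phi> r) ` {r0..pi})" by (intro compact_imp_bounded compact_continuous_image) auto
  then obtain B2 where "\<forall>y\<in>(\<lambda>r. r\<^sup>2 * \<phi> r) ` {r0..pi}. norm y \<le> B2" unfolding bounded_iff by blast
  then have B2: "r\<^sup>2 * \<phi> r \<le> B2" if "r0 \<le> r" "r \<le> pi" for r using that by (simp add: abs_le_iff)
  show ?thesis
  proof (rule that[of "max 0 (max B1 B2)"])
    fix r :: real assume "0 < r" "r \<le> pi"
    then show "\<phi> r * r\<^sup>2 \<le> max 0 (max B1 B2)"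
      using B1[of r] B2[of r] by (cases "r < r0") (simp_all add: mult.commute le_max_iff_disj)
  qed simp
qed

section \<open>Strongly singular kernels: growth of the potential energy\<close>

text \<open>The square of the chord that subtends the angle \<open>z\<close>: a smooth periodic substitute for the square of
  the distance.\<close>

definition chord2 :: "real \<Rightarrow> real" where "chord2 z = 2 - 2 * cos z"

lemma chord2_sin: "chord2 z = 4 * (sin (z / 2))\<^sup>2"
  using cos_double_sin[of "z / 2"] by (simp add: chord2_def)

lemma chord2_bounds: "0 \<le> chord2 z" "chord2 z \<le> 4" "(sin z)\<^sup>2 \<le> chord2 z"
proof -
  show "0 \<le> chord2 z" by (simp add: chord2_def)
  show "chord2 z \<le> 4" using cos_ge_minus_one[of z] unfolding chord2_def by linarith
  have "(sin z)\<^sup>2 = (1 + cos z) * (1 - cos z)" by (simp add: sin_squared_eq power2_eq_square algebra_simps)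
  also have "\<dots> \<le> 2 * (1 - cos z)" by (intro mult_right_mono) auto
  finally show "(sin z)\<^sup>2 \<le> chord2 z" by (simp add: chord2_def)
qed

lemma chord2_torus_dist: "chord2 (x - y) = chord2 (torus_dist x y)"
  by (simp add: chord2_def cos_torus_dist)

lemma chord2_le: "chord2 z \<le> z\<^sup>2"
proof -
  have "(sin (z / 2))\<^sup>2 \<le> (z / 2)\<^sup>2" using abs_sin_x_le_abs_x[of "z / 2"] by (rule abs_le_square_iff[THEN iffD1])
  then show ?thesis by (simp add: chord2_sin power2_eq_square)
qed

lemma chord2_ge: assumes z: "0 \<le> z" "z \<le> 1" shows "(z / 2)\<^sup>2 \<le> chord2 z"
proof -
  have "z / 4 \<le> sin (z / 2)"
  proof (cases "z = 0")
    case False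
    then obtain c where c: "0 < c" "c < z / 2" "sin (z / 2) - sin 0 = (z / 2 - 0) * cos c"
      using MVT2[of 0 "z / 2" sin cos] z DERIV_sin by auto
    have "cos (pi / 3) \<le> cos c" using c z pi_gt3 by (intro cos_monotone_0_pi_le) auto
    then have "1 / 2 \<le> cos c" by (simp add: cos_60)
    then have "z / 2 * (1 / 2) \<le> z / 2 * cos c" using z by (intro mult_left_mono) auto
    moreover have "sin (z / 2) = z / 2 * cos c" using c(3) by simp
    ultimately show ?thesis by linarith
  qed simp
  then have "(z / 4)\<^sup>2 \<le> (sin (z / 2))\<^sup>2" using z by (intro power_mono) auto
  then show ?thesis by (simp add: chord2_sin power2_eq_square)
qed

lemma square_powr: "z > 0 \<Longrightarrow> (z\<^sup>2) powr p = z powr (2 * p)" for z :: real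
  by (metis powr_numeral powr_powr less_imp_le)

text \<open>The regularised density \<open>r powr (- 2 * \<gamma>)\<close> and its derivative.\<close>

definition riesz :: "real \<Rightarrow> real \<Rightarrow> real \<Rightarrow> real" where
  "riesz \<gamma> \<delta> z = (\<delta> + chord2 z) powr - \<gamma>"

definition riesz' :: "real \<Rightarrow> real \<Rightarrow> real \<Rightarrow> real" where
  "riesz' \<gamma> \<delta> z = - 2 * \<gamma> * sin z * (\<delta> + chord2 z) powr (- \<gamma> - 1)"

lemma riesz_derivative: "\<delta> > 0 \<Longrightarrow> (riesz \<gamma> \<delta> has_real_derivative riesz' \<gamma> \<delta> z) (at z)"
proof -
  assume "\<delta> > 0"
  then have pos: "\<delta> + chord2 z > 0" using chord2_bounds(1)[of z] by simp
  have "((\<lambda>z. \<delta> + chord2 z) has_real_derivative 2 * sin z) (at z)"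
    unfolding chord2_def by (auto intro!: derivative_eq_intros)
  from DERIV_fun_powr[OF this pos, of "- \<gamma>"] show ?thesis
    unfolding riesz_def riesz'_def by (simp add: mult_ac)
qed

lemma chord2_continuous:
  fixes p :: "'a::t2_space \<Rightarrow> real"
  shows "continuous_on S p \<Longrightarrow> continuous_on S (\<lambda>s. chord2 (p s))"
  unfolding chord2_def by (intro continuous_intros)

lemma riesz_continuous:
  fixes p :: "'a::t2_space \<Rightarrow> real"
  assumes "\<delta> > 0" "continuous_on S p"
  shows "continuous_on S (\<lambda>s. riesz \<gamma> \<delta> (p s))" "continuous_on S (\<lambda>s. riesz' \<gamma> \<delta> (p s))"
  unfolding riesz_def riesz'_def using assms chord2_bounds(1)
  by (auto intro!: continuous_intros chord2_continuous simp: add_pos_nonneg less_imp_neq[OF add_pos_nonneg, symmetric])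

text \<open>Young's inequality, together with \<open>(sin z)\<^sup>2 \<le> chord2 z\<close>.\<close>

lemma riesz_energy_pointwise:
  assumes \<gamma>: "\<gamma> > 0" and \<delta>: "\<delta> > 0" and \<tau>: "\<tau> > 0"
  shows "riesz' \<gamma> \<delta> z * w \<le> riesz \<gamma> \<delta> z / \<tau> + \<tau> * (\<gamma>\<^sup>2 * ((\<delta> + chord2 z) powr (- \<gamma> - 1) * w\<^sup>2))"
proof -
  define S where "S = \<delta> + chord2 z"
  have S: "S > 0" "(sin z)\<^sup>2 \<le> S" using chord2_bounds[of z] \<delta> by (auto simp: S_def)
  define r where "r = S powr (- \<gamma> - 1)"
  have r: "r > 0" using S by (simp add: r_def)
  have rS: "S powr - \<gamma> = r * S" using powr_add[of S "- \<gamma> - 1" 1] S by (simp add: r_def)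
  define u where "u = - sin z * \<gamma> * w"
  have "2 * u \<le> (sin z)\<^sup>2 / \<tau> + \<tau> * (\<gamma> * w)\<^sup>2"
  proof -
    have "0 \<le> (sin z + \<tau> * (\<gamma> * w))\<^sup>2 / \<tau>" using \<tau> by simp
    also have "\<dots> = (sin z)\<^sup>2 / \<tau> + \<tau> * (\<gamma> * w)\<^sup>2 - 2 * u"
      using \<tau> by (simp add: u_def power2_eq_square field_simps)
    finally show ?thesis by simp
  qed
  also have "\<dots> \<le> S / \<tau> + \<tau> * (\<gamma> * w)\<^sup>2" using S \<tau> by (intro add_right_mono divide_right_mono) auto
  finally have "r * (2 * u) \<le> r * (S / \<tau> + \<tau> * (\<gamma> * w)\<^sup>2)" using r by (intro mult_left_mono) auto
  then show ?thesis
    unfolding riesz'_def riesz_def S_def[symmetric] rS r_def[symmetric]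
    by (simp add: u_def algebra_simps power_mult_distrib)
qed

text \<open>The derivative of \<open>P z = sin z * riesz \<gamma> \<delta> z\<close> bounds \<open>(1 - 2 * \<gamma>) * riesz \<gamma> \<delta> z\<close> from above up to the
  constant \<open>3\<close>, and integrates to zero over a period. This gives a bound uniform in \<open>\<delta>\<close>.\<close>

lemma riesz_integral_le:
  assumes \<gamma>: "0 < \<gamma>" "\<gamma> < 1 / 2" and \<delta>: "0 < \<delta>" "\<delta> \<le> 1"
  shows "integral {0..2 * pi} (\<lambda>y. riesz \<gamma> \<delta> (x - y)) \<le> 6 * pi / (1 - 2 * \<gamma>)"
proof -
  define P where "P z = sin z * riesz \<gamma> \<delta> z" for z
  define P' where "P' z = cos z * riesz \<gamma> \<delta> z + riesz' \<gamma> \<delta> z * sin z" for z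
  have P: "(P has_real_derivative P' z) (at z)" for z
    unfolding P_def P'_def by (intro DERIV_mult DERIV_sin riesz_derivative \<delta>)
  have le: "riesz \<gamma> \<delta> z \<le> (P' z + 3) / (1 - 2 * \<gamma>)" for z
  proof -
    define S where "S = \<delta> + chord2 z"
    have S: "S > 0" "(sin z)\<^sup>2 \<le> S" "chord2 z \<le> S" "S \<le> 5" using chord2_bounds[of z] \<delta> by (auto simp: S_def)
    define r where "r = S powr (- \<gamma> - 1)"
    have r: "r > 0" using S by (simp add: r_def)
    have rS: "S powr - \<gamma> = r * S" using powr_add[of S "- \<gamma> - 1" 1] S by (simp add: r_def)
    have "S * S powr - \<gamma> = S powr (1 - \<gamma>)" using powr_add[of S 1 "- \<gamma>"] S by simp
    also have "\<dots> \<le> 6"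
    proof (cases "S \<le> 1")
      case True
      have "S powr (1 - \<gamma>) \<le> 1" using True S \<gamma> by (intro powr_le1) auto
      then show ?thesis by simp
    next
      case False
      have "S powr (1 - \<gamma>) \<le> S powr 1" using False \<gamma> by (intro powr_mono) auto
      then show ?thesis using S by simp
    qed
    finally have six: "S * (r * S) \<le> 6" by (simp add: rS)
    have "chord2 z * (r * S) \<le> S * (r * S)" using S r by (intro mult_right_mono) auto
    with six have a: "chord2 z * (r * S) \<le> 6" by simp
    have "2 * \<gamma> * r * (sin z)\<^sup>2 \<le> 2 * \<gamma> * r * S" using S \<gamma> r by (intro mult_left_mono) auto
    moreover have "P' z = (1 - chord2 z / 2) * (r * S) - 2 * \<gamma> * r * (sin z)\<^sup>2"
      unfolding P'_def riesz_def riesz'_def S_def[symmetric] r_def[symmetric] rS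
      by (simp add: chord2_def power2_eq_square diff_divide_distrib)
    ultimately have "(1 - 2 * \<gamma>) * (r * S) \<le> P' z + 3" using a by (simp add: algebra_simps)
    then show ?thesis using \<gamma> unfolding riesz_def S_def[symmetric] rS by (simp add: field_simps)
  qed
  have "((\<lambda>y. (P' (x - y) + 3) / (1 - 2 * \<gamma>)) has_integral
     ((- P (x - 2 * pi) + 3 * (2 * pi)) / (1 - 2 * \<gamma>) - (- P (x - 0) + 3 * 0) / (1 - 2 * \<gamma>))) {0..2 * pi}"
  proof (rule fundamental_theorem_of_calculus)
    fix y :: real
    have "((\<lambda>y. (- P (x - y) + 3 * y) / (1 - 2 * \<gamma>)) has_real_derivative (P' (x - y) + 3) / (1 - 2 * \<gamma>)) (at y)"
      using \<gamma> by (auto intro!: derivative_eq_intros DERIV_chain2[OF P] simp: add.commute)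
    then show "((\<lambda>y. (- P (x - y) + 3 * y) / (1 - 2 * \<gamma>)) has_vector_derivative (P' (x - y) + 3) / (1 - 2 * \<gamma>)) (at y within {0..2 * pi})"
      by (auto simp: has_real_derivative_iff_has_vector_derivative intro: has_vector_derivative_at_within)
  qed simp
  moreover have "P (x - 2 * pi) = P (x - 0)" by (simp add: P_def riesz_def chord2_def sin_diff cos_diff)
  ultimately have rhs: "((\<lambda>y. (P' (x - y) + 3) / (1 - 2 * \<gamma>)) has_integral (6 * pi / (1 - 2 * \<gamma>))) {0..2 * pi}"
    by (simp add: add_divide_distrib[symmetric])
  have "(\<lambda>y. riesz \<gamma> \<delta> (x - y)) integrable_on {0..2 * pi}"
    by (intro integrable_continuous_interval riesz_continuous \<delta> continuous_intros)
  from integral_le[OF this has_integral_integrable[OF rhs] le] show ?thesis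
    unfolding integral_unique[OF rhs] .
qed

context euler_flow
begin

text \<open>At distances up to \<open>r1\<close> the rate of change is controlled by the energy and the dissipation, by means of
  the lower bound on the kernel; farther away, by the total mass and the variation. The bound on the initial energy
  uses that the initial density is bounded and \<open>\<beta> < 3\<close>.\<close>

lemma riesz_energy_growth:
  assumes \<beta>: "2 < \<beta>" "\<beta> < 3" and M: "M 0 > 0"
    and r0: "r0 > 0" and l: "l > 0" and lower: "\<And>r. 0 < r \<Longrightarrow> r < r0 \<Longrightarrow> l / r powr \<beta> \<le> \<phi> r"
  obtains C where "\<And>t \<delta>. t \<ge> 0 \<Longrightarrow> 0 < \<delta> \<Longrightarrow> \<delta> \<le> 1 \<Longrightarrow> I t (\<lambda>x y. riesz ((\<beta> - 2) / 2) \<delta> (x - y)) \<le> C * (1 + t)"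
proof -
  define \<gamma> where "\<gamma> = (\<beta> - 2) / 2"
  have \<gamma>: "0 < \<gamma>" "\<gamma> < 1 / 2" "- \<gamma> - 1 = - \<beta> / 2" using \<beta> by (auto simp: \<gamma>_def field_simps)
  define r1 where "r1 = min (r0 / 2) 1"
  have r1: "0 < r1" "r1 < r0" "r1 \<le> 1" using r0 by (auto simp: r1_def)
  define q1 where "q1 = chord2 r1"
  have q1: "q1 > 0" using cos_monotone_0_pi[of 0 r1] r1 pi_gt3 by (simp add: q1_def chord2_def)
  define c0 where "c0 = 2 * \<gamma> * q1 powr (- \<gamma> - 1)"
  have c0: "c0 \<ge> 0" using \<gamma> by (simp add: c0_def)
  define c1 where "c1 = 2 powr \<beta> / l"
  have c1: "c1 > 0" using l by (simp add: c1_def)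
  have near: "(\<delta> + chord2 (x - y)) powr (- \<gamma> - 1) \<le> c1 * \<phi> (torus_dist x y)"
    if d: "0 < torus_dist x y" "torus_dist x y \<le> r1" and \<delta>: "\<delta> > 0" for x y \<delta>
  proof -
    let ?d = "torus_dist x y"
    have "(?d / 2)\<^sup>2 \<le> \<delta> + chord2 (x - y)"
      using chord2_ge[of ?d] d r1 \<delta> by (simp add: chord2_torus_dist)
    then have "(\<delta> + chord2 (x - y)) powr (- \<gamma> - 1) \<le> ((?d / 2)\<^sup>2) powr (- \<gamma> - 1)"
      using d \<gamma> by (intro powr_mono2') auto
    also have "\<dots> = (?d / 2) powr (- \<beta>)"
      using d unfolding \<gamma>(3) by (subst square_powr) auto
    also have "\<dots> = 2 powr \<beta> * ?d powr - \<beta>" using d by (simp add: powr_divide powr_minus field_simps)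
    also have "\<dots> = c1 * (l / ?d powr \<beta>)" using l by (simp add: c1_def powr_minus field_simps)
    also have "\<dots> \<le> c1 * \<phi> ?d" using lower[OF d(1)] d r1 c1 by (intro mult_left_mono) auto
    finally show ?thesis .
  qed
  have far: "riesz' \<gamma> \<delta> (x - y) * w \<le> c0 * (1 + w\<^sup>2)"
    if d: "r1 \<le> torus_dist x y" and \<delta>: "\<delta> > 0" for x y w \<delta>
  proof -
    have "cos (torus_dist x y) \<le> cos r1"
      using d r1 torus_dist_bounds[of x y] by (intro cos_monotone_0_pi_le) auto
    then have "q1 \<le> \<delta> + chord2 (x - y)" using \<delta> by (simp add: q1_def chord2_def cos_torus_dist)
    then have p: "(\<delta> + chord2 (x - y)) powr (- \<gamma> - 1) \<le> q1 powr (- \<gamma> - 1)"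
      using q1 \<gamma> by (intro powr_mono2') auto
    have "riesz' \<gamma> \<delta> (x - y) * w \<le> \<bar>riesz' \<gamma> \<delta> (x - y)\<bar> * \<bar>w\<bar>" by (metis abs_ge_self abs_mult)
    also have "\<dots> \<le> c0 * (1 + w\<^sup>2)"
    proof (rule mult_mono)
      have "\<bar>riesz' \<gamma> \<delta> (x - y)\<bar> = 2 * \<gamma> * \<bar>sin (x - y)\<bar> * (\<delta> + chord2 (x - y)) powr (- \<gamma> - 1)"
        using \<gamma> by (simp add: riesz'_def abs_mult)
      also have "\<dots> \<le> 2 * \<gamma> * 1 * q1 powr (- \<gamma> - 1)"
        using \<gamma> p by (intro mult_mono) auto
      finally show "\<bar>riesz' \<gamma> \<delta> (x - y)\<bar> \<le> c0" by (simp add: c0_def)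
      show "\<bar>w\<bar> \<le> 1 + w\<^sup>2" using young[of 1 "\<bar>w\<bar>" 1] by simp
    qed (use c0 in auto)
    finally show ?thesis .
  qed
  obtain R where R: "\<And>x. x \<in> {0..2 * pi} \<Longrightarrow> \<rho> x 0 \<le> R"
  proof -
    have "continuous_on {0..2 * pi} (\<lambda>x. \<rho> x 0)" by (rule continuous_on_subset[OF rho_cont]) auto
    then have "bounded ((\<lambda>x. \<rho> x 0) ` {0..2 * pi})" by (intro compact_imp_bounded compact_continuous_image) auto
    then obtain R where "\<forall>y\<in>(\<lambda>x. \<rho> x 0) ` {0..2 * pi}. norm y \<le> R" unfolding bounded_iff by blast
    then show ?thesis by (intro that[of R]) (simp add: abs_le_iff)
  qed
  have R0: "R \<ge> 0" using R[of 0] rho_nonneg[of 0 0] by simp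
  define E0 where "E0 = R * (6 * pi / (1 - 2 * \<gamma>)) * M 0"
  have E0: "E0 \<ge> 0" using R0 \<gamma> M by (simp add: E0_def)
  have initial: "I 0 (\<lambda>x y. riesz \<gamma> \<delta> (x - y)) \<le> E0" if \<delta>: "0 < \<delta>" "\<delta> \<le> 1" for \<delta>
  proof -
    interpret A: circle_alignment "\<mu> 0" \<phi> "\<lambda>x. v x 0" "a 0" by (rule alignment) simp
    have bounded_pair: "A.bounded_pair (\<lambda>x y. riesz \<gamma> \<delta> (x - y))"
      by (intro A.bounded_pair_continuous riesz_continuous \<delta> continuous_intros)
    have inner: "(\<integral>y. riesz \<gamma> \<delta> (x - y) \<partial>\<mu> 0) \<le> R * (6 * pi / (1 - 2 * \<gamma>))" for x
    proof -
      have c: "continuous_on S (\<lambda>y. riesz \<gamma> \<delta> (x - y))" for S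
        by (intro riesz_continuous \<delta> continuous_intros)
      have rc: "continuous_on S (\<lambda>y. \<rho> y 0)" for S by (rule continuous_on_subset[OF rho_cont]) auto
      have "(\<integral>y. riesz \<gamma> \<delta> (x - y) \<partial>\<mu> 0) = integral {0..2 * pi} (\<lambda>y. riesz \<gamma> \<delta> (x - y) * \<rho> y 0)"
        unfolding \<mu>_def by (rule mass_measure_integral_continuous[OF rc _ c]) (simp add: rho_nonneg)
      also have "\<dots> \<le> integral {0..2 * pi} (\<lambda>y. riesz \<gamma> \<delta> (x - y) * R)"
        by (intro integral_le integrable_continuous_interval continuous_intros c rc mult_left_mono R)
          (auto simp: riesz_def)
      also have "\<dots> = R * integral {0..2 * pi} (\<lambda>y. riesz \<gamma> \<delta> (x - y))" by simp
      also have "\<dots> \<le> R * (6 * pi / (1 - 2 * \<gamma>))" using R0 by (intro mult_left_mono riesz_integral_le \<gamma> \<delta>)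
      finally show ?thesis .
    qed
    have nn: "0 \<le> (\<integral>y. riesz \<gamma> \<delta> (x - y) \<partial>\<mu> 0)" for x
      by (intro Bochner_Integration.integral_nonneg) (simp add: riesz_def)
    have int: "integrable (\<mu> 0) (\<lambda>x. \<integral>y. riesz \<gamma> \<delta> (x - y) \<partial>\<mu> 0)"
      using A.partial_integrable[OF A.bounded_pair_swap[OF A.bounded_pair_partial_integral[OF bounded_pair]], of 0] by simp
    have "I 0 (\<lambda>x y. riesz \<gamma> \<delta> (x - y)) = (\<integral>x. \<integral>y. riesz \<gamma> \<delta> (x - y) \<partial>\<mu> 0 \<partial>\<mu> 0)"
      unfolding I_def by (rule A.pair_integral_iterated[OF bounded_pair])
    also have "\<dots> \<le> R * (6 * pi / (1 - 2 * \<gamma>)) * measure (\<mu> 0) UNIV"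
      using A.abs_integral_le[OF int, of "R * (6 * pi / (1 - 2 * \<gamma>))"] inner nn by simp
    finally show ?thesis by (simp add: E0_def M_def)
  qed
  define c where "c = c0 * ((M 0)\<^sup>2 + V 0)"
  have c: "c \<ge> 0" using c0 V_nonneg[of 0] by (simp add: c_def)
  have "I t (\<lambda>x y. riesz \<gamma> \<delta> (x - y)) \<le> (E0 + 3 * (\<gamma>\<^sup>2 * c1 / M 0) * V 0 + 2 * c) * (1 + t)"
    if t: "t \<ge> 0" and \<delta>: "0 < \<delta>" "\<delta> \<le> 1" for t \<delta>
  proof (rule linear_growth[where V = V and J = J and E' = "\<lambda>t. I t (\<lambda>x y. riesz' \<gamma> \<delta> (x - y) * (v x t - v y t))"])
    fix t :: real assume t: "t \<ge> 0"
    interpret A: circle_alignment "\<mu> t" \<phi> "\<lambda>x. v x t" "a t" by (rule alignment[OF t])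
    have "riesz \<gamma> \<delta> (z + 2 * pi) = riesz \<gamma> \<delta> z" for z by (simp add: riesz_def chord2_def)
    from I_derivative[of "riesz \<gamma> \<delta>" "riesz' \<gamma> \<delta>" "\<lambda>_. 1" "\<lambda>_. 0", OF riesz_derivative[OF \<delta>(1)] _ this _ _ t]
    show "((\<lambda>t. I t (\<lambda>x y. riesz \<gamma> \<delta> (x - y))) has_real_derivative I t (\<lambda>x y. riesz' \<gamma> \<delta> (x - y) * (v x t - v y t))) (at t within {0..})"
      using A.pair_integral_const[where c = 0] riesz_continuous(2)[OF \<delta>(1) continuous_on_id, of UNIV \<gamma>] by (simp add: I_def)
    fix \<tau> :: real assume \<tau>: "\<tau> > 0"
    define h where "h x y = (1 - truncated_kernel (\<lambda>_. 1) r1 x y) * ((\<delta> + chord2 (x - y)) powr (- \<gamma> - 1) * (v x t - v y t)\<^sup>2)" for x y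
    have one: "A.bounded_pair (\<lambda>x y. 1)" by (intro A.bounded_pair_continuous continuous_intros)
    have cs: "continuous_on UNIV (\<lambda>p::real \<times> real. (\<delta> + chord2 (fst p - snd p)) powr (- \<gamma> - 1))"
      using \<delta> chord2_bounds(1)
      by (auto intro!: continuous_intros chord2_continuous simp: less_imp_neq[OF add_pos_nonneg, symmetric])
    have bounded_pair_h: "A.bounded_pair h"
    proof -
      have "A.bounded_pair (\<lambda>x y. 1 + - 1 * truncated_kernel (\<lambda>_. 1) r1 x y)"
        using r1 by (intro A.bounded_pair_add one A.bounded_pair_cmult A.bounded_pair_truncated_kernel continuous_intros) auto
      then show ?thesis unfolding h_def
        using A.bounded_pair_mult A.bounded_pair_mult[OF A.bounded_pair_continuous[OF cs] A.bounded_pair_square] by simp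
    qed
    have h_le: "A.pair_integral h \<le> c1 * J t"
      unfolding J_def
    proof (rule A.pair_integral_le_J[OF _ bounded_pair_h])
      show "h x y = 0" if "torus_dist x y = 0" for x y
        using A.v_eq_if_torus_dist_0[OF that] by (simp add: h_def)
      fix x y assume d: "torus_dist x y > 0"
      show "h x y \<le> c1 * (\<phi> (torus_dist x y) * (v x t - v y t)\<^sup>2)"
      proof (cases "torus_dist x y \<le> r1")
        case True
        have "h x y \<le> 1 * ((\<delta> + chord2 (x - y)) powr (- \<gamma> - 1) * (v x t - v y t)\<^sup>2)"
          unfolding h_def by (intro mult_right_mono) (auto simp: truncated_kernel_def)
        also have "\<dots> \<le> (c1 * \<phi> (torus_dist x y)) * (v x t - v y t)\<^sup>2"
          using mult_right_mono[OF near[OF d True \<delta>(1)]] by simp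
        finally show ?thesis by (simp add: mult.assoc)
      next
        case False
        then show ?thesis using r1 c1 kernel_nonneg[OF d] by (simp add: h_def truncated_kernel_def)
      qed
    qed (use M M_constant[OF t] c1 in \<open>auto simp: M_def\<close>)
    have admE: "A.bounded_pair (\<lambda>x y. 1 / \<tau> * riesz \<gamma> \<delta> (x - y))"
      by (intro A.bounded_pair_cmult A.bounded_pair_continuous riesz_continuous \<delta> continuous_intros)
    have admV: "A.bounded_pair (\<lambda>x y. c0 * (1 + (v x t - v y t)\<^sup>2))" by (intro A.bounded_pair_cmult A.bounded_pair_add one A.bounded_pair_square)
    have admH: "A.bounded_pair (\<lambda>x y. \<tau> * (\<gamma>\<^sup>2 * h x y))" by (intro A.bounded_pair_cmult bounded_pair_h)
    have "A.pair_integral (\<lambda>x y. riesz' \<gamma> \<delta> (x - y) * (v x t - v y t))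
      \<le> A.pair_integral (\<lambda>x y. c0 * (1 + (v x t - v y t)\<^sup>2) + (1 / \<tau> * riesz \<gamma> \<delta> (x - y) + \<tau> * (\<gamma>\<^sup>2 * h x y)))"
    proof (rule A.pair_integral_mono)
      show "A.bounded_pair (\<lambda>x y. riesz' \<gamma> \<delta> (x - y) * (v x t - v y t))"
        by (intro A.bounded_pair_continuous continuous_on_mult riesz_continuous \<delta> continuous_intros A.v_continuous_compose)
      show "A.bounded_pair (\<lambda>x y. c0 * (1 + (v x t - v y t)\<^sup>2) + (1 / \<tau> * riesz \<gamma> \<delta> (x - y) + \<tau> * (\<gamma>\<^sup>2 * h x y)))"
        by (intro A.bounded_pair_add admV admE admH)
      fix x y
      have V0: "0 \<le> c0 * (1 + (v x t - v y t)\<^sup>2)" using c0 by simp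
      show "riesz' \<gamma> \<delta> (x - y) * (v x t - v y t)
        \<le> c0 * (1 + (v x t - v y t)\<^sup>2) + (1 / \<tau> * riesz \<gamma> \<delta> (x - y) + \<tau> * (\<gamma>\<^sup>2 * h x y))"
      proof (cases "torus_dist x y \<le> r1")
        case True
        then have "h x y = (\<delta> + chord2 (x - y)) powr (- \<gamma> - 1) * (v x t - v y t)\<^sup>2"
          by (simp add: h_def truncated_kernel_def)
        then show ?thesis
          using riesz_energy_pointwise[OF \<gamma>(1) \<delta>(1) \<tau>, of "x - y" "v x t - v y t"] V0 by simp
      next
        case False
        then have "h x y = 0" by (simp add: h_def truncated_kernel_def)
        moreover have "0 \<le> 1 / \<tau> * riesz \<gamma> \<delta> (x - y)" using \<tau> by (simp add: riesz_def)
        ultimately show ?thesis using far[OF _ \<delta>(1), of x y "v x t - v y t"] False by simp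
      qed
    qed
    also have "\<dots> = c0 * (A.pair_integral (\<lambda>x y. 1) + A.pair_integral (\<lambda>x y. (v x t - v y t)\<^sup>2))
        + (1 / \<tau> * A.pair_integral (\<lambda>x y. riesz \<gamma> \<delta> (x - y)) + \<tau> * (\<gamma>\<^sup>2 * A.pair_integral h))"
      unfolding A.pair_integral_add[OF admV A.bounded_pair_add[OF admE admH]] A.pair_integral_add[OF admE admH] A.pair_integral_cmult
        A.pair_integral_add[OF one A.bounded_pair_square] ..
    also have "c0 * (A.pair_integral (\<lambda>x y. 1) + A.pair_integral (\<lambda>x y. (v x t - v y t)\<^sup>2)) \<le> c"
      using A.pair_integral_const[where c = 1] V_eq[OF t] V_le[OF t M] M_constant[OF t] c0
      by (auto simp: c_def I_def M_def intro!: mult_left_mono)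
    also have "\<tau> * (\<gamma>\<^sup>2 * A.pair_integral h) \<le> \<tau> * (\<gamma>\<^sup>2 * (c1 * J t))" using h_le \<tau> by (intro mult_left_mono) auto
    finally show "I t (\<lambda>x y. riesz' \<gamma> \<delta> (x - y) * (v x t - v y t))
      \<le> c + I t (\<lambda>x y. riesz \<gamma> \<delta> (x - y)) / \<tau> + \<tau> * (\<gamma>\<^sup>2 * c1) * J t"
      by (simp add: I_def mult.assoc)
  qed (use M V_derivative V_nonneg V_le initial \<delta> E0 c c1 t in auto)
  then show ?thesis using that unfolding \<gamma>_def by blast
qed

lemma alignment_strongly_singular:
  assumes \<beta>: "2 < \<beta>" "\<beta> < 3" and power: "power_singular \<phi> \<beta>"
    and cor: "is_corrector \<phi> \<psi> g K \<Lambda>"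
  shows "(V \<longlongrightarrow> 0) at_top"
proof (cases "M 0 = 0")
  case True
  have "\<forall>\<^sub>F t in at_top. V t = 0" using eventually_ge_at_top[of 0] by eventually_elim (rule V_zero[OF _ True])
  then show ?thesis by (rule tendsto_eventually)
next
  case False
  then have M: "M 0 > 0" using M_nonneg[of 0] by simp
  define \<gamma> where "\<gamma> = (\<beta> - 2) / 2"
  obtain r0 l L where rl: "r0 > 0" "l > 0" "L > 0"
    and bnd: "\<And>r. r > 0 \<Longrightarrow> (if r < r0 then l / r powr \<beta> else 0) \<le> \<phi> r \<and> \<phi> r \<le> L / r powr \<beta>"
    using power unfolding power_singular_def by blast
  have "l / r powr \<beta> \<le> \<phi> r" if "0 < r" "r < r0" for r using bnd[of r] that by simp
  from riesz_energy_growth[OF \<beta> M rl(1,2) this] obtain C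
    where C: "\<And>t \<delta>. t \<ge> 0 \<Longrightarrow> 0 < \<delta> \<Longrightarrow> \<delta> \<le> 1 \<Longrightarrow> I t (\<lambda>x y. riesz \<gamma> \<delta> (x - y)) \<le> C * (1 + t)"
    unfolding \<gamma>_def by blast
  define d where "d = L * 2 powr \<gamma> * \<bar>C\<bar>"
  have d: "d \<ge> 0" using rl by (simp add: d_def)
  note \<psi> = is_correctorD[OF cor] and c\<psi> = is_correctorD(8)[OF cor] and \<Lambda> = is_correctorD(10)[OF cor]
  define P where "P = \<Lambda> * pi"
  have P: "\<bar>\<psi> z\<bar> \<le> P" for z using \<psi>(9) by (simp add: P_def)
  have P0: "P \<ge> 0" using P[of 0] by linarith
  obtain G' where G': "\<And>t. t \<ge> 0 \<Longrightarrow> ((\<lambda>t. I t (\<lambda>x y. \<psi> (x - y) * (v x t - v y t))) has_real_derivative G' t) (at t within {0..})"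
    "\<And>t \<tau> D. t \<ge> 0 \<Longrightarrow> \<tau> > 0 \<Longrightarrow>
      (\<And>\<epsilon>. \<epsilon> > 0 \<Longrightarrow> I t (\<lambda>x y. truncated_kernel \<phi> \<epsilon> x y * (torus_dist x y)\<^sup>2) \<le> D) \<Longrightarrow>
      G' t \<le> - V t + K * J t + \<Lambda> * M 0 * (\<tau> * J t + D / (4 * \<tau>))"
    using corrector_derivative[OF cor M] by blast
  have second_moment: "I t (\<lambda>x y. truncated_kernel \<phi> \<epsilon> x y * (torus_dist x y)\<^sup>2) \<le> d * (1 + t)"
    if t: "t \<ge> 0" and \<epsilon>: "\<epsilon> > 0" for t \<epsilon>
  proof -
    interpret A: circle_alignment "\<mu> t" \<phi> "\<lambda>x. v x t" "a t" by (rule alignment[OF t])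
    \<comment> \<open>at distances greater than \<open>\<epsilon>\<close> this regularisation changes the density by a bounded factor only\<close>
    define \<delta> where "\<delta> = min 1 (\<epsilon>\<^sup>2)"
    have \<delta>: "0 < \<delta>" "\<delta> \<le> 1" "\<delta> \<le> \<epsilon>\<^sup>2" using \<epsilon> by (auto simp: \<delta>_def)
    have "A.pair_integral (\<lambda>x y. truncated_kernel \<phi> \<epsilon> x y * (torus_dist x y)\<^sup>2) \<le> A.pair_integral (\<lambda>x y. L * 2 powr \<gamma> * riesz \<gamma> \<delta> (x - y))"
    proof (rule A.pair_integral_mono)
      show "A.bounded_pair (\<lambda>x y. truncated_kernel \<phi> \<epsilon> x y * (torus_dist x y)\<^sup>2)"
        by (intro A.bounded_pair_kernel_mult[OF \<epsilon>] A.bounded_pair_continuous continuous_intros)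
      show "A.bounded_pair (\<lambda>x y. L * 2 powr \<gamma> * riesz \<gamma> \<delta> (x - y))"
        by (intro A.bounded_pair_cmult A.bounded_pair_continuous riesz_continuous \<delta> continuous_intros)
      fix x y
      let ?d = "torus_dist x y"
      show "truncated_kernel \<phi> \<epsilon> x y * ?d\<^sup>2 \<le> L * 2 powr \<gamma> * riesz \<gamma> \<delta> (x - y)"
      proof (cases "\<epsilon> < ?d")
        case False
        then show ?thesis using rl by (simp add: truncated_kernel_def riesz_def)
      next
        case True
        then have d: "?d > 0" using \<epsilon> by simp
        have "\<epsilon>\<^sup>2 \<le> ?d\<^sup>2" using True \<epsilon> by (intro power_mono) auto
        then have "\<delta> + chord2 (x - y) \<le> 2 * ?d\<^sup>2"
          using \<delta> chord2_le[of ?d] by (simp add: chord2_torus_dist)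
        then have "(2 * ?d\<^sup>2) powr - \<gamma> \<le> riesz \<gamma> \<delta> (x - y)"
          unfolding riesz_def using \<beta> \<delta> chord2_bounds(1)[of "x - y"]
          by (intro powr_mono2') (auto simp: \<gamma>_def add_pos_nonneg)
        then have "2 powr \<gamma> * (2 * ?d\<^sup>2) powr - \<gamma> \<le> 2 powr \<gamma> * riesz \<gamma> \<delta> (x - y)" by simp
        moreover have "2 powr \<gamma> * (2 * ?d\<^sup>2) powr - \<gamma> = (?d\<^sup>2) powr - \<gamma>"
          using d by (simp add: powr_mult powr_minus)
        moreover have "(?d\<^sup>2) powr - \<gamma> = ?d powr (2 - \<beta>)"
          using d by (simp add: square_powr \<gamma>_def diff_divide_distrib)
        moreover have "?d powr (2 - \<beta>) = ?d\<^sup>2 / ?d powr \<beta>"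
          using d by (simp add: powr_diff)
        ultimately have "L * (?d\<^sup>2 / ?d powr \<beta>) \<le> L * (2 powr \<gamma> * riesz \<gamma> \<delta> (x - y))"
          using rl by (intro mult_left_mono) auto
        moreover have "\<phi> ?d * ?d\<^sup>2 \<le> L / ?d powr \<beta> * ?d\<^sup>2" using bnd[OF d] by (intro mult_right_mono) auto
        ultimately show ?thesis using True by (simp add: truncated_kernel_def)
      qed
    qed
    also have "\<dots> \<le> L * 2 powr \<gamma> * (\<bar>C\<bar> * (1 + t))"
    proof -
      have "C * (1 + t) \<le> \<bar>C\<bar> * (1 + t)" using t by (intro mult_right_mono) auto
      then have "A.pair_integral (\<lambda>x y. riesz \<gamma> \<delta> (x - y)) \<le> \<bar>C\<bar> * (1 + t)" using C[OF t \<delta>(1,2)] by (simp add: I_def)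
      then show ?thesis unfolding A.pair_integral_cmult using rl by (intro mult_left_mono) auto
    qed
    finally show ?thesis by (simp add: I_def d_def mult.assoc)
  qed
  show ?thesis
  proof (rule vanishing_of_variation[where J = J and G' = G' and M = "M 0"
        and G = "\<lambda>t. I t (\<lambda>x y. \<psi> (x - y) * (v x t - v y t))"])
    fix \<eta> :: real assume \<eta>: "\<eta> > 0"
    define \<kappa> where "\<kappa> = \<Lambda> * M 0 * d / (4 * \<eta>) + 1"
    have pos: "0 \<le> \<Lambda> * M 0 * d" using \<Lambda> M d by simp
    have \<kappa>: "\<kappa> > 0" using pos \<eta> by (simp add: \<kappa>_def add_nonneg_pos)
    have \<kappa>\<eta>: "\<Lambda> * M 0 * (d / (4 * \<kappa>)) \<le> \<eta>"
    proof -
      have "\<Lambda> * M 0 * d \<le> 4 * \<eta> * \<kappa>" using \<eta> by (simp add: \<kappa>_def distrib_left)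
      then show ?thesis using \<kappa> by (simp add: field_simps)
    qed
    show "\<exists>B\<ge>0. \<forall>t\<ge>0. G' t \<le> - V t + B * (1 + t) * J t + \<eta>"
    proof (intro exI[of _ "K + \<Lambda> * M 0 * \<kappa>"] conjI allI impI)
      show "0 \<le> K + \<Lambda> * M 0 * \<kappa>" using \<psi>(6) \<Lambda> M \<kappa> by simp
      fix t :: real assume t: "0 \<le> t"
      have "G' t \<le> - V t + K * J t + \<Lambda> * M 0 * ((1 + t) * \<kappa> * J t + d * (1 + t) / (4 * ((1 + t) * \<kappa>)))"
        by (rule G'(2)) (use t \<kappa> second_moment in auto)
      also have "d * (1 + t) / (4 * ((1 + t) * \<kappa>)) = d / (4 * \<kappa>)"
      proof -
        have "d * (1 + t) / (4 * ((1 + t) * \<kappa>)) = (1 + t) * d / ((1 + t) * (4 * \<kappa>))" by (simp only: mult_ac)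
        also have "\<dots> = d / (4 * \<kappa>)" using t by (intro nonzero_mult_divide_mult_cancel_left) auto
        finally show ?thesis .
      qed
      also have "\<Lambda> * M 0 * ((1 + t) * \<kappa> * J t + d / (4 * \<kappa>)) \<le> \<Lambda> * M 0 * \<kappa> * (1 + t) * J t + \<eta>"
        using \<kappa>\<eta> by (simp add: algebra_simps)
      also have "K * J t \<le> K * (1 + t) * J t"
        using mult_left_mono[of 1 "1 + t" "K * J t"] J_ge_0[OF t M] \<psi>(6) t by (simp add: mult_ac)
      finally show "G' t \<le> - V t + (K + \<Lambda> * M 0 * \<kappa>) * (1 + t) * J t + \<eta>" by (simp add: algebra_simps)
    qed
  next
    fix t :: real assume t: "t \<ge> 0"
    have "\<bar>I t (\<lambda>x y. \<psi> (x - y) * (v x t - v y t))\<bar> \<le> P * ((M 0)\<^sup>2 + V t)" by (rule corrector_bounded[OF t c\<psi> P])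
    also have "\<dots> \<le> P * ((M 0)\<^sup>2 + V 0)" using V_le[OF t M] P0 by (intro mult_left_mono) auto
    finally show "\<bar>I t (\<lambda>x y. \<psi> (x - y) * (v x t - v y t))\<bar> \<le> P * ((M 0)\<^sup>2 + V 0)" .
  qed (use M V_derivative G'(1) J_ge_0 V_nonneg in auto)
qed

end

section \<open>Decay of the variation\<close>

text \<open>The lower bound on the kernel is unbounded near \<open>0\<close>.\<close>

lemma power_singular_not_smooth:
  assumes \<beta>: "\<beta> > 0" and power: "power_singular \<phi> \<beta>"
  shows "\<not> smooth_kernel \<phi>"
proof
  assume "smooth_kernel \<phi>"
  then have "continuous_on {0..1} \<phi>" by (intro continuous_on_subset[OF smooth_kernel_continuous]) auto
  then have "bounded (\<phi> ` {0..1})" by (intro compact_imp_bounded compact_continuous_image) auto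
  then obtain B where "\<forall>y\<in>\<phi> ` {0..1}. norm y \<le> B" unfolding bounded_iff by blast
  then have B: "\<phi> r \<le> B" if "0 \<le> r" "r \<le> 1" for r using that by (simp add: abs_le_iff)
  obtain r0 l where rl: "r0 > 0" "l > 0" and lower: "\<And>r. 0 < r \<Longrightarrow> r < r0 \<Longrightarrow> l / r powr \<beta> \<le> \<phi> r"
    using power unfolding power_singular_def by (metis (full_types))
  define c where "c = (l / (\<bar>B\<bar> + 1)) powr (1 / \<beta>)"
  define r where "r = min c (min (r0 / 2) 1)"
  have c: "c > 0" using rl by (simp add: c_def)
  then have r: "0 < r" "r < r0" "r \<le> 1" "r \<le> c" using rl by (auto simp: r_def)
  have "r powr \<beta> \<le> c powr \<beta>" using r \<beta> by (intro powr_mono2) auto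
  also have "\<dots> = l / (\<bar>B\<bar> + 1)" using \<beta> rl by (simp add: c_def powr_powr)
  finally have "(\<bar>B\<bar> + 1) * r powr \<beta> \<le> l" by (simp add: field_simps add_pos_nonneg)
  then have "\<bar>B\<bar> + 1 \<le> l / r powr \<beta>" using r by (simp add: field_simps)
  also have "\<dots> \<le> B" using lower[OF r(1,2)] B[of r] r by simp
  finally show False by simp
qed

theorem theorem1p2:
  fixes \<phi> :: "real \<Rightarrow> real"
  assumes nonneg: "\<And>r. r > 0 \<Longrightarrow> \<phi> r \<ge> 0"
    and nontrivial: "nontrivial_kernel \<phi>"
    and kernel: "smooth_kernel \<phi> \<or> singular_kernel \<phi>"
  shows
    "(\<forall>A. \<exists>C. \<forall>\<^sub>F t in at_top. \<forall>N\<ge>1. \<forall>x v.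
        cs_solution \<phi> N x v \<and> velocity_spread_le N (\<lambda>i. v i 0) A \<longrightarrow>
        variation N (\<lambda>i. v i t) \<le> C * real N / t)
     \<and>
     (subquadratic \<phi> \<longrightarrow>
       (\<forall>A. \<exists>C. \<forall>\<^sub>F t in at_top. \<forall>N\<ge>1. \<forall>x v.
          cs_solution \<phi> N x v \<and> velocity_spread_le N (\<lambda>i. v i 0) A \<longrightarrow>
          variation N (\<lambda>i. v i t) \<le> C * (ln t / t)) \<and>
       (\<forall>\<rho>0 v0. \<exists>C. \<forall>\<^sub>F t in at_top. \<forall>\<rho> v.
          euler_alignment_solution \<phi> \<rho> v \<and> (\<forall>x. \<rho> x 0 = \<rho>0 x \<and> v x 0 = v0 x) \<longrightarrow>
          hydro_variation (\<lambda>x. \<rho> x t) (\<lambda>x. v x t) \<le> C * (ln t / t)))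
     \<and>
     (\<forall>\<beta>>2. power_singular \<phi> \<beta> \<longrightarrow>
       (\<forall>A. \<exists>R. (R \<longlongrightarrow> 0) at_top \<and> (\<forall>N\<ge>1. \<forall>x v.
          cs_solution \<phi> N x v \<and> velocity_spread_le N (\<lambda>i. v i 0) A \<longrightarrow>
          (\<forall>t\<ge>0. variation N (\<lambda>i. v i t) \<le> R t))) \<and>
       (\<beta> < 3 \<longrightarrow> (\<forall>\<rho> v. euler_alignment_solution \<phi> \<rho> v \<longrightarrow>
          ((\<lambda>t. hydro_variation (\<lambda>x. \<rho> x t) (\<lambda>x. v x t)) \<longlongrightarrow> 0) at_top)))"
proof (intro conjI impI allI)
  have cont: "continuous_on {0<..} \<phi>" using kernel by (rule kernel_continuous)
  obtain \<psi> g K \<Lambda> where cor: "is_corrector \<phi> \<psi> g K \<Lambda>"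
    using corrector_exists[OF cont nonneg nontrivial] .
  have flow: "euler_flow \<phi> \<rho> v" if "euler_alignment_solution \<phi> \<rho> v" for \<rho> v
    using that cont nonneg by (simp add: euler_flow_def)

  show "\<exists>C. \<forall>\<^sub>F t in at_top. \<forall>N\<ge>1. \<forall>x v.
      cs_solution \<phi> N x v \<and> velocity_spread_le N (\<lambda>i. v i 0) A \<longrightarrow>
      variation N (\<lambda>i. v i t) \<le> C * real N / t" for A
    using kernel
  proof
    assume "smooth_kernel \<phi>"
    from smooth_N_decay[OF this nonneg nontrivial, of A] obtain C where C: "\<forall>t\<ge>1. \<forall>N\<ge>1. \<forall>x v.
        cs_solution \<phi> N x v \<and> velocity_spread_le N (\<lambda>i. v i 0) A \<longrightarrow>
        variation N (\<lambda>i. v i t) \<le> C * real N / t" by blast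
    show ?thesis
      by (rule exI[of _ C], rule eventually_mono[OF eventually_ge_at_top[of 1]]) (use C in blast)
  next
    assume sing: "singular_kernel \<phi>"
    show ?thesis
    proof (rule exI[of _ "4 * pi\<^sup>2"], rule eventually_mono[OF eventually_ge_at_top[of 1]], intro allI impI)
      fix t :: real and N :: nat and x v
      assume t: "1 \<le> t" and N: "1 \<le> N" and "cs_solution \<phi> N x v \<and> velocity_spread_le N (\<lambda>i. v i 0) A"
      then have "variation N (\<lambda>i. v i t) \<le> 4 * pi\<^sup>2 / t\<^sup>2"
        using variation_decay_singular[OF _ sing nonneg N, of x v t] by simp
      also have "\<dots> = 4 * pi\<^sup>2 * (1 / t) / t" by (simp add: power2_eq_square)
      also have "\<dots> \<le> 4 * pi\<^sup>2 * real N / t"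
        using t N by (intro divide_right_mono mult_left_mono) (auto intro: order_trans[of _ 1])
      finally show "variation N (\<lambda>i. v i t) \<le> 4 * pi\<^sup>2 * real N / t" .
    qed
  qed

  show "\<exists>C. \<forall>\<^sub>F t in at_top. \<forall>N\<ge>1. \<forall>x v.
      cs_solution \<phi> N x v \<and> velocity_spread_le N (\<lambda>i. v i 0) A \<longrightarrow>
      variation N (\<lambda>i. v i t) \<le> C * (ln t / t)" for A
    using kernel
  proof
    assume "smooth_kernel \<phi>"
    from smooth_log_decay[OF this nonneg nontrivial, of A] obtain C where C: "\<forall>t\<ge>exp 1. \<forall>N\<ge>1. \<forall>x v.
        cs_solution \<phi> N x v \<and> velocity_spread_le N (\<lambda>i. v i 0) A \<longrightarrow>
        variation N (\<lambda>i. v i t) \<le> C * (ln t / t)" by blast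
    show ?thesis
      by (rule exI[of _ C], rule eventually_mono[OF eventually_ge_at_top[of "exp 1"]]) (use C in blast)
  next
    assume sing: "singular_kernel \<phi>"
    show ?thesis
    proof (rule exI[of _ "4 * pi\<^sup>2"], rule eventually_mono[OF eventually_ge_at_top[of "exp 1"]], intro allI impI)
      fix t :: real and N :: nat and x v
      assume t: "exp 1 \<le> t" and N: "1 \<le> N" and sol: "cs_solution \<phi> N x v \<and> velocity_spread_le N (\<lambda>i. v i 0) A"
      have t1: "t \<ge> 1" using t one_le_exp_iff[of 1] by linarith
      then have ln1: "ln t \<ge> 1" using t ln_ge_iff[of t 1] by simp
      have "variation N (\<lambda>i. v i t) \<le> 4 * pi\<^sup>2 / t\<^sup>2"
        using variation_decay_singular[OF _ sing nonneg N, of x v t] sol t1 by simp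
      also have "\<dots> = 4 * pi\<^sup>2 * ((1 / t) / t)" by (simp add: power2_eq_square)
      also have "\<dots> \<le> 4 * pi\<^sup>2 * (ln t / t)"
        using t1 ln1 by (intro divide_right_mono mult_left_mono) (auto intro: order_trans[of _ 1])
      finally show "variation N (\<lambda>i. v i t) \<le> 4 * pi\<^sup>2 * (ln t / t)" .
    qed
  qed

  show "\<exists>C. \<forall>\<^sub>F t in at_top. \<forall>\<rho> v.
      euler_alignment_solution \<phi> \<rho> v \<and> (\<forall>x. \<rho> x 0 = \<rho>0 x \<and> v x 0 = v0 x) \<longrightarrow>
      hydro_variation (\<lambda>x. \<rho> x t) (\<lambda>x. v x t) \<le> C * (ln t / t)" if sub: "subquadratic \<phi>" for \<rho>0 v0
  proof -
    obtain B where B: "B \<ge> 0" "\<And>r. 0 < r \<Longrightarrow> r \<le> pi \<Longrightarrow> \<phi> r * r\<^sup>2 \<le> B"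
      using subquadratic_bound[OF cont sub] by blast
    define m where "m = measure (mass_measure \<rho>0) UNIV"
    define V0 where "V0 = hydro_variation \<rho>0 v0"
    show ?thesis
    proof (rule exI[of _ "V0 + K / (2 * m) * V0 + 2 * (\<Lambda> * pi * (m\<^sup>2 + V0)) + \<Lambda> * m * (B * m\<^sup>2) * \<Lambda> / 4"],
        rule eventually_mono[OF eventually_ge_at_top[of "exp 1"]], intro allI impI)
      fix t :: real and \<rho> v
      assume t: "exp 1 \<le> t" and sol: "euler_alignment_solution \<phi> \<rho> v \<and> (\<forall>x. \<rho> x 0 = \<rho>0 x \<and> v x 0 = v0 x)"
      then interpret E: euler_flow \<phi> \<rho> v using flow by blast
      have "(\<lambda>x. \<rho> x 0) = \<rho>0" "(\<lambda>x. v x 0) = v0" using sol by auto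
      then have "E.M 0 = m" "E.V 0 = V0" by (simp_all add: E.M_def E.V_def E.\<mu>_def m_def V0_def)
      with E.log_decay[OF cor B t] show "hydro_variation (\<lambda>x. \<rho> x t) (\<lambda>x. v x t)
        \<le> (V0 + K / (2 * m) * V0 + 2 * (\<Lambda> * pi * (m\<^sup>2 + V0)) + \<Lambda> * m * (B * m\<^sup>2) * \<Lambda> / 4) * (ln t / t)"
        by (simp add: E.V_def)
    qed
  qed

  show "\<exists>R. (R \<longlongrightarrow> 0) at_top \<and> (\<forall>N\<ge>1. \<forall>x v.
      cs_solution \<phi> N x v \<and> velocity_spread_le N (\<lambda>i. v i 0) A \<longrightarrow>
      (\<forall>t\<ge>0. variation N (\<lambda>i. v i t) \<le> R t))" if \<beta>: "\<beta> > 2" and power: "power_singular \<phi> \<beta>" for \<beta> A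
  proof -
    have sing: "singular_kernel \<phi>" using power_singular_not_smooth[OF _ power] \<beta> kernel by simp
    define R where "R t = (if t < 1 then A\<^sup>2 else 4 * pi\<^sup>2 / t\<^sup>2)" for t :: real
    have "((\<lambda>t::real. 4 * pi\<^sup>2 / t\<^sup>2) \<longlongrightarrow> 0) at_top"
      by (intro tendsto_divide_0[OF tendsto_const] filterlim_at_top_imp_at_infinity filterlim_pow_at_top filterlim_ident) simp
    moreover have "\<forall>\<^sub>F t in at_top. 4 * pi\<^sup>2 / t\<^sup>2 = R t"
      using eventually_ge_at_top[of 1] by eventually_elim (simp add: R_def)
    ultimately have "(R \<longlongrightarrow> 0) at_top" by (rule Lim_transform_eventually)
    moreover have "variation N (\<lambda>i. v i t) \<le> R t"
      if N: "N \<ge> 1" and sol: "cs_solution \<phi> N x v" and A: "velocity_spread_le N (\<lambda>i. v i 0) A" and t: "t \<ge> 0" for N x v t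
    proof (cases "t < 1")
      case False
      then show ?thesis using variation_decay_singular[OF sol sing nonneg N, of t] by (simp add: R_def)
    next
      case True
      have "variation N (\<lambda>i. v i t) \<le> variation N (\<lambda>i. v i 0)"
      proof (rule variation_nonincreasing[OF sol N])
        fix i j and s :: real assume ij: "i \<in> {1..N}" "j \<in> {1..N}" "i \<noteq> j" and s: "0 \<le> s"
        have "torus_dist (x i s) (x j s) \<noteq> 0"
          using no_collision[OF sol sing nonneg ij s] by (simp add: torus_dist_eq_0_iff)
        then show "0 \<le> \<phi> (torus_dist (x i s) (x j s))"
          using nonneg torus_dist_bounds(1)[of "x i s" "x j s"] by simp
      qed (use t in auto)
      also have "\<dots> \<le> A\<^sup>2" by (rule variation_initial_le[OF A N])
      finally show ?thesis using True by (simp add: R_def)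
    qed
    ultimately show ?thesis by blast
  qed

  show "((\<lambda>t. hydro_variation (\<lambda>x. \<rho> x t) (\<lambda>x. v x t)) \<longlongrightarrow> 0) at_top"
    if \<beta>: "\<beta> > 2" "\<beta> < 3" and power: "power_singular \<phi> \<beta>" and sol: "euler_alignment_solution \<phi> \<rho> v" for \<beta> \<rho> v
  proof -
    interpret E: euler_flow \<phi> \<rho> v using flow[OF sol] .
    show ?thesis using E.alignment_strongly_singular[OF \<beta> power cor] by (simp add: E.V_def[abs_def])
  qed
qed

end
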